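(* Let $G$ be a compact Abelian group with dual group $\Gamma$, let $f\in C(G)$, $0<s\le 1$ and $1/r=1/s-1$ (so $r=\infty$ if $s=1$). Consider the convolution operator $\star f: M(G)\to C(G)$. The family of Fourier coefficients $\hat f=(\hat f(\gamma))_{\gamma\in\Gamma}$ belongs to $l_s(\Gamma)$ (i.e. $\sum_{\gamma}|\hat f(\gamma)|^s<\infty$) if and only if the operator $\star f$ can be factored through a Schatten $S_r$-operator in a Hilbert space.
   Context: All Banach spaces are complex. $C(G)$ is the space of continuous complex functions on $G$ with the sup norm; $M(G)=C(G)^*$ is the Banach space of finite regular Borel complex measures on $G$ with the variation norm; $m$ is the normalized Haar measure; $\Gamma$ is the (discrete) group of characters of $G$. The convolution operator $\star f$ is $(\star f)(\mu)(g)=\int_G f(g-h)\,d\mu(h)$, $g\in G$. Fourier coefficients: $\hat f(\gamma)=\int_G\overline{\gamma(h)}f(h)\,dm(h)$. For a Hilbert space $H$ and $0<r<\infty$, $S_r(H)$ is the Schatten class of compact operators on $H$ whose sequence of singular numbers lies in $l_r$; $S_\infty(H)$ is understood as the class $L(H)$ of all bounded operators on $H$ (so factoring through an $S_\infty$-operator means factoring through a Hilbert space). An operator $T\in L(X,Y)$ can be factored through an $S_r$-operator if there are a Hilbert space $H$, an operator $U\in S_r(H)$ and bounded operators $B: X\to H$, $A: H\to Y$ with $T=AUB$. *)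

theory Defs
  imports "HOL-Analysis.Analysis"
begin

section \<open>Complex normed spaces, Hilbert spaces and bounded operators\<close>

class scaleC =
  fixes scaleC :: "complex \<Rightarrow> 'a \<Rightarrow> 'a" (infixr \<open>*\<^sub>C\<close> 75)

class complex_normed_vector = real_normed_vector + scaleC +
  assumes scaleC_add_right: "a *\<^sub>C (x + y) = a *\<^sub>C x + a *\<^sub>C y"
    and scaleC_add_left: "(a + b) *\<^sub>C x = a *\<^sub>C x + b *\<^sub>C x"
    and scaleC_scaleC: "a *\<^sub>C b *\<^sub>C x = (a * b) *\<^sub>C x"
    and scaleR_scaleC: "scaleR r x = complex_of_real r *\<^sub>C x"
    and norm_scaleC: "norm (a *\<^sub>C x) = cmod a * norm x"

text \<open>The inner product is linear in the first argument. Topology, norm and real inner product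
  are those of \<^class>\<open>real_inner\<close>; hence \<open>norm x = sqrt (Re (cinner x x))\<close>, and positive
  definiteness of \<open>cinner\<close> is inherited.\<close>

class complex_hilbert = complex_normed_vector + real_inner + complete_space +
  fixes cinner :: "'a \<Rightarrow> 'a \<Rightarrow> complex"
  assumes cinner_commute: "cinner x y = cnj (cinner y x)"
    and cinner_add_left: "cinner (x + y) z = cinner x z + cinner y z"
    and cinner_scaleC_left: "cinner (a *\<^sub>C x) y = a * cinner x y"
    and inner_eq_Re_cinner: "inner x y = Re (cinner x y)"

global_interpretation cvec: vector_space "scaleC :: complex \<Rightarrow> 'a \<Rightarrow> 'a::complex_normed_vector"
proof
  fix x :: 'a
  show "1 *\<^sub>C x = x"
    using scaleR_scaleC[of 1 x] by simp
qed (simp_all add: scaleC_add_right scaleC_add_left scaleC_scaleC)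

definition bounded_clinear ::
    "('a::complex_normed_vector \<Rightarrow> 'b::complex_normed_vector) \<Rightarrow> bool" where
  "bounded_clinear T \<longleftrightarrow> bounded_linear T \<and> (\<forall>c x. T (c *\<^sub>C x) = c *\<^sub>C T x)"

definition compact_operator ::
    "('a::complex_normed_vector \<Rightarrow> 'b::complex_normed_vector) \<Rightarrow> bool" where
  "compact_operator T \<longleftrightarrow> bounded_clinear T \<and> compact (closure (T ` cball 0 1))"

definition cadjoint :: "('a::complex_hilbert \<Rightarrow> 'b::complex_hilbert) \<Rightarrow> 'b \<Rightarrow> 'a" where
  "cadjoint T = (THE S. \<forall>x y. cinner (T x) y = cinner x (S y))"


section \<open>Schatten classes\<close>

text \<open>The sequence \<open>\<sigma>\<close> lists the square roots of the nonzero eigenvalues of \<open>U\<^sup>*U\<close>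
  in decreasing order and according to multiplicity, followed by zeros if there are only
  finitely many. For compact \<open>U\<close> there is exactly one such sequence. (\<open>cvec.dim\<close> and
  \<open>card\<close> are \<open>0\<close> on infinite-dimensional spaces and infinite sets, but for compact \<open>U\<close> and
  \<open>\<sigma> \<longlonglongrightarrow> 0\<close> neither occurs when \<open>t > 0\<close>.)\<close>

definition is_singular_numbers ::
    "('h::complex_hilbert \<Rightarrow> 'h) \<Rightarrow> (nat \<Rightarrow> real) \<Rightarrow> bool" where
  "is_singular_numbers U \<sigma> \<longleftrightarrow>
     (\<forall>n. 0 \<le> \<sigma> n) \<and> decseq \<sigma> \<and> \<sigma> \<longlonglongrightarrow> 0 \<and>
     (\<forall>t>0. card {n. \<sigma> n = t} =
        cvec.dim {x. cadjoint U (U x) = complex_of_real (t\<^sup>2) *\<^sub>C x})"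

definition schatten_class :: "ereal \<Rightarrow> ('h::complex_hilbert \<Rightarrow> 'h) set" where
  "schatten_class r =
     (if r = \<infinity> then {U. bounded_clinear U}
      else {U. compact_operator U \<and>
         (\<exists>\<sigma>. is_singular_numbers U \<sigma> \<and> summable (\<lambda>n. \<sigma> n powr real_of_ereal r))})"

text \<open>A HOL formula cannot quantify existentially over types, so the type of the Hilbert space
  \<open>H\<close> is a parameter here. For operators into \<open>C(G)\<close> with \<open>G\<close> of type \<open>'g\<close>, the single space
  \<open>('g \<Rightarrow> complex) ell2\<close> (defined below) stands for all Hilbert spaces: given a factorization
  \<open>A U B\<close> through any \<open>H\<close>, let \<open>P\<close> be the projection onto the orthogonal complement \<open>K\<close> of the
  kernel of \<open>A\<close> and write \<open>P U = V W\<close> (polar decomposition) with \<open>V \<in> S\<^sub>r(K)\<close> and \<open>W : H \<rightarrow> K\<close>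
  bounded. Then \<open>A U B = A V (W B)\<close> factors through \<open>K\<close>, and as \<open>A\<close> maps \<open>K\<close> injectively into
  \<open>C(G)\<close>, an orthonormal basis of \<open>K\<close> is no larger than the set of functions \<open>'g \<Rightarrow> complex\<close>.\<close>

definition factors_through_schatten ::
    "'h::complex_hilbert itself \<Rightarrow> ereal \<Rightarrow>
     ('x::complex_normed_vector \<Rightarrow> 'y::complex_normed_vector) \<Rightarrow> bool" where
  "factors_through_schatten _ r T \<longleftrightarrow>
     (\<exists>(B :: 'x \<Rightarrow> 'h) (U :: 'h \<Rightarrow> 'h) (A :: 'h \<Rightarrow> 'y).
        bounded_clinear B \<and> U \<in> schatten_class r \<and> bounded_clinear A \<and> T = A \<circ> U \<circ> B)"


section \<open>The Hilbert space of square-summable families\<close>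

typedef 'i ell2 = "{x :: 'i \<Rightarrow> complex. (\<lambda>i. (cmod (x i))\<^sup>2) summable_on UNIV}"
  morphisms ell2_nth Abs_ell2
  by (rule exI[of _ "\<lambda>_. 0"]) simp

setup_lifting type_definition_ell2

lemma ell2_add_summable:
  fixes x y :: "'i \<Rightarrow> complex"
  assumes "(\<lambda>i. (cmod (x i))\<^sup>2) summable_on UNIV" "(\<lambda>i. (cmod (y i))\<^sup>2) summable_on UNIV"
  shows "(\<lambda>i. (cmod (x i + y i))\<^sup>2) summable_on UNIV"
proof -
  have "(\<lambda>i. 2 * (cmod (x i))\<^sup>2 + 2 * (cmod (y i))\<^sup>2) summable_on UNIV"
    by (intro summable_on_add summable_on_cmult_right assms)
  then show ?thesis
  proof (rule summable_on_comparison_test)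
    fix i
    have "(cmod (x i + y i))\<^sup>2 \<le> (cmod (x i) + cmod (y i))\<^sup>2"
      by (intro power_mono norm_triangle_ineq) auto
    also have "\<dots> \<le> 2 * (cmod (x i))\<^sup>2 + 2 * (cmod (y i))\<^sup>2"
      using sum_squares_bound[of "cmod (x i)" "cmod (y i)"] by (simp add: power2_sum)
    finally show "(cmod (x i + y i))\<^sup>2 \<le> 2 * (cmod (x i))\<^sup>2 + 2 * (cmod (y i))\<^sup>2" .
  qed auto
qed

lemma ell2_scale_summable:
  fixes x :: "'i \<Rightarrow> complex"
  assumes "(\<lambda>i. (cmod (x i))\<^sup>2) summable_on UNIV"
  shows "(\<lambda>i. (cmod (c * x i))\<^sup>2) summable_on UNIV"
  using summable_on_cmult_right[OF assms, of "(cmod c)\<^sup>2"] by (simp add: norm_mult power_mult_distrib)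

lemma ell2_mult_summable:
  fixes x y :: "'i \<Rightarrow> complex"
  assumes "(\<lambda>i. (cmod (x i))\<^sup>2) summable_on UNIV" "(\<lambda>i. (cmod (y i))\<^sup>2) summable_on UNIV"
  shows "(\<lambda>i. x i * cnj (y i)) summable_on UNIV"
proof (rule abs_summable_summable)
  have "(\<lambda>i. (cmod (x i))\<^sup>2 + (cmod (y i))\<^sup>2) summable_on UNIV"
    by (intro summable_on_add assms)
  then show "(\<lambda>i. cmod (x i * cnj (y i))) summable_on UNIV"
  proof (rule summable_on_comparison_test)
    fix i
    have "0 \<le> cmod (x i) * cmod (y i)" by simp
    then show "cmod (x i * cnj (y i)) \<le> (cmod (x i))\<^sup>2 + (cmod (y i))\<^sup>2"
      using sum_squares_bound[of "cmod (x i)" "cmod (y i)"]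
      unfolding norm_mult complex_mod_cnj by linarith
  qed auto
qed

instantiation ell2 :: (type) real_vector
begin

lift_definition zero_ell2 :: "'a ell2" is "\<lambda>_. 0" by simp
lift_definition plus_ell2 :: "'a ell2 \<Rightarrow> 'a ell2 \<Rightarrow> 'a ell2" is "\<lambda>x y i. x i + y i"
  by (rule ell2_add_summable)
lift_definition uminus_ell2 :: "'a ell2 \<Rightarrow> 'a ell2" is "\<lambda>x i. - x i" by simp
lift_definition minus_ell2 :: "'a ell2 \<Rightarrow> 'a ell2 \<Rightarrow> 'a ell2" is "\<lambda>x y i. x i - y i"
  subgoal for x y using ell2_add_summable[of x "\<lambda>i. - y i"] by simp
  done
lift_definition scaleR_ell2 :: "real \<Rightarrow> 'a ell2 \<Rightarrow> 'a ell2" is "\<lambda>r x i. complex_of_real r * x i"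
  by (rule ell2_scale_summable)

instance
  by standard (transfer; simp add: algebra_simps fun_eq_iff)+

end

instantiation ell2 :: (type) scaleC
begin
lift_definition scaleC_ell2 :: "complex \<Rightarrow> 'a ell2 \<Rightarrow> 'a ell2" is "\<lambda>c x i. c * x i"
  by (rule ell2_scale_summable)
instance ..
end

lift_definition cinner_ell2_aux :: "'i ell2 \<Rightarrow> 'i ell2 \<Rightarrow> complex"
  is "\<lambda>x y. \<Sum>\<^sub>\<infinity>i. x i * cnj (y i)" .

lemma ell2_nth_simps [simp]:
  "ell2_nth 0 i = 0"
  "ell2_nth (x + y) i = ell2_nth x i + ell2_nth y i"
  "ell2_nth (x - y) i = ell2_nth x i - ell2_nth y i"
  "ell2_nth (- x) i = - ell2_nth x i"
  "ell2_nth (r *\<^sub>R x) i = complex_of_real r * ell2_nth x i"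
  "ell2_nth (c *\<^sub>C x) i = c * ell2_nth x i"
  by (transfer; simp)+

lemma ell2_eqI: "(\<And>i. ell2_nth x i = ell2_nth y i) \<Longrightarrow> x = y"
  by transfer auto

lemma ell2_sq_summable: "(\<lambda>i. (cmod (ell2_nth x i))\<^sup>2) summable_on UNIV"
  using ell2_nth[of x] by simp

lemma ell2_prod_summable: "(\<lambda>i. ell2_nth x i * cnj (ell2_nth y i)) summable_on UNIV"
  by (intro ell2_mult_summable ell2_sq_summable)

lemma cinner_ell2_aux_add: "cinner_ell2_aux (x + y) z = cinner_ell2_aux x z + cinner_ell2_aux y z"
  unfolding cinner_ell2_aux.rep_eq
  by (simp add: distrib_right infsum_add ell2_prod_summable)

lemma cinner_ell2_aux_scale: "cinner_ell2_aux (c *\<^sub>C x) y = c * cinner_ell2_aux x y"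
  unfolding cinner_ell2_aux.rep_eq by (simp add: mult.assoc infsum_cmult_right')

lemma cinner_ell2_aux_commute: "cinner_ell2_aux x y = cnj (cinner_ell2_aux y x)"
  unfolding cinner_ell2_aux.rep_eq by (simp add: mult.commute flip: infsum_cnj)

lemma cinner_ell2_aux_self:
  "cinner_ell2_aux x x = complex_of_real (\<Sum>\<^sub>\<infinity>i. (cmod (ell2_nth x i))\<^sup>2)"
proof -
  have "(\<Sum>\<^sub>\<infinity>i. ell2_nth x i * cnj (ell2_nth x i))
      = (\<Sum>\<^sub>\<infinity>i. complex_of_real ((cmod (ell2_nth x i))\<^sup>2))"
    by (simp add: complex_norm_square del: of_real_power)
  also have "\<dots> = complex_of_real (\<Sum>\<^sub>\<infinity>i. (cmod (ell2_nth x i))\<^sup>2)"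
    by (rule infsumI)
      (intro has_sum_bounded_linear[OF bounded_linear_of_real] has_sum_infsum ell2_sq_summable)
  finally show ?thesis
    unfolding cinner_ell2_aux.rep_eq .
qed

lemma scaleR_ell2_scaleC: "r *\<^sub>R (x::'i ell2) = complex_of_real r *\<^sub>C x"
  by (rule ell2_eqI) simp

instantiation ell2 :: (type) real_inner
begin

definition inner_ell2 :: "'a ell2 \<Rightarrow> 'a ell2 \<Rightarrow> real" where
  "inner_ell2 x y = Re (cinner_ell2_aux x y)"
definition norm_ell2 :: "'a ell2 \<Rightarrow> real" where
  "norm_ell2 x = sqrt (inner x x)"
definition dist_ell2 :: "'a ell2 \<Rightarrow> 'a ell2 \<Rightarrow> real" where
  "dist_ell2 x y = norm (x - y)"
definition sgn_ell2 :: "'a ell2 \<Rightarrow> 'a ell2" where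
  "sgn_ell2 x = inverse (norm x) *\<^sub>R x"
definition uniformity_ell2 :: "('a ell2 \<times> 'a ell2) filter" where
  "uniformity_ell2 = (INF e\<in>{0 <..}. principal {(x, y). dist x y < e})"
definition open_ell2 :: "'a ell2 set \<Rightarrow> bool" where
  "open_ell2 S = (\<forall>x\<in>S. \<forall>\<^sub>F (x', y) in uniformity. x' = x \<longrightarrow> y \<in> S)"

instance
proof
  fix x y z :: "'a ell2" and r :: real
  show "inner x y = inner y x"
    unfolding inner_ell2_def by (subst cinner_ell2_aux_commute) simp
  show "inner (x + y) z = inner x z + inner y z"
    unfolding inner_ell2_def by (simp add: cinner_ell2_aux_add)
  show "inner (r *\<^sub>R x) y = r * inner x y"
    unfolding inner_ell2_def by (simp add: scaleR_ell2_scaleC cinner_ell2_aux_scale)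
  show "0 \<le> inner x x"
    unfolding inner_ell2_def by (simp add: cinner_ell2_aux_self infsum_nonneg)
  show "inner x x = 0 \<longleftrightarrow> x = 0"
  proof
    assume "inner x x = 0"
    then have *: "(\<Sum>\<^sub>\<infinity>i. (cmod (ell2_nth x i))\<^sup>2) = 0"
      by (simp add: inner_ell2_def cinner_ell2_aux_self)
    have "(cmod (ell2_nth x i))\<^sup>2 = 0" for i
      by (rule nonneg_infsum_le_0D[where A = UNIV]) (use * ell2_sq_summable in auto)
    then show "x = 0"
      by (intro ell2_eqI) simp
  qed (simp add: inner_ell2_def cinner_ell2_aux.rep_eq)
qed (rule norm_ell2_def dist_ell2_def sgn_ell2_def uniformity_ell2_def open_ell2_def)+

end

lemma norm_ell2_sq: "(norm (x::'i ell2))\<^sup>2 = (\<Sum>\<^sub>\<infinity>i. (cmod (ell2_nth x i))\<^sup>2)"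
  by (simp add: power2_norm_eq_inner inner_ell2_def cinner_ell2_aux_self)

lemma ell2_sum_le_norm:
  assumes "finite F"
  shows "(\<Sum>i\<in>F. (cmod (ell2_nth x i))\<^sup>2) \<le> (norm x)\<^sup>2"
  unfolding norm_ell2_sq by (rule finite_sum_le_infsum) (use assms ell2_sq_summable in auto)

lemma ell2_nth_le_norm: "cmod (ell2_nth x i) \<le> norm x"
  using ell2_sum_le_norm[of "{i}" x] by (simp add: power2_le_iff_abs_le)

instance ell2 :: (type) complete_space
proof
  fix X :: "nat \<Rightarrow> 'a ell2"
  assume C: "Cauchy X"
  have "Cauchy (\<lambda>n. ell2_nth (X n) i)" for i
  proof (rule metric_CauchyI)
    fix e :: real assume "e > 0"
    then obtain N where N: "\<And>m n. m \<ge> N \<Longrightarrow> n \<ge> N \<Longrightarrow> dist (X m) (X n) < e"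
      using metric_CauchyD[OF C] by blast
    have "dist (ell2_nth (X m) i) (ell2_nth (X n) i) \<le> dist (X m) (X n)" for m n
      using ell2_nth_le_norm[of "X m - X n" i] by (simp add: dist_norm)
    then show "\<exists>N. \<forall>m\<ge>N. \<forall>n\<ge>N. dist (ell2_nth (X m) i) (ell2_nth (X n) i) < e"
      using N by (meson le_less_trans)
  qed
  then have "\<forall>i. \<exists>l. (\<lambda>n. ell2_nth (X n) i) \<longlonglongrightarrow> l"
    by (simp add: Cauchy_convergent_iff convergent_def)
  then obtain y where y: "\<And>i. (\<lambda>n. ell2_nth (X n) i) \<longlonglongrightarrow> y i"
    by metis
  have bound: "\<exists>N. \<forall>n\<ge>N. \<forall>F. finite F \<longrightarrow> (\<Sum>i\<in>F. (cmod (ell2_nth (X n) i - y i))\<^sup>2) \<le> e\<^sup>2"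
    if "e > 0" for e
  proof -
    obtain N where N: "\<And>m n. m \<ge> N \<Longrightarrow> n \<ge> N \<Longrightarrow> dist (X m) (X n) < e"
      using metric_CauchyD[OF C] \<open>e > 0\<close> by blast
    have "(\<Sum>i\<in>F. (cmod (ell2_nth (X n) i - y i))\<^sup>2) \<le> e\<^sup>2" if "n \<ge> N" "finite F" for n F
    proof (rule LIMSEQ_le_const2)
      show "(\<lambda>m. \<Sum>i\<in>F. (cmod (ell2_nth (X n) i - ell2_nth (X m) i))\<^sup>2)
              \<longlonglongrightarrow> (\<Sum>i\<in>F. (cmod (ell2_nth (X n) i - y i))\<^sup>2)"
        by (intro tendsto_intros y)
      show "\<exists>N. \<forall>m\<ge>N. (\<Sum>i\<in>F. (cmod (ell2_nth (X n) i - ell2_nth (X m) i))\<^sup>2) \<le> e\<^sup>2"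
      proof (intro exI allI impI)
        fix m assume "m \<ge> N"
        have "(\<Sum>i\<in>F. (cmod (ell2_nth (X n - X m) i))\<^sup>2) \<le> (norm (X n - X m))\<^sup>2"
          by (rule ell2_sum_le_norm) fact
        also have "\<dots> \<le> e\<^sup>2"
          using N[OF \<open>n \<ge> N\<close> \<open>m \<ge> N\<close>] by (intro power_mono) (auto simp: dist_norm)
        finally show "(\<Sum>i\<in>F. (cmod (ell2_nth (X n) i - ell2_nth (X m) i))\<^sup>2) \<le> e\<^sup>2"
          by simp
      qed
    qed
    then show ?thesis by blast
  qed
  have diff_summable: "(\<lambda>i. (cmod (ell2_nth (X n) i - y i))\<^sup>2) summable_on UNIV"
    if "\<forall>F. finite F \<longrightarrow> (\<Sum>i\<in>F. (cmod (ell2_nth (X n) i - y i))\<^sup>2) \<le> b" for n b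
    by (rule nonneg_bdd_above_summable_on) (use that in \<open>auto simp: bdd_above_def\<close>)
  obtain N where "\<forall>F. finite F \<longrightarrow> (\<Sum>i\<in>F. (cmod (ell2_nth (X N) i - y i))\<^sup>2) \<le> 1\<^sup>2"
    using bound[of 1] by auto
  note s = diff_summable[OF this]
  have "(\<lambda>i. (cmod (y i))\<^sup>2) summable_on UNIV"
    using ell2_add_summable[OF ell2_sq_summable[of "X N"], of "\<lambda>i. - (ell2_nth (X N) i - y i)"] s
    by (simp only: norm_minus_cancel) (simp add: algebra_simps)
  then have nth: "ell2_nth (Abs_ell2 y) = y"
    by (simp add: Abs_ell2_inverse)
  have "X \<longlonglongrightarrow> Abs_ell2 y"
  proof (rule metric_LIMSEQ_I)
    fix e :: real assume "e > 0"
    then obtain N where N: "\<forall>n\<ge>N. \<forall>F. finite F \<longrightarrow>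
        (\<Sum>i\<in>F. (cmod (ell2_nth (X n) i - y i))\<^sup>2) \<le> (e/2)\<^sup>2"
      using bound[of "e/2"] by auto
    have "dist (X n) (Abs_ell2 y) < e" if "n \<ge> N" for n
    proof -
      have "(norm (X n - Abs_ell2 y))\<^sup>2 \<le> (e/2)\<^sup>2"
        unfolding norm_ell2_sq
        by (rule infsum_le_finite_sums[OF ell2_sq_summable]) (use N that in \<open>auto simp: nth\<close>)
      then have "norm (X n - Abs_ell2 y) \<le> e/2"
        by (rule power2_le_imp_le) (use \<open>e > 0\<close> in auto)
      then show ?thesis
        using \<open>e > 0\<close> by (simp add: dist_norm)
    qed
    then show "\<exists>N. \<forall>n\<ge>N. dist (X n) (Abs_ell2 y) < e" by blast
  qed
  then show "convergent X"
    by (auto simp: convergent_def)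
qed

instantiation ell2 :: (type) complex_hilbert
begin

definition cinner_ell2 :: "'a ell2 \<Rightarrow> 'a ell2 \<Rightarrow> complex" where
  "cinner_ell2 = cinner_ell2_aux"

instance
proof
  fix x y z :: "'a ell2" and a b :: complex and r :: real
  show "a *\<^sub>C (x + y) = a *\<^sub>C x + a *\<^sub>C y" "(a + b) *\<^sub>C x = a *\<^sub>C x + b *\<^sub>C x"
    "a *\<^sub>C b *\<^sub>C x = (a * b) *\<^sub>C x"
    by (rule ell2_eqI, simp add: algebra_simps)+
  show "r *\<^sub>R x = complex_of_real r *\<^sub>C x"
    by (rule scaleR_ell2_scaleC)
  show "norm (a *\<^sub>C x) = cmod a * norm x"
  proof (rule power2_eq_imp_eq)
    show "(norm (a *\<^sub>C x))\<^sup>2 = (cmod a * norm x)\<^sup>2"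
      by (simp add: norm_ell2_sq power_mult_distrib norm_mult infsum_cmult_right')
  qed auto
qed (auto simp: cinner_ell2_def inner_ell2_def cinner_ell2_aux_add cinner_ell2_aux_scale
     intro: cinner_ell2_aux_commute)

end


section \<open>The space of continuous functions\<close>

text \<open>On a compact space, the type \<open>'g \<Rightarrow>\<^sub>C complex\<close> with its supremum norm is \<open>C(G)\<close>.\<close>

setup_lifting type_definition_bcontfun

instantiation bcontfun :: (topological_space, complex_normed_vector) complex_normed_vector
begin

lift_definition scaleC_bcontfun :: "complex \<Rightarrow> ('a \<Rightarrow>\<^sub>C 'b) \<Rightarrow> 'a \<Rightarrow>\<^sub>C 'b" is "\<lambda>c f x. c *\<^sub>C f x"
proof -
  fix c :: complex and f :: "'a \<Rightarrow> 'b"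
  assume f: "f \<in> bcontfun"
  have bl: "bounded_linear (\<lambda>y::'b. c *\<^sub>C y)"
    by (rule bounded_linear_intro[where K = "cmod c"])
      (simp_all add: scaleC_add_right norm_scaleC scaleR_scaleC scaleC_scaleC mult.commute)
  have "bounded ((\<lambda>y::'b. c *\<^sub>C y) ` range f)"
    using f by (intro bounded_linear_image bl) (simp add: bcontfun_def)
  then show "(\<lambda>x. c *\<^sub>C f x) \<in> bcontfun"
    using f bounded_linear.continuous_on[OF bl, of UNIV f] by (simp add: bcontfun_def image_image)
qed

instance
proof
  fix f g :: "'a \<Rightarrow>\<^sub>C 'b" and a b :: complex and r :: real
  show "a *\<^sub>C (f + g) = a *\<^sub>C f + a *\<^sub>C g" "(a + b) *\<^sub>C f = a *\<^sub>C f + b *\<^sub>C f"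
    "a *\<^sub>C b *\<^sub>C f = (a * b) *\<^sub>C f" "r *\<^sub>R f = complex_of_real r *\<^sub>C f"
    by (rule bcontfun_eqI,
        simp add: scaleC_bcontfun.rep_eq scaleC_add_right scaleC_add_left scaleC_scaleC
          scaleR_scaleC)+
  have le: "norm (c *\<^sub>C h) \<le> cmod c * norm h" for c :: complex and h :: "'a \<Rightarrow>\<^sub>C 'b"
    by (rule norm_bound)
      (simp add: scaleC_bcontfun.rep_eq norm_scaleC mult_left_mono norm_bounded)
  show "norm (a *\<^sub>C f) = cmod a * norm f"
  proof (rule antisym[OF le])
    show "cmod a * norm f \<le> norm (a *\<^sub>C f)"
    proof (cases "a = 0")
      case False
      have "inverse a *\<^sub>C a *\<^sub>C f = f"
        using False by (intro bcontfun_eqI) (simp add: scaleC_bcontfun.rep_eq scaleC_scaleC)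
      then have "norm f \<le> cmod (inverse a) * norm (a *\<^sub>C f)"
        using le[of "inverse a" "a *\<^sub>C f"] by simp
      then have "cmod a * norm f \<le> cmod a * (cmod (inverse a) * norm (a *\<^sub>C f))"
        by (rule mult_left_mono) simp
      also have "\<dots> = norm (a *\<^sub>C f)"
        using False by (simp add: norm_inverse)
      finally show ?thesis .
    qed simp
  qed
qed

end

instantiation complex :: complex_normed_vector
begin
definition scaleC_complex :: "complex \<Rightarrow> complex \<Rightarrow> complex" where
  "scaleC_complex = (*)"
instance
  by standard (auto simp: scaleC_complex_def algebra_simps norm_mult scaleR_conv_of_real)
end


section \<open>The space of regular complex Borel measures\<close>

text \<open>The total variation of a set function on the Borel sets.\<close>

definition variation :: "('a::topological_space set \<Rightarrow> complex) \<Rightarrow> 'a set \<Rightarrow> ennreal" where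
  "variation \<mu> E =
     (SUP P \<in> {P. finite P \<and> disjoint P \<and> P \<subseteq> sets borel \<and> \<Union>P \<subseteq> E}.
        \<Sum>A\<in>P. ennreal (cmod (\<mu> A)))"

text \<open>Measures are set functions extended by \<open>0\<close> to non-Borel sets, so that equality of measures
  is equality of set functions.\<close>

definition regular_complex_measures :: "('a::topological_space set \<Rightarrow> complex) set" where
  "regular_complex_measures = {\<mu>.
     (\<forall>E. E \<notin> sets borel \<longrightarrow> \<mu> E = 0) \<and>
     (\<forall>A :: nat \<Rightarrow> 'a set. range A \<subseteq> sets borel \<longrightarrow> disjoint_family A \<longrightarrow>
        (\<lambda>n. \<mu> (A n)) sums \<mu> (\<Union>n. A n)) \<and>
     variation \<mu> UNIV < \<infinity> \<and>
     (\<forall>E \<in> sets borel. \<forall>e>0. \<exists>K U. compact K \<and> open U \<and> K \<subseteq> E \<and> E \<subseteq> U \<and>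
        variation \<mu> (U - K) < e)}"

lemma variation_zero [simp]: "variation (\<lambda>_. 0) E = 0"
  unfolding variation_def by (simp add: bot_ennreal[symmetric] del: sum_constant) (simp add: bot_ennreal)

lemma variation_mono: "E \<subseteq> F \<Longrightarrow> variation \<mu> E \<le> variation \<mu> F"
  unfolding variation_def by (rule SUP_subset_mono) auto

lemma variation_add: "variation (\<lambda>E. \<mu> E + \<nu> E) S \<le> variation \<mu> S + variation \<nu> S"
  unfolding variation_def[of "\<lambda>E. \<mu> E + \<nu> E"]
proof (rule SUP_least)
  fix P assume P: "P \<in> {P. finite P \<and> disjoint P \<and> P \<subseteq> sets borel \<and> \<Union>P \<subseteq> S}"
  have "(\<Sum>A\<in>P. ennreal (cmod (\<mu> A + \<nu> A))) \<le>
      (\<Sum>A\<in>P. ennreal (cmod (\<mu> A)) + ennreal (cmod (\<nu> A)))"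
    by (intro sum_mono) (simp add: norm_triangle_ineq ennreal_leI flip: ennreal_plus)
  also have "\<dots> = (\<Sum>A\<in>P. ennreal (cmod (\<mu> A))) + (\<Sum>A\<in>P. ennreal (cmod (\<nu> A)))"
    by (rule sum.distrib)
  also have "\<dots> \<le> variation \<mu> S + variation \<nu> S"
    unfolding variation_def using P by (intro add_mono SUP_upper)
  finally show "(\<Sum>A\<in>P. ennreal (cmod (\<mu> A + \<nu> A))) \<le> variation \<mu> S + variation \<nu> S" .
qed

lemma variation_scale: "variation (\<lambda>E. c * \<mu> E) S = ennreal (cmod c) * variation \<mu> S"
proof -
  have "(\<Sum>A\<in>P. ennreal (cmod (c * \<mu> A))) = ennreal (cmod c) * (\<Sum>A\<in>P. ennreal (cmod (\<mu> A)))" for P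
    by (simp add: norm_mult ennreal_mult sum_distrib_left del: sum_ennreal)
  then show ?thesis
    unfolding variation_def by (simp add: SUP_mult_left_ennreal)
qed

lemma le_variation: "E \<in> sets borel \<Longrightarrow> ennreal (cmod (\<mu> E)) \<le> variation \<mu> E"
  unfolding variation_def by (rule SUP_upper2[of "{E}"]) auto

lemma zero_regular_complex_measure: "(\<lambda>_. 0) \<in> regular_complex_measures"
proof -
  have "\<exists>K U. compact K \<and> open U \<and> K \<subseteq> E \<and> E \<subseteq> U \<and> variation (\<lambda>_. 0) (U - K) < e"
    if "e > 0" for E :: "'a set" and e
    by (rule exI[of _ "{}"], rule exI[of _ UNIV]) (use that in auto)
  then show ?thesis
    unfolding regular_complex_measures_def by simp
qed

lemma add_regular_complex_measure:
  assumes "\<mu> \<in> regular_complex_measures" "\<nu> \<in> regular_complex_measures"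
  shows "(\<lambda>E. \<mu> E + \<nu> E) \<in> regular_complex_measures"
proof -
  have "\<exists>K U. compact K \<and> open U \<and> K \<subseteq> E \<and> E \<subseteq> U \<and>
      variation (\<lambda>E. \<mu> E + \<nu> E) (U - K) < e" if E: "E \<in> sets borel" and "e > 0" for E and e :: ennreal
  proof -
    define d where "d = e / 2"
    have "d + d = e"
      using mult_divide_eq_ennreal[of 2 e] unfolding d_def
      by (simp add: mult_2_right flip: add_divide_distrib_ennreal)
    moreover have "d > 0"
      using \<open>e > 0\<close> unfolding d_def by (simp add: ennreal_zero_less_divide)
    ultimately have d: "d > 0" "d + d \<le> e" by auto
    obtain K U where KU: "compact K" "open U" "K \<subseteq> E" "E \<subseteq> U" "variation \<mu> (U - K) < d"
      using assms(1) E d(1) unfolding regular_complex_measures_def by blast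
    obtain L V where LV: "compact L" "open V" "L \<subseteq> E" "E \<subseteq> V" "variation \<nu> (V - L) < d"
      using assms(2) E d(1) unfolding regular_complex_measures_def by blast
    have "variation (\<lambda>E. \<mu> E + \<nu> E) ((U \<inter> V) - (K \<union> L))
        \<le> variation \<mu> ((U \<inter> V) - (K \<union> L)) + variation \<nu> ((U \<inter> V) - (K \<union> L))"
      by (rule variation_add)
    also have "\<dots> \<le> variation \<mu> (U - K) + variation \<nu> (V - L)"
      by (intro add_mono variation_mono) auto
    also have "\<dots> < d + d"
      using KU(5) LV(5) by (rule add_strict_mono)
    also have "\<dots> \<le> e" by (rule d(2))
    finally show ?thesis
      using KU LV by (intro exI[of _ "K \<union> L"] exI[of _ "U \<inter> V"]) auto
  qed
  moreover have "variation (\<lambda>E. \<mu> E + \<nu> E) UNIV < \<infinity>"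
    using assms variation_add[of \<mu> \<nu> UNIV] unfolding regular_complex_measures_def
    by (auto intro: le_less_trans)
  ultimately show ?thesis
    using assms unfolding regular_complex_measures_def by (auto intro: sums_add)
qed

lemma scale_regular_complex_measure:
  assumes "\<mu> \<in> regular_complex_measures"
  shows "(\<lambda>E. c * \<mu> E) \<in> regular_complex_measures"
proof (cases "c = 0")
  case True
  then show ?thesis by (simp add: zero_regular_complex_measure)
next
  case False
  have "\<exists>K U. compact K \<and> open U \<and> K \<subseteq> E \<and> E \<subseteq> U \<and> variation (\<lambda>E. c * \<mu> E) (U - K) < e"
    if E: "E \<in> sets borel" and "e > 0" for E and e :: ennreal
  proof -
    define d where "d = ennreal (inverse (cmod c)) * e"
    have "ennreal (cmod c) * ennreal (inverse (cmod c)) = 1"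
      using False by (simp flip: ennreal_mult)
    then have d: "ennreal (cmod c) * d = e"
      by (simp add: d_def flip: mult.assoc)
    have "d > 0"
      using \<open>e > 0\<close> False unfolding d_def by (simp add: ennreal_zero_less_mult_iff)
    then obtain K U where KU: "compact K" "open U" "K \<subseteq> E" "E \<subseteq> U" "variation \<mu> (U - K) < d"
      using assms E unfolding regular_complex_measures_def by blast
    have "ennreal (cmod c) * variation \<mu> (U - K) < ennreal (cmod c) * d"
      using KU(5) False by (intro ennreal_mult_strict_left_mono) auto
    then have "variation (\<lambda>E. c * \<mu> E) (U - K) < e"
      by (simp add: variation_scale d)
    then show ?thesis using KU by blast
  qed
  moreover have "variation (\<lambda>E. c * \<mu> E) UNIV < \<infinity>"
    using assms unfolding regular_complex_measures_def variation_scale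
    by (auto simp: ennreal_mult_less_top)
  ultimately show ?thesis
    using assms unfolding regular_complex_measures_def by (auto intro: sums_mult)
qed

typedef (overloaded) 'a cmeasure =
    "regular_complex_measures :: ('a::topological_space set \<Rightarrow> complex) set"
  morphisms cmeasure_of Abs_cmeasure
  using zero_regular_complex_measure by blast

setup_lifting type_definition_cmeasure

instantiation cmeasure :: (topological_space) real_vector
begin

lift_definition zero_cmeasure :: "'a cmeasure" is "\<lambda>_. 0"
  by (rule zero_regular_complex_measure)
lift_definition plus_cmeasure :: "'a cmeasure \<Rightarrow> 'a cmeasure \<Rightarrow> 'a cmeasure" is "\<lambda>\<mu> \<nu> E. \<mu> E + \<nu> E"
  by (rule add_regular_complex_measure)
lift_definition uminus_cmeasure :: "'a cmeasure \<Rightarrow> 'a cmeasure" is "\<lambda>\<mu> E. - \<mu> E"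
  subgoal for \<mu> using scale_regular_complex_measure[of \<mu> "-1"] by simp
  done
lift_definition minus_cmeasure :: "'a cmeasure \<Rightarrow> 'a cmeasure \<Rightarrow> 'a cmeasure" is "\<lambda>\<mu> \<nu> E. \<mu> E - \<nu> E"
  subgoal for \<mu> \<nu>
    using add_regular_complex_measure[OF _ scale_regular_complex_measure[of \<nu> "-1"], of \<mu>] by simp
  done
lift_definition scaleR_cmeasure :: "real \<Rightarrow> 'a cmeasure \<Rightarrow> 'a cmeasure"
  is "\<lambda>r \<mu> E. complex_of_real r * \<mu> E"
  by (rule scale_regular_complex_measure)

instance
  by standard (transfer; simp add: algebra_simps fun_eq_iff)+

end

instantiation cmeasure :: (topological_space) complex_normed_vector
begin

lift_definition scaleC_cmeasure :: "complex \<Rightarrow> 'a cmeasure \<Rightarrow> 'a cmeasure" is "\<lambda>c \<mu> E. c * \<mu> E"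
  by (rule scale_regular_complex_measure)
lift_definition norm_cmeasure :: "'a cmeasure \<Rightarrow> real" is "\<lambda>\<mu>. enn2real (variation \<mu> UNIV)" .
definition dist_cmeasure :: "'a cmeasure \<Rightarrow> 'a cmeasure \<Rightarrow> real" where
  "dist_cmeasure \<mu> \<nu> = norm (\<mu> - \<nu>)"
definition sgn_cmeasure :: "'a cmeasure \<Rightarrow> 'a cmeasure" where
  "sgn_cmeasure \<mu> = inverse (norm \<mu>) *\<^sub>R \<mu>"
definition uniformity_cmeasure :: "('a cmeasure \<times> 'a cmeasure) filter" where
  "uniformity_cmeasure = (INF e\<in>{0 <..}. principal {(x, y). dist x y < e})"
definition open_cmeasure :: "'a cmeasure set \<Rightarrow> bool" where
  "open_cmeasure S = (\<forall>x\<in>S. \<forall>\<^sub>F (x', y) in uniformity. x' = x \<longrightarrow> y \<in> S)"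

instance
proof
  fix \<mu> \<nu> :: "'a cmeasure" and a b :: complex and r :: real
  show "a *\<^sub>C (\<mu> + \<nu>) = a *\<^sub>C \<mu> + a *\<^sub>C \<nu>" "(a + b) *\<^sub>C \<mu> = a *\<^sub>C \<mu> + b *\<^sub>C \<mu>"
    "a *\<^sub>C b *\<^sub>C \<mu> = (a * b) *\<^sub>C \<mu>" "r *\<^sub>R \<mu> = complex_of_real r *\<^sub>C \<mu>"
    by (transfer; simp add: algebra_simps fun_eq_iff)+
  have norm_scale: "norm (c *\<^sub>C \<mu>) = cmod c * norm \<mu>" for c
    by transfer (simp add: variation_scale enn2real_mult)
  then show "norm (a *\<^sub>C \<mu>) = cmod a * norm \<mu>" .
  have "r *\<^sub>R \<mu> = complex_of_real r *\<^sub>C \<mu>"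
    by (transfer; simp)
  then show "norm (r *\<^sub>R \<mu>) = \<bar>r\<bar> * norm \<mu>"
    by (simp add: norm_scale)
  show "norm \<mu> = 0 \<longleftrightarrow> \<mu> = 0"
  proof
    assume "norm \<mu> = 0"
    then show "\<mu> = 0"
    proof transfer
      fix \<mu> :: "'a set \<Rightarrow> complex"
      assume \<mu>: "\<mu> \<in> regular_complex_measures" and 0: "enn2real (variation \<mu> UNIV) = 0"
      then have v: "variation \<mu> UNIV = 0"
        unfolding regular_complex_measures_def by (auto simp: enn2real_eq_0_iff)
      show "\<mu> = (\<lambda>_. 0)"
      proof
        fix E
        show "\<mu> E = 0"
        proof (cases "E \<in> sets borel")
          case True
          have "ennreal (cmod (\<mu> E)) \<le> variation \<mu> E"
            by (rule le_variation[OF True])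
          also have "\<dots> \<le> variation \<mu> UNIV"
            by (rule variation_mono) simp
          finally show ?thesis by (simp add: v)
        qed (use \<mu> in \<open>auto simp: regular_complex_measures_def\<close>)
      qed
    qed
  qed (transfer, simp)
  show "norm (\<mu> + \<nu>) \<le> norm \<mu> + norm \<nu>"
  proof transfer
    fix \<mu> \<nu> :: "'a set \<Rightarrow> complex"
    assume "\<mu> \<in> regular_complex_measures" "\<nu> \<in> regular_complex_measures"
    then have fin: "variation \<mu> UNIV < \<infinity>" "variation \<nu> UNIV < \<infinity>"
      unfolding regular_complex_measures_def by auto
    have "enn2real (variation (\<lambda>E. \<mu> E + \<nu> E) UNIV)
        \<le> enn2real (variation \<mu> UNIV + variation \<nu> UNIV)"
      using fin by (intro enn2real_mono variation_add) auto
    also have "\<dots> = enn2real (variation \<mu> UNIV) + enn2real (variation \<nu> UNIV)"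
      using fin by (intro enn2real_plus) auto
    finally show "enn2real (variation (\<lambda>E. \<mu> E + \<nu> E) UNIV)
        \<le> enn2real (variation \<mu> UNIV) + enn2real (variation \<nu> UNIV)" .
  qed
qed (rule dist_cmeasure_def sgn_cmeasure_def uniformity_cmeasure_def open_cmeasure_def)+

end

text \<open>The integral of a bounded Borel function against a complex measure: the common limit of the
  integrals \<open>\<Sum>c. c * \<mu>(s = c)\<close> of Borel simple functions \<open>s\<close> that approximate it uniformly.\<close>

definition cm_integral :: "'a::topological_space cmeasure \<Rightarrow> ('a \<Rightarrow> complex) \<Rightarrow> complex" where
  "cm_integral \<mu> f = (THE I. \<forall>s :: nat \<Rightarrow> 'a \<Rightarrow> complex.
     (\<forall>n. simple_function borel (s n)) \<longrightarrow> uniform_limit UNIV s f sequentially \<longrightarrow>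
     (\<lambda>n. \<Sum>c\<in>range (s n). c * cmeasure_of \<mu> (s n -` {c})) \<longlonglongrightarrow> I)"


section \<open>Harmonic analysis on a compact Abelian group\<close>

definition normalized_haar_measure :: "'g::topological_ab_group_add measure \<Rightarrow> bool" where
  "normalized_haar_measure m \<longleftrightarrow>
     sets m = sets borel \<and>
     emeasure m UNIV = 1 \<and>
     (\<forall>a. \<forall>E \<in> sets borel. emeasure m ((+) a ` E) = emeasure m E) \<and>
     (\<forall>E \<in> sets borel. emeasure m E = (SUP K\<in>{K. compact K \<and> K \<subseteq> E}. emeasure m K)) \<and>
     (\<forall>E \<in> sets borel. emeasure m E = (INF U\<in>{U. open U \<and> E \<subseteq> U}. emeasure m U))"

definition characters :: "('g::topological_ab_group_add \<Rightarrow> complex) set" where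
  "characters = {\<gamma>. continuous_on UNIV \<gamma> \<and> (\<forall>x. cmod (\<gamma> x) = 1) \<and>
     (\<forall>x y. \<gamma> (x + y) = \<gamma> x * \<gamma> y)}"

definition fourier_coeff ::
    "'g::topological_ab_group_add measure \<Rightarrow> ('g \<Rightarrow>\<^sub>C complex) \<Rightarrow> ('g \<Rightarrow> complex) \<Rightarrow> complex" where
  "fourier_coeff m f \<gamma> = (LINT h|m. cnj (\<gamma> h) * f h)"

definition conv_operator ::
    "('g::topological_ab_group_add \<Rightarrow>\<^sub>C complex) \<Rightarrow> 'g cmeasure \<Rightarrow> ('g \<Rightarrow>\<^sub>C complex)" where
  "conv_operator f \<mu> = Bcontfun (\<lambda>g. cm_integral \<mu> (\<lambda>h. f (g - h)))"

end

theory Submission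
  imports Defs "HOL-Complex_Analysis.Great_Picard" "HOL-Computational_Algebra.Fundamental_Theorem_Algebra"
begin

text \<open>
  On characters, \<open>\<star>f\<close> acts as the diagonal operator \<open>\<gamma> \<mapsto> f\<^sup>\<and>(\<gamma>) \<gamma>\<close>.

  If \<open>f\<^sup>\<and> \<in> l\<^sub>s\<close>, then \<open>f\<close> is the sum of its absolutely convergent Fourier series. This needs the
  uniqueness theorem, which rests on the existence of sufficiently many characters: for a hermitian
  kernel \<open>k \<noteq> 0\<close>, the square of the convolution with \<open>k\<close> is a compact positive operator on \<open>C(G)\<close> with the
  \<open>L\<^sub>2\<close> inner product; an eigenspace for a nonzero eigenvalue is finite-dimensional and translation
  invariant, and a common eigenvector of all translations is a multiple of a character. Splitting
  \<open>f\<^sup>\<and>\<close> into factors of modulus \<open>\<bar>f\<^sup>\<and>\<bar>\<^bsup>s/2\<^esup>\<close>, \<open>\<bar>f\<^sup>\<and>\<bar>\<^bsup>1-s\<^esup>\<close> and \<open>\<bar>f\<^sup>\<and>\<bar>\<^bsup>s/2\<^esup>\<close> gives the factorization through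
  a diagonal operator on \<open>l\<^sub>2\<close>.

  Conversely, let \<open>\<star>f = A U B\<close>. The operators \<open>B : L\<^sub>2 \<rightarrow> M(G) \<rightarrow> H\<close> and \<open>A : H \<rightarrow> C(G) \<rightarrow> L\<^sub>2\<close> are
  Hilbert-Schmidt, so the diagonal operator with entries \<open>f\<^sup>\<and>\<close> is a product of a Hilbert-Schmidt
  operator, an \<open>S\<^sub>r\<close>-operator and a Hilbert-Schmidt operator, and \<open>1/s = 1/2 + 1/r + 1/2\<close>.
\<close>

section \<open>Linear algebra\<close>

text \<open>Neither \<open>L_2\<close> nor a completion is formed. The spectral theory lives in
  inner product spaces that may be incomplete, where compactness supplies the limits; summability is
  tested on finite sets \<open>F\<close> of characters, with bounds that do not depend on
  \<open>F\<close>. The map \<open>A\<close> is Hilbert-Schmidt into \<open>L_2\<close> because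
  evaluation at a point of \<open>G\<close> is a functional on \<open>H\<close> bounded by the norm
  of \<open>A\<close>: along an orthonormal sequence the squares are summable pointwise, and the
  bound is integrated. For \<open>B\<close> there are no point evaluations; densities of integral
  one with large coefficients on \<open>F\<close> take their place, and averaging over translates
  isolates the diagonal terms. The product of three operators is estimated by discarding
  \<open>n\<close> directions for each factor. This costs \<open>3 n\<close> conditions, so the
  coefficients in decreasing order are compared with blocks of length three. If \<open>r\<close> is
  infinite, the middle factor need not be compact and only its norm enters. An obstacle throughout:
  \<open>G\<close> need not be metrizable nor its character group countable, while singular numbers
  form a sequence over the naturals.\<close>

lemma homogeneous_system_nontrivial:
  fixes a :: "'k \<Rightarrow> 'j \<Rightarrow> 'c::field"
  assumes "finite K" "finite J" "card K < card J"
  shows "\<exists>c. (\<exists>j\<in>J. c j \<noteq> 0) \<and> (\<forall>k\<in>K. (\<Sum>j\<in>J. a k j * c j) = 0)"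
  using assms
proof (induction K arbitrary: J a rule: finite_induct)
  case empty
  then have "J \<noteq> {}" by auto
  then show ?case by (intro exI[of _ "\<lambda>_. 1"]) auto
next
  case (insert k K)
  show ?case
  proof (cases "\<forall>j\<in>J. a k j = 0")
    case True
    have "card K < card J" using insert by simp
    from insert.IH[OF insert.prems(1) this, of a] True show ?thesis by auto
  next
    case False
    then obtain i where i: "i \<in> J" "a k i \<noteq> 0" by auto
    define J' where "J' = J - {i}"
    \<comment> \<open>Gaussian elimination: \<open>a'\<close> is the system after equation
      \<open>k\<close> has been used to remove the unknown \<open>i\<close>, which is recovered
      afterwards from that equation.\<close>
    define a' where "a' = (\<lambda>l j. a l j - a l i * a k j / a k i)"
    have J: "J = insert i J'" "finite J'" "i \<notin> J'" using i insert.prems(1) by (auto simp: J'_def)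
    have "card K < card J'" using insert J by simp
    from insert.IH[OF J(2) this, of a'] obtain c where c: "\<exists>j\<in>J'. c j \<noteq> 0"
        "\<And>l. l \<in> K \<Longrightarrow> (\<Sum>j\<in>J'. a' l j * c j) = 0" by auto
    define d where "d = c(i := - (\<Sum>j\<in>J'. a k j * c j) / a k i)"
    have s: "(\<Sum>j\<in>J. a l j * d j) = a l i * d i + (\<Sum>j\<in>J'. a l j * c j)" for l
      using J by (auto simp: d_def intro!: sum.cong)
    have "(\<Sum>j\<in>J. a k j * d j) = 0"
      unfolding s using i by (simp add: d_def)
    moreover have "(\<Sum>j\<in>J. a l j * d j) = 0" if "l \<in> K" for l
    proof -
      have "(\<Sum>j\<in>J'. a' l j * c j) = (\<Sum>j\<in>J'. a l j * c j) - a l i / a k i * (\<Sum>j\<in>J'. a k j * c j)"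
        by (simp add: a'_def left_diff_distrib sum_subtractf sum_distrib_left mult.assoc)
      then show ?thesis using c(2)[OF that] unfolding s by (simp add: d_def)
    qed
    moreover have "\<exists>j\<in>J. d j \<noteq> 0" using c(1) J by (auto simp: d_def)
    ultimately show ?thesis by blast
  qed
qed

lemma clinear_sum:
  fixes T :: "'a::complex_normed_vector \<Rightarrow> 'b::complex_normed_vector"
  assumes "\<And>x y. T (x + y) = T x + T y" "\<And>c x. T (c *\<^sub>C x) = c *\<^sub>C T x"
  shows "T (\<Sum>i\<in>I. c i *\<^sub>C x i) = (\<Sum>i\<in>I. c i *\<^sub>C T (x i))"
proof (cases "finite I")
  case True
  have T0: "T 0 = 0" using assms(2)[of 0 0] by simp
  from True show ?thesis by (induction I) (auto simp: assms T0)
next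
  case False
  have T0: "T 0 = 0" using assms(2)[of 0 0] by simp
  show ?thesis using False by (simp add: T0)
qed

text \<open>The orbit of \<open>v\<close> lies in a finite-dimensional space, so a nonzero
  polynomial in \<open>T\<close> kills \<open>v\<close>. Linear factors are split off one at a time;
  the last vector before zero is an eigenvector.\<close>

lemma finite_span_eigenvector:
  fixes T :: "'a::complex_normed_vector \<Rightarrow> 'a"
  assumes add: "\<And>x y. T (x + y) = T x + T y" and scale: "\<And>c x. T (c *\<^sub>C x) = c *\<^sub>C T x"
    and sub: "cvec.subspace E" and B: "finite B" "E \<subseteq> cvec.span B"
    and inv: "\<And>x. x \<in> E \<Longrightarrow> T x \<in> E" and v: "v \<in> E" "v \<noteq> 0"
  shows "\<exists>z u. u \<in> E \<and> u \<noteq> 0 \<and> T u = z *\<^sub>C u"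
proof -
  \<comment> \<open>\<open>act n p x\<close> is \<open>p(T) x\<close> as soon as \<open>n\<close>
    exceeds the degree of \<open>p\<close>; the free length \<open>n\<close> keeps the degree out of
    the algebra.\<close>
  define act where "act n p x = (\<Sum>i<n. coeff p i *\<^sub>C (T ^^ i) x)" for n p x
  have Tn: "(T ^^ i) x \<in> E" if "x \<in> E" for i x using that by (induction i) (auto intro: inv)
  have actE: "act n p x \<in> E" if "x \<in> E" for n p x
    unfolding act_def by (intro cvec.subspace_sum[OF sub] cvec.subspace_scale[OF sub] Tn that)
  have act_shift: "act (Suc n) (pCons 0 p) x = T (act n p x)" for n p x
    unfolding act_def sum.lessThan_Suc_shift
    by (subst clinear_sum[OF add scale]) simp
  have act_deg: "act (Suc n) p x = act n p x" if "degree p < n" for n p x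
    unfolding act_def using that by (simp add: coeff_eq_0)
  have act_factor: "act (Suc n) ([:- z, 1:] * q) x = T (act n q x) - z *\<^sub>C act n q x"
    if "degree q < n" for n q x z
  proof -
    have "coeff ([:- z, 1:] * q) i = coeff (pCons 0 q) i - z * coeff q i" for i by simp
    then have "act (Suc n) ([:- z, 1:] * q) x = act (Suc n) (pCons 0 q) x - z *\<^sub>C act (Suc n) q x"
      unfolding act_def
      by (simp only: cvec.scale_left_diff_distrib sum_subtractf cvec.scale_sum_right cvec.scale_scale)
    then show ?thesis by (simp only: act_shift act_deg[OF that])
  qed
  have main: "\<exists>z u. u \<in> E \<and> u \<noteq> 0 \<and> T u = z *\<^sub>C u"
    if "p \<noteq> 0" "degree p = n" "act (Suc n) p v = 0" for p n
    using that
  proof (induction n arbitrary: p)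
    case 0
    then obtain a where "p = [:a:]" by (metis degree_eq_zeroE)
    then show ?case using 0 v by (simp add: act_def)
  next
    case (Suc n)
    have "\<not> constant (poly p)" using Suc.prems constant_degree[of p] by simp
    then obtain z where "poly p z = 0" using fundamental_theorem_of_algebra by blast
    then obtain q where q: "p = [:- z, 1:] * q" unfolding poly_eq_0_iff_dvd by (elim dvdE)
    then have q0: "q \<noteq> 0" "degree q = n" using Suc.prems
      by (auto simp: degree_mult_eq simp del: mult_pCons_left)
    have *: "T (act (Suc n) q v) = z *\<^sub>C act (Suc n) q v"
      using Suc.prems(3) act_factor[of q "Suc n" z v] q0 unfolding q by simp
    show ?case
    proof (cases "act (Suc n) q v = 0")
      case True
      then show ?thesis using Suc.IH[OF q0] by simp
    next
      case False
      then show ?thesis using * actE[OF v(1)] by blast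
    qed
  qed
  have "\<exists>a. (T ^^ i) v = (\<Sum>b\<in>B. a b *\<^sub>C b)" for i
    using Tn[OF v(1), of i] B by (auto simp: cvec.span_finite)
  then obtain a' where a': "\<And>i. (T ^^ i) v = (\<Sum>b\<in>B. a' i b *\<^sub>C b)"
    by (atomize_elim, intro choice allI)
  define a where "a = (\<lambda>b i. a' i b)"
  have a: "(T ^^ i) v = (\<Sum>b\<in>B. a b i *\<^sub>C b)" for i
    by (simp add: a' a_def)
  \<comment> \<open>\<open>card B + 1\<close> powers of \<open>T\<close> against
    \<open>card B\<close> coordinates leave a nontrivial relation.\<close>
  obtain c where c: "\<exists>j\<in>{..card B}. c j \<noteq> 0" "\<And>b. b \<in> B \<Longrightarrow> (\<Sum>j\<le>card B. a b j * c j) = 0"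
    using homogeneous_system_nontrivial[OF B(1), of "{..card B}" a] by auto
  define p where "p = (\<Sum>i\<le>card B. monom (c i) i)"
  have cp: "coeff p i = (if i \<le> card B then c i else 0)" for i
    by (simp add: p_def coeff_sum)
  have p0: "p \<noteq> 0"
  proof
    assume "p = 0"
    then have "coeff p i = 0" for i by simp
    then show False using c(1) unfolding cp by (metis atMost_iff)
  qed
  have deg: "degree p \<le> card B" by (rule degree_le) (simp add: cp)
  have "act (Suc (degree p)) p v = act (Suc (card B)) p v"
    unfolding act_def using deg by (intro sum.mono_neutral_left) (auto simp: coeff_eq_0)
  also have "\<dots> = (\<Sum>i\<le>card B. c i *\<^sub>C (\<Sum>b\<in>B. a b i *\<^sub>C b))"
    unfolding act_def a lessThan_Suc_atMost by (intro sum.cong) (auto simp: cp)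
  also have "\<dots> = (\<Sum>b\<in>B. (\<Sum>i\<le>card B. a b i * c i) *\<^sub>C b)"
    by (simp add: cvec.scale_sum_right cvec.scale_sum_left mult.commute)
      (rule sum.swap)
  also have "\<dots> = 0" using c(2) by simp
  finally show ?thesis using main[OF p0 refl] by blast
qed

text \<open>If \<open>v\<close> is not an eigenvector of some \<open>T i\<close>, an eigenspace of
  this \<open>T i\<close> inside \<open>E\<close> omits \<open>v\<close>. It is invariant under all
  the operators because they commute, and it is spanned by fewer vectors.\<close>

lemma commuting_common_eigenvector:
  fixes T :: "'i \<Rightarrow> 'a::complex_normed_vector \<Rightarrow> 'a"
  assumes add: "\<And>i x y. T i (x + y) = T i x + T i y"
    and scale: "\<And>i c x. T i (c *\<^sub>C x) = c *\<^sub>C T i x"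
    and comm: "\<And>i j x. T i (T j x) = T j (T i x)"
    and sub: "cvec.subspace E" and B: "finite B" "E \<subseteq> cvec.span B"
    and inv: "\<And>i x. x \<in> E \<Longrightarrow> T i x \<in> E" and v: "v \<in> E" "v \<noteq> 0"
  shows "\<exists>u. u \<in> E \<and> u \<noteq> 0 \<and> (\<forall>i. \<exists>z. T i u = z *\<^sub>C u)"
  using sub B inv v
proof (induction "card B" arbitrary: B E v rule: less_induct)
  case less
  show ?case
  proof (cases "\<forall>i. \<exists>z. T i v = z *\<^sub>C v")
    case True
    then show ?thesis using less.prems by blast
  next
    case False
    then obtain i where i: "\<And>z. T i v \<noteq> z *\<^sub>C v" by auto
    obtain z u where u: "u \<in> E" "u \<noteq> 0" "T i u = z *\<^sub>C u"
      using finite_span_eigenvector[where T = "T i", OF add scale less.prems(1-3) less.prems(4-6)]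
      by blast
    define E' where "E' = {x \<in> E. T i x = z *\<^sub>C x}"
    have sub': "cvec.subspace E'"
      using less.prems(1) scale[of i 0 0] unfolding E'_def cvec.subspace_def
      by (auto simp: add scale scaleC_add_right scaleC_scaleC mult.commute)
    have inv': "T j x \<in> E'" if "x \<in> E'" for j x
      using that less.prems(4) unfolding E'_def by (auto simp: comm[of i j] scale)
    obtain B' where B': "B' \<subseteq> E'" "cvec.independent B'" "E' \<subseteq> cvec.span B'"
      using cvec.maximal_independent_subset[of E'] by blast
    have "v \<notin> E'" using i by (auto simp: E'_def)
    moreover have "cvec.span B' \<subseteq> E'" using B' sub' by (simp add: cvec.span_minimal)
    ultimately have "v \<notin> cvec.span B'" by blast
    then have ind: "cvec.independent (insert v B')" "v \<notin> B'"
      using B' by (auto simp: cvec.independent_insert cvec.span_base)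
    have "insert v B' \<subseteq> cvec.span B" using less.prems B' by (auto simp: E'_def)
    from cvec.independent_span_bound[OF less.prems(2) ind(1) this]
    have fin: "finite B'" "card B' < card B" using ind(2) by auto
    have "\<exists>u. u \<in> E' \<and> u \<noteq> 0 \<and> (\<forall>i. \<exists>z. T i u = z *\<^sub>C u)"
      by (rule less.hyps[OF fin(2) sub' fin(1) B'(3) inv']) (use u in \<open>auto simp: E'_def\<close>)
    then show ?thesis by (auto simp: E'_def)
  qed
qed

section \<open>Compact positive operators\<close>

text \<open>Needed both for inner products and for the form \<open>ip (W x) y\<close> of a positive
  operator, which can vanish on nonzero vectors. Hence the separate case \<open>c = 0\<close>, where
  no division is possible.\<close>

lemma semidefinite_Cauchy_Schwarz:
  fixes q :: "'a::complex_normed_vector \<Rightarrow> 'a \<Rightarrow> complex"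
  assumes add: "\<And>x y z. q (x + y) z = q x z + q y z"
    and scale: "\<And>c x y. q (c *\<^sub>C x) y = c * q x y"
    and comm: "\<And>x y. q x y = cnj (q y x)"
    and pos: "\<And>x. 0 \<le> Re (q x x)"
  shows "(cmod (q x y))\<^sup>2 \<le> Re (q x x) * Re (q y y)"
proof -
  define a b c where "a = Re (q x x)" "b = q x y" "c = Re (q y y)"
  note abc = this
  have real: "q u u = complex_of_real (Re (q u u))" for u
    using comm[of u u] by (simp add: complex_eq_iff)
  have yx: "q y x = cnj b" using comm[of y x] by (simp add: abc)
  have add': "q z (x + y) = q z x + q z y" for x y z
    by (subst (1 2 3) comm) (simp add: add)
  have scale': "q x (k *\<^sub>C y) = cnj k * q x y" for k x y
    by (subst (1 2) comm) (simp add: scale)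
  have *: "q (s *\<^sub>C x + t *\<^sub>C y) (s *\<^sub>C x + t *\<^sub>C y) =
      of_real ((cmod s)\<^sup>2) * of_real a + (s * cnj t * b + cnj (s * cnj t * b)) +
      of_real ((cmod t)\<^sup>2) * of_real c" for s t
  proof -
    have "q x x = of_real a" "q y y = of_real c" "q x y = b"
      using real[of x] real[of y] by (simp_all add: abc)
    then show ?thesis
      unfolding complex_norm_square by (simp add: add add' scale scale' yx algebra_simps)
  qed
  have main: "0 \<le> (cmod s)\<^sup>2 * a + 2 * Re (s * cnj t * b) + (cmod t)\<^sup>2 * c" for s t
    using pos[of "s *\<^sub>C x + t *\<^sub>C y"] unfolding * by (simp add: algebra_simps)
  have bb: "Re (b * cnj b) = (cmod b)\<^sup>2" "Re (cnj b * b) = (cmod b)\<^sup>2"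
    by (simp_all add: cmod_power2 flip: power2_eq_square)
  have c0: "0 \<le> c" using pos abc by simp
  show ?thesis
  proof (cases "c = 0")
    case False
    \<comment> \<open>The multiple of \<open>y\<close> that minimizes the form, with the denominator
      \<open>c\<close> cleared.\<close>
    have "0 \<le> c\<^sup>2 * a + 2 * Re (of_real c * cnj (- b) * b) + (cmod b)\<^sup>2 * c"
      using main[of "of_real c" "- b"] by simp
    also have "Re (of_real c * cnj (- b) * b) = - (c * (cmod b)\<^sup>2)"
      by (simp add: cmod_power2 algebra_simps) (simp add: power2_eq_square)
    finally have "0 \<le> c * (c * a - (cmod b)\<^sup>2)"
      by (simp add: algebra_simps power2_eq_square)
    then show ?thesis using False c0 by (simp add: zero_le_mult_iff abc mult.commute)
  next
    case True
    have "b = 0"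
    proof (rule ccontr)
      assume b: "b \<noteq> 0"
      \<comment> \<open>Chosen so that the form takes the value
        \<open>a - (a + 1) = -1\<close>.\<close>
      define t where "t = complex_of_real ((a + 1) / (2 * (cmod b)\<^sup>2))"
      have "cnj (t * b) * b = complex_of_real ((a + 1) / (2 * (cmod b)\<^sup>2) * (cmod b)\<^sup>2)"
        unfolding t_def of_real_mult complex_norm_square by simp
      then have "Re (1 * cnj (- (t * b)) * b) = - ((a + 1) / (2 * (cmod b)\<^sup>2) * (cmod b)\<^sup>2)"
        by (simp only: mult_1 complex_cnj_minus mult_minus_left uminus_complex.sel Re_complex_of_real)
      also have "\<dots> = - ((a + 1) / 2)" using b by simp
      finally show False using main[of 1 "- (t * b)"] True by simp
    qed
    then show ?thesis using True by (simp add: abc)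
  qed
qed

text \<open>The norm \<open>nrm\<close> of \<open>ip\<close> may differ from the norm of the type
  class: for continuous functions on \<open>G\<close> these are the \<open>L_2\<close> norm and the
  supremum norm, and the former need not be complete.\<close>

locale prehilbert =
  fixes ip :: "'a::complex_normed_vector \<Rightarrow> 'a \<Rightarrow> complex"
  assumes ip_add_left: "ip (x + y) z = ip x z + ip y z"
    and ip_scale_left: "ip (c *\<^sub>C x) y = c * ip x y"
    and ip_commute: "ip x y = cnj (ip y x)"
    and ip_nonneg: "0 \<le> Re (ip x x)"
    and ip_definite: "ip x x = 0 \<Longrightarrow> x = 0"
begin

definition nrm :: "'a \<Rightarrow> real" where "nrm x = sqrt (Re (ip x x))"

lemma ip_add_right: "ip z (x + y) = ip z x + ip z y"
  by (subst (1 2 3) ip_commute) (simp add: ip_add_left)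

lemma ip_scale_right: "ip x (c *\<^sub>C y) = cnj c * ip x y"
  by (subst (1 2) ip_commute) (simp add: ip_scale_left)

lemma ip_zero [simp]: "ip 0 y = 0" "ip y 0 = 0"
  using ip_scale_left[of 0 0 y] ip_scale_right[of y 0 0] by simp_all

lemma ip_minus_left: "ip (- x) y = - ip x y"
  using ip_add_left[of x "- x" y] by (simp add: eq_neg_iff_add_eq_0 add.commute)

lemma ip_minus_right: "ip y (- x) = - ip y x"
  using ip_add_right[of y x "- x"] by (simp add: eq_neg_iff_add_eq_0 add.commute)

lemma ip_diff_left: "ip (x - y) z = ip x z - ip y z"
  using ip_add_left[of x "- y" z] by (simp add: ip_minus_left)

lemma ip_diff_right: "ip z (x - y) = ip z x - ip z y"
  using ip_add_right[of z x "- y"] by (simp add: ip_minus_right)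

lemma ip_sum_left: "ip (\<Sum>i\<in>I. x i) y = (\<Sum>i\<in>I. ip (x i) y)"
  by (induction I rule: infinite_finite_induct) (auto simp: ip_add_left)

lemma ip_sum_right: "ip y (\<Sum>i\<in>I. x i) = (\<Sum>i\<in>I. ip y (x i))"
  by (induction I rule: infinite_finite_induct) (auto simp: ip_add_right)

lemma ip_self: "ip x x = complex_of_real ((nrm x)\<^sup>2)"
  using ip_commute[of x x] ip_nonneg[of x] by (simp add: nrm_def complex_eq_iff)

lemma nrm_sq: "(nrm x)\<^sup>2 = Re (ip x x)"
  by (simp add: nrm_def ip_nonneg)

lemma nrm_nonneg [simp]: "0 \<le> nrm x"
  by (simp add: nrm_def ip_nonneg)

lemma nrm_zero [simp]: "nrm 0 = 0"
  by (simp add: nrm_def)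

lemma nrm_eq_0 [simp]: "nrm x = 0 \<longleftrightarrow> x = 0"
proof
  assume "nrm x = 0"
  then show "x = 0" using ip_self[of x] by (intro ip_definite) simp
qed simp

lemma Cauchy_Schwarz: "cmod (ip x y) \<le> nrm x * nrm y"
proof (rule power2_le_imp_le)
  show "(cmod (ip x y))\<^sup>2 \<le> (nrm x * nrm y)\<^sup>2"
    unfolding power_mult_distrib nrm_sq
    by (rule semidefinite_Cauchy_Schwarz[of ip, OF ip_add_left ip_scale_left ip_commute ip_nonneg])
qed simp

lemma nrm_scale: "nrm (c *\<^sub>C x) = cmod c * nrm x"
proof (rule power2_eq_imp_eq)
  show "(nrm (c *\<^sub>C x))\<^sup>2 = (cmod c * nrm x)\<^sup>2"
  proof -
    have "ip (c *\<^sub>C x) (c *\<^sub>C x) = (c * cnj c) * ip x x"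
      by (simp add: ip_scale_left ip_scale_right)
    also have "\<dots> = complex_of_real ((cmod c)\<^sup>2 * (nrm x)\<^sup>2)"
      by (simp only: ip_self complex_norm_square[symmetric] of_real_mult)
    finally show ?thesis
      by (simp only: nrm_sq[of "c *\<^sub>C x"] Re_complex_of_real power_mult_distrib)
  qed
qed auto

lemma nrm_triangle: "nrm (x + y) \<le> nrm x + nrm y"
proof (rule power2_le_imp_le)
  have "(nrm (x + y))\<^sup>2 = (nrm x)\<^sup>2 + (nrm y)\<^sup>2 + (Re (ip x y) + Re (ip y x))"
    by (simp add: nrm_sq ip_add_left ip_add_right)
  also have "Re (ip x y) \<le> nrm x * nrm y"
    using Cauchy_Schwarz[of x y] complex_Re_le_cmod[of "ip x y"] by linarith
  also have "Re (ip y x) \<le> nrm x * nrm y"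
    using Cauchy_Schwarz[of y x] complex_Re_le_cmod[of "ip y x"] by (simp add: mult.commute)
  finally show "(nrm (x + y))\<^sup>2 \<le> (nrm x + nrm y)\<^sup>2" by (simp add: power2_sum)
qed simp

lemma nrm_minus [simp]: "nrm (- x) = nrm x"
  by (simp add: nrm_def ip_minus_left ip_minus_right)

lemma nrm_diff_commute: "nrm (x - y) = nrm (y - x)"
  using nrm_minus[of "x - y"] by simp

lemma nrm_diff_triangle: "nrm (x - z) \<le> nrm (x - y) + nrm (y - z)"
  using nrm_triangle[of "x - y" "y - z"] by simp

lemma nrm_diff_abs: "\<bar>nrm x - nrm y\<bar> \<le> nrm (x - y)"
  using nrm_triangle[of "x - y" y] nrm_triangle[of "y - x" x] nrm_diff_commute[of x y] by simp

lemma nrm_tendsto: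
  assumes "(\<lambda>n. nrm (X n - l)) \<longlonglongrightarrow> 0"
  shows "(\<lambda>n. nrm (X n)) \<longlonglongrightarrow> nrm l"
  by (rule Lim_null_comparison[OF _ assms, THEN LIM_zero_cancel])
    (simp add: nrm_diff_abs)

lemma ip_tendsto:
  assumes "(\<lambda>n. nrm (X n - l)) \<longlonglongrightarrow> 0"
  shows "(\<lambda>n. ip (X n) y) \<longlonglongrightarrow> ip l y"
proof (rule LIM_zero_cancel, rule Lim_null_comparison)
  show "(\<lambda>n. nrm (X n - l) * nrm y) \<longlonglongrightarrow> 0"
    using tendsto_mult_right[OF assms, of "nrm y"] by simp
  show "\<forall>\<^sub>F n in sequentially. norm (ip (X n) y - ip l y) \<le> nrm (X n - l) * nrm y"
    using Cauchy_Schwarz by (simp flip: ip_diff_left)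
qed

lemma Bessel:
  assumes "finite I" and orth: "\<And>i j. i \<in> I \<Longrightarrow> j \<in> I \<Longrightarrow> i \<noteq> j \<Longrightarrow> ip (w i) (w j) = 0"
    and unit: "\<And>i. i \<in> I \<Longrightarrow> nrm (w i) \<le> 1"
  shows "(\<Sum>i\<in>I. (cmod (ip v (w i)))\<^sup>2) \<le> (nrm v)\<^sup>2"
proof -
  define p where "p = (\<Sum>i\<in>I. ip v (w i) *\<^sub>C w i)"
  define s where "s = (\<Sum>i\<in>I. (cmod (ip v (w i)))\<^sup>2)"
  have "ip v p = (\<Sum>i\<in>I. complex_of_real ((cmod (ip v (w i)))\<^sup>2))"
    unfolding p_def ip_sum_right ip_scale_right
    by (simp add: complex_norm_square mult.commute del: of_real_power)
  then have vp: "ip v p = of_real s" by (simp add: s_def)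
  have "ip (w i) p = cnj (ip v (w i)) * of_real ((nrm (w i))\<^sup>2)" if "i \<in> I" for i
  proof -
    have "ip (w i) p = (\<Sum>j\<in>I. if j = i then cnj (ip v (w i)) * ip (w i) (w i) else 0)"
      unfolding p_def ip_sum_right ip_scale_right using orth that by (intro sum.cong) auto
    then show ?thesis using that assms(1) by (simp add: ip_self)
  qed
  then have "ip p p = (\<Sum>i\<in>I. ip v (w i) * (cnj (ip v (w i)) * of_real ((nrm (w i))\<^sup>2)))"
    by (subst p_def) (simp add: ip_sum_left ip_scale_left)
  also have "\<dots> = of_real (\<Sum>i\<in>I. (cmod (ip v (w i)))\<^sup>2 * (nrm (w i))\<^sup>2)"
    unfolding of_real_sum
    by (intro sum.cong) (simp_all add: complex_norm_square mult.assoc del: of_real_power)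
  finally have "Re (ip p p) \<le> s"
    unfolding s_def Re_complex_of_real
    by simp (intro sum_mono mult_right_le_one_le, auto intro: power_le_one unit)
  moreover have "0 \<le> Re (ip (v - p) (v - p))" by (rule ip_nonneg)
  moreover have "ip p v = of_real s" using vp ip_commute[of p v] by simp
  moreover have "Re (ip (v - p) (v - p)) = Re (ip v v) - Re (ip v p) - Re (ip p v) + Re (ip p p)"
    by (simp add: ip_diff_left ip_diff_right)
  ultimately have "s \<le> (nrm v)\<^sup>2" unfolding vp nrm_sq by simp
  then show ?thesis by (simp add: s_def)
qed

end

text \<open>Compactness refers to \<open>nrm\<close> and asks for a limit inside the space; this
  stands in for completeness when eigenvectors are constructed.\<close>

locale compact_positive = prehilbert ip
  for ip :: "'a::complex_normed_vector \<Rightarrow> 'a \<Rightarrow> complex" +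
  fixes W :: "'a \<Rightarrow> 'a"
  assumes W_add: "W (x + y) = W x + W y"
    and W_scale: "W (c *\<^sub>C x) = c *\<^sub>C W x"
    and W_sym: "ip (W x) y = ip x (W y)"
    and W_pos: "0 \<le> Re (ip (W x) x)"
    and W_compact: "(\<And>n. nrm (X n) \<le> 1) \<Longrightarrow>
      \<exists>l \<phi>. strict_mono (\<phi> :: nat \<Rightarrow> nat) \<and> (\<lambda>n. nrm (W (X (\<phi> n)) - l)) \<longlonglongrightarrow> 0"
begin

lemma W_zero [simp]: "W 0 = 0"
  using W_scale[of 0 0] by simp

lemma W_diff: "W (x - y) = W x - W y"
  using W_add[of "x - y" y] by (simp add: algebra_simps)

lemma form_Cauchy_Schwarz:
  "(cmod (ip (W x) y))\<^sup>2 \<le> Re (ip (W x) x) * Re (ip (W y) y)"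
proof (rule semidefinite_Cauchy_Schwarz[of "\<lambda>x y. ip (W x) y"])
  show "ip (W x) y = cnj (ip (W y) x)" for x y
    by (subst W_sym) (rule ip_commute)
qed (auto simp: W_add W_scale ip_add_left ip_scale_left W_pos)

text \<open>Compactness forces boundedness: a subsequence of the \<open>W (X n)\<close> converges,
  so its products with the \<open>X n\<close> cannot grow with \<open>n\<close>.\<close>

lemma form_bounded: "\<exists>C. \<forall>v. nrm v \<le> 1 \<longrightarrow> Re (ip (W v) v) \<le> C"
proof (rule ccontr)
  assume "\<not> ?thesis"
  then have "\<forall>n. \<exists>v. nrm v \<le> 1 \<and> real n < Re (ip (W v) v)"
    by (meson not_le)
  then obtain X where X: "\<And>n. nrm (X n) \<le> 1" "\<And>n. real n < Re (ip (W (X n)) (X n))"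
    by metis
  obtain l \<phi> where *: "strict_mono (\<phi> :: nat \<Rightarrow> nat)" "(\<lambda>n. nrm (W (X (\<phi> n)) - l)) \<longlonglongrightarrow> 0"
    using W_compact[of X] X(1) by auto
  obtain K where K: "\<And>n. nrm (W (X (\<phi> n))) \<le> K"
    using Bseq_def nrm_tendsto[OF *(2)] convergent_imp_Bseq convergentI
    by (metis abs_of_nonneg nrm_nonneg real_norm_def)
  obtain n where n: "K < real n" using reals_Archimedean2 by blast
  have "real n \<le> real (\<phi> n)" using *(1) by (simp add: seq_suble)
  also have "\<dots> < Re (ip (W (X (\<phi> n))) (X (\<phi> n)))" by (rule X)
  also have "\<dots> \<le> nrm (W (X (\<phi> n))) * nrm (X (\<phi> n))"
    using Cauchy_Schwarz[of "W (X (\<phi> n))" "X (\<phi> n)"] complex_Re_le_cmod by (meson order_trans)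
  also have "\<dots> \<le> nrm (W (X (\<phi> n)))" by (simp add: X(1) mult_left_le)
  also have "\<dots> \<le> K" by (rule K)
  finally show False using n by simp
qed

definition orth :: "'a set \<Rightarrow> 'a set" where
  "orth S = {v. \<forall>w\<in>S. ip v w = 0}"

text \<open>The ball rather than the sphere, so that the supremum is \<open>0\<close> when the
  complement is trivial. If \<open>S\<close> consists of eigenvectors, this is the operator norm of
  \<open>W\<close> on \<open>orth S\<close>.\<close>

definition top_value :: "'a set \<Rightarrow> real" where
  "top_value S = (SUP v\<in>{v \<in> orth S. nrm v \<le> 1}. Re (ip (W v) v))"

lemma orth_zero [simp]: "0 \<in> orth S" by (simp add: orth_def)

lemma orth_scale: "v \<in> orth S \<Longrightarrow> c *\<^sub>C v \<in> orth S"
  by (auto simp: orth_def ip_scale_left)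

lemma orth_diff: "v \<in> orth S \<Longrightarrow> u \<in> orth S \<Longrightarrow> v - u \<in> orth S"
  by (auto simp: orth_def ip_diff_left)

lemma bdd_form: "bdd_above ((\<lambda>v. Re (ip (W v) v)) ` {v \<in> orth S. nrm v \<le> 1})"
  using form_bounded by (auto simp: bdd_above_def)

lemma top_value_upper: "v \<in> orth S \<Longrightarrow> nrm v \<le> 1 \<Longrightarrow> Re (ip (W v) v) \<le> top_value S"
  unfolding top_value_def by (rule cSUP_upper[OF _ bdd_form]) auto

lemma top_value_nonneg: "0 \<le> top_value S"
  using top_value_upper[of 0 S] by simp

lemma top_value_antimono: "S \<subseteq> S' \<Longrightarrow> top_value S' \<le> top_value S"
  unfolding top_value_def
  by (rule cSUP_subset_mono[OF _ bdd_form]) (auto simp: orth_def intro!: exI[of _ 0])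

lemma form_le_top_value:
  assumes "v \<in> orth S"
  shows "Re (ip (W v) v) \<le> top_value S * (nrm v)\<^sup>2"
proof (cases "nrm v = 0")
  case False
  then have nv: "0 < nrm v" by (metis less_eq_real_def nrm_nonneg)
  define u where "u = complex_of_real (1 / nrm v) *\<^sub>C v"
  have "nrm u = 1" using nv False by (simp add: u_def nrm_scale norm_divide)
  then have "Re (ip (W u) u) \<le> top_value S"
    using assms by (intro top_value_upper) (auto simp: u_def orth_scale)
  also have "ip (W u) u = complex_of_real (1 / nrm v) * (cnj (complex_of_real (1 / nrm v)) * ip (W v) v)"
    unfolding u_def by (simp only: W_scale ip_scale_left ip_scale_right mult.left_commute)
  also have "Re \<dots> = Re (ip (W v) v) / (nrm v)\<^sup>2"
    by (simp add: power2_eq_square)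
  finally show ?thesis by (simp only: pos_divide_le_eq[OF zero_less_power[OF nv]])
qed simp

lemma W_orth:
  assumes "\<And>w. w \<in> S \<Longrightarrow> \<exists>l. W w = l *\<^sub>C w" "v \<in> orth S"
  shows "W v \<in> orth S"
  using assms unfolding orth_def by (auto simp: W_sym ip_scale_right) (metis ip_scale_right mult_zero_right)

text \<open>Cauchy-Schwarz for the form of \<open>W\<close>, applied to \<open>v\<close> and
  \<open>W v\<close>. It turns a maximizing sequence into approximate eigenvectors and makes
  \<open>W\<close> Lipschitz on \<open>orth S\<close>.\<close>

lemma nrm_W_le:
  assumes "\<And>w. w \<in> S \<Longrightarrow> \<exists>l. W w = l *\<^sub>C w" "v \<in> orth S"
  shows "(nrm (W v))\<^sup>2 \<le> top_value S * Re (ip (W v) v)"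
proof (cases "nrm (W v) = 0")
  case True
  then show ?thesis by (simp add: top_value_nonneg W_pos)
next
  case False
  have "(nrm (W v))\<^sup>2 * (nrm (W v))\<^sup>2 = (cmod (ip (W v) (W v)))\<^sup>2"
    by (simp only: ip_self norm_of_real) (simp add: power2_eq_square)
  also have "\<dots> \<le> Re (ip (W v) v) * Re (ip (W (W v)) (W v))"
    by (rule form_Cauchy_Schwarz)
  also have "\<dots> \<le> Re (ip (W v) v) * (top_value S * (nrm (W v))\<^sup>2)"
    by (intro mult_left_mono form_le_top_value W_orth assms W_pos) auto
  finally have "(nrm (W v))\<^sup>2 * (nrm (W v))\<^sup>2 \<le> top_value S * Re (ip (W v) v) * (nrm (W v))\<^sup>2"
    by (simp only: ac_simps)
  then show ?thesis
    by (rule mult_right_le_imp_le) (use False in simp)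
qed

text \<open>A sequence that maximizes the form consists of approximate eigenvectors, and compactness
  makes a subsequence converge. If the supremum is \<open>0\<close>, the zero vector serves, so that
  the recursion below never stops.\<close>

lemma eigenvector_exists:
  assumes S: "\<And>w. w \<in> S \<Longrightarrow> \<exists>l. W w = l *\<^sub>C w"
  shows "\<exists>w\<in>orth S. W w = of_real (top_value S) *\<^sub>C w \<and> (nrm w = 1 \<or> w = 0 \<and> top_value S = 0)"
proof (cases "top_value S = 0")
  case True
  then show ?thesis by (intro bexI[of _ 0]) auto
next
  case False
  define l where "l = top_value S"
  have l: "0 < l" using False top_value_nonneg[of S] by (simp add: l_def)
  have "\<exists>v. v \<in> orth S \<and> nrm v \<le> 1 \<and> l - 1 / real (Suc n) < Re (ip (W v) v)" for n
  proof -
    have "l - 1 / real (Suc n) < (SUP v\<in>{v \<in> orth S. nrm v \<le> 1}. Re (ip (W v) v))"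
      by (simp add: l_def top_value_def)
    then show ?thesis
      by (subst (asm) less_cSUP_iff[OF _ bdd_form]) (auto intro!: exI[of _ 0])
  qed
  then obtain X where X: "\<And>n. X n \<in> orth S" "\<And>n. nrm (X n) \<le> 1"
      "\<And>n. l - 1 / real (Suc n) < Re (ip (W (X n)) (X n))" by metis
  obtain y \<phi> where \<phi>: "strict_mono (\<phi> :: nat \<Rightarrow> nat)" and y: "(\<lambda>n. nrm (W (X (\<phi> n)) - y)) \<longlonglongrightarrow> 0"
    using W_compact[of X] X(2) by auto
  define Y where "Y = X \<circ> \<phi>"
  define q where "q = (\<lambda>v. Re (ip (W v) v))"
  have "(\<lambda>n. q (X n)) \<longlonglongrightarrow> l"
  proof (rule tendsto_sandwich)
    show "(\<lambda>n. l - 1 / real (Suc n)) \<longlonglongrightarrow> l"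
      using tendsto_diff[OF tendsto_const LIMSEQ_Suc[OF lim_1_over_n], of l] by simp
    show "\<forall>\<^sub>F n in sequentially. q (X n) \<le> l"
      unfolding q_def l_def by (intro always_eventually allI top_value_upper X)
  qed (use X(3) in \<open>auto simp: q_def less_imp_le\<close>)
  then have q: "(\<lambda>n. q (Y n)) \<longlonglongrightarrow> l"
    using \<phi> LIMSEQ_subseq_LIMSEQ[of "\<lambda>n. q (X n)" l \<phi>] by (simp add: Y_def o_def)
  have bound: "(nrm (W (Y n) - of_real l *\<^sub>C Y n))\<^sup>2 \<le> l * (l - q (Y n))" for n
  proof -
    have "(nrm (W (Y n) - of_real l *\<^sub>C Y n))\<^sup>2 = (nrm (W (Y n)))\<^sup>2 - 2 * l * q (Y n) + l\<^sup>2 * (nrm (Y n))\<^sup>2"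
      using W_sym[of "Y n" "Y n"]
      by (simp add: nrm_sq ip_diff_left ip_diff_right ip_scale_left ip_scale_right q_def)
        (simp add: power2_eq_square algebra_simps)
    also have "\<dots> \<le> l * q (Y n) - 2 * l * q (Y n) + l\<^sup>2 * 1"
      using nrm_W_le[where v = "Y n" and S = S, OF S] X l
      by (intro add_mono diff_mono mult_left_mono power_le_one) (auto simp: q_def l_def Y_def)
    finally show ?thesis by (simp add: algebra_simps power2_eq_square)
  qed
  have "(\<lambda>n. (nrm (W (Y n) - of_real l *\<^sub>C Y n))\<^sup>2) \<longlonglongrightarrow> 0"
  proof (rule Lim_null_comparison)
    show "(\<lambda>n. l * (l - q (Y n))) \<longlonglongrightarrow> 0"
      using tendsto_mult[OF tendsto_const tendsto_diff[OF tendsto_const q], of l l] by simp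
    show "\<forall>\<^sub>F n in sequentially. norm ((nrm (W (Y n) - of_real l *\<^sub>C Y n))\<^sup>2) \<le> l * (l - q (Y n))"
      by (intro always_eventually allI) (simp only: real_norm_def abs_power2 bound)
  qed
  then have d: "(\<lambda>n. nrm (W (Y n) - of_real l *\<^sub>C Y n)) \<longlonglongrightarrow> 0"
    using tendsto_real_sqrt[of "\<lambda>n. (nrm (W (Y n) - of_real l *\<^sub>C Y n))\<^sup>2" 0] by simp
  have y': "(\<lambda>n. nrm (W (Y n) - y)) \<longlonglongrightarrow> 0" using y by (simp add: Y_def)
  \<comment> \<open>\<open>W (Y n)\<close> tends to \<open>y\<close> and
    \<open>W (Y n) - l Y n\<close> to \<open>0\<close>, so \<open>y / l\<close> must be the limit of
    \<open>Y n\<close>.\<close>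
  define w where "w = of_real (1 / l) *\<^sub>C y"
  have yw: "y = of_real l *\<^sub>C w" using l by (simp add: w_def scaleC_scaleC flip: of_real_mult)
  have "l * nrm (Y n - w) \<le> nrm (W (Y n) - of_real l *\<^sub>C Y n) + nrm (W (Y n) - y)" for n
  proof -
    have "l * nrm (Y n - w) = nrm (of_real l *\<^sub>C (Y n - w))" using l by (simp add: nrm_scale)
    also have "\<dots> = nrm (of_real l *\<^sub>C Y n - y)" by (simp add: yw cvec.scale_right_diff_distrib)
    also have "\<dots> \<le> nrm (of_real l *\<^sub>C Y n - W (Y n)) + nrm (W (Y n) - y)"
      by (rule nrm_diff_triangle)
    finally show ?thesis by (simp add: nrm_diff_commute)
  qed
  then have bound': "nrm (Y n - w) \<le> (nrm (W (Y n) - of_real l *\<^sub>C Y n) + nrm (W (Y n) - y)) / l" for n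
    using l by (simp add: pos_le_divide_eq mult.commute)
  have lim': "(\<lambda>n. (nrm (W (Y n) - of_real l *\<^sub>C Y n) + nrm (W (Y n) - y)) / l) \<longlonglongrightarrow> 0"
    using tendsto_divide[OF tendsto_add[OF d y'] tendsto_const, of l] l by simp
  have Yw: "(\<lambda>n. nrm (Y n - w)) \<longlonglongrightarrow> 0"
    by (rule Lim_null_comparison[OF always_eventually lim'])
      (simp only: real_norm_def abs_of_nonneg nrm_nonneg bound' simp_thms)
  have w: "w \<in> orth S"
  proof -
    have "ip w u = 0" if "u \<in> S" for u
      using ip_tendsto[OF Yw, of u] X(1) that LIMSEQ_unique[of "\<lambda>n. ip (Y n) u" 0]
      by (auto simp: orth_def Y_def)
    then show ?thesis by (simp add: orth_def)
  qed
  \<comment> \<open>Continuity of \<open>W\<close> in \<open>nrm\<close>, obtained on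
    \<open>orth S\<close> with constant \<open>l\<close>.\<close>
  have bound'': "nrm (W (Y n) - W w) \<le> l * nrm (Y n - w)" for n
  proof (rule power2_le_imp_le)
    have o: "Y n - w \<in> orth S" using X w by (intro orth_diff) (auto simp: Y_def)
    have "(nrm (W (Y n - w)))\<^sup>2 \<le> l * Re (ip (W (Y n - w)) (Y n - w))"
      unfolding l_def by (rule nrm_W_le[OF S o])
    also have "\<dots> \<le> l * (l * (nrm (Y n - w))\<^sup>2)"
      using form_le_top_value[OF o] l by (intro mult_left_mono) (auto simp: l_def)
    finally show "(nrm (W (Y n) - W w))\<^sup>2 \<le> (l * nrm (Y n - w))\<^sup>2"
      by (simp add: W_diff power2_eq_square mult.assoc mult.left_commute)
  qed (use l in auto)
  have lim'': "(\<lambda>n. l * nrm (Y n - w)) \<longlonglongrightarrow> 0"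
    using tendsto_mult[OF tendsto_const Yw, of l] by simp
  have Ww: "(\<lambda>n. nrm (W (Y n) - W w)) \<longlonglongrightarrow> 0"
    by (rule Lim_null_comparison[OF always_eventually lim''])
      (simp only: real_norm_def abs_of_nonneg nrm_nonneg bound'' simp_thms)
  have "nrm (W w - y) \<le> nrm (W (Y n) - W w) + nrm (W (Y n) - y)" for n
    using nrm_diff_triangle[of "W w" y "W (Y n)"] by (simp add: nrm_diff_commute)
  then have "nrm (W w - y) \<le> 0"
    using tendsto_add[OF Ww y'] by (intro LIMSEQ_le_const[of _ 0]) auto
  then have "nrm (W w - y) = 0" by (simp only: antisym_conv nrm_nonneg)
  then have eig: "W w = of_real l *\<^sub>C w" using yw by simp
  have lim: "(\<lambda>n. nrm (Y n)) \<longlonglongrightarrow> nrm w" by (rule nrm_tendsto[OF Yw])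
  \<comment> \<open>The form values tend to \<open>l\<close>, so the limit cannot have norm below
    \<open>1\<close>.\<close>
  have "l \<le> l * (nrm w)\<^sup>2"
  proof (rule LIMSEQ_le[OF q])
    show "(\<lambda>n. l * (nrm (Y n))\<^sup>2) \<longlonglongrightarrow> l * (nrm w)\<^sup>2" by (intro tendsto_intros lim)
    show "\<exists>N. \<forall>n\<ge>N. q (Y n) \<le> l * (nrm (Y n))\<^sup>2"
      using form_le_top_value X(1) by (auto simp: q_def l_def Y_def)
  qed
  then have "1 \<le> (nrm w)\<^sup>2" using l by simp
  then have "1 \<le> nrm w" by (metis abs_le_square_iff abs_of_nonneg nrm_nonneg one_power2 abs_one)
  moreover have "nrm w \<le> 1" using X(2) by (intro LIMSEQ_le_const2[OF lim]) (auto simp: Y_def)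
  ultimately have "nrm w = 1" by simp
  then show ?thesis using w eig by (auto simp: l_def)
qed

text \<open>The positive eigenvalues with multiplicity in decreasing order, padded by eigenvalues
  \<open>0\<close> whose vectors may vanish. The last clause, the extremal property, yields both the
  completeness of the eigenspaces and the estimates on complements.\<close>

definition eigensystem :: "(nat \<Rightarrow> 'a) \<Rightarrow> (nat \<Rightarrow> real) \<Rightarrow> bool" where
  "eigensystem w l \<longleftrightarrow>
     (\<forall>n. W (w n) = of_real (l n) *\<^sub>C w n) \<and> (\<forall>m n. m \<noteq> n \<longrightarrow> ip (w m) (w n) = 0) \<and>
     (\<forall>n. nrm (w n) = 1 \<or> w n = 0 \<and> l n = 0) \<and> (\<forall>n. 0 \<le> l n) \<and> decseq l \<and> l \<longlonglongrightarrow> 0 \<and>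
     (\<forall>n v. (\<forall>k<n. ip v (w k) = 0) \<longrightarrow> Re (ip (W v) v) \<le> l n * (nrm v)\<^sup>2)"

text \<open>If the eigenvalues stayed above \<open>L > 0\<close>, the images of the orthonormal
  vectors would have mutual distance at least \<open>L\<close>, against compactness.\<close>

lemma orthonormal_eigenvalues_tendsto_0:
  assumes W: "\<And>n. W (w n) = of_real (l n) *\<^sub>C w n"
    and orth: "\<And>m n. m \<noteq> n \<Longrightarrow> ip (w m) (w n) = 0"
    and unit: "\<And>n. nrm (w n) = 1 \<or> w n = 0 \<and> l n = 0"
    and l: "\<And>n. 0 \<le> l n" "decseq l"
  shows "l \<longlonglongrightarrow> 0"
proof -
  obtain L where L: "l \<longlonglongrightarrow> L" "\<And>n. L \<le> l n"
    using decseq_convergent[OF l(2), of 0] l(1) by auto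
  have "0 \<le> L" using L(1) l(1) by (intro LIMSEQ_le_const) auto
  moreover have False if "0 < L"
  proof -
    have pos: "0 < l n" for n using that L(2) by (rule less_le_trans)
    then have u: "nrm (w n) = 1" for n using unit[of n] by (metis less_irrefl)
    obtain y \<phi> where \<phi>: "strict_mono (\<phi> :: nat \<Rightarrow> nat)"
        and y: "(\<lambda>n. nrm (W (w (\<phi> n)) - y)) \<longlonglongrightarrow> 0"
      using W_compact[of w] u by auto
    have "\<forall>\<^sub>F n in sequentially. nrm (W (w (\<phi> n)) - y) < L / 2"
      using that by (intro order_tendstoD(2)[OF y]) simp
    then obtain N where N: "\<And>n. n \<ge> N \<Longrightarrow> nrm (W (w (\<phi> n)) - y) < L / 2"
      unfolding eventually_sequentially by blast
    have ne: "\<phi> N \<noteq> \<phi> (Suc N)" using strict_monoD[OF \<phi>, of N "Suc N"] by simp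
    define d where "d = W (w (\<phi> N)) - W (w (\<phi> (Suc N)))"
    have "nrm d \<le> nrm (W (w (\<phi> N)) - y) + nrm (y - W (w (\<phi> (Suc N))))"
      unfolding d_def by (rule nrm_diff_triangle)
    also have "\<dots> < L" using N[of N] N[of "Suc N"] by (simp add: nrm_diff_commute)
    finally have dL: "nrm d < L" .
    have "L * 1 \<le> l (\<phi> N) * 1" using L(2) by simp
    also have "l (\<phi> N) * 1 = cmod (ip d (w (\<phi> N)))"
      unfolding d_def W using orth[of "\<phi> (Suc N)" "\<phi> N"] ne u l
      by (simp add: ip_diff_left ip_scale_left ip_self)
    also have "\<dots> \<le> nrm d * nrm (w (\<phi> N))" by (rule Cauchy_Schwarz)
    finally show False using dL u by simp
  qed
  ultimately have "L = 0" by force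
  then show ?thesis using L(1) by simp
qed

definition top_eigenvector :: "'a set \<Rightarrow> 'a" where
  "top_eigenvector S = (SOME w. w \<in> orth S \<and> W w = of_real (top_value S) *\<^sub>C w \<and>
     (nrm w = 1 \<or> w = 0 \<and> top_value S = 0))"

primrec eigenvectors :: "nat \<Rightarrow> 'a set" where
  "eigenvectors 0 = {}"
| "eigenvectors (Suc n) = insert (top_eigenvector (eigenvectors n)) (eigenvectors n)"

text \<open>The choice in \<open>top_eigenvector\<close> is known to succeed only when the earlier
  vectors are eigenvectors, hence the strong induction.\<close>

theorem eigensystem_exists: "\<exists>w l. eigensystem w l"
proof -
  define w where "w n = top_eigenvector (eigenvectors n)" for n
  define l where "l n = top_value (eigenvectors n)" for n
  have S: "eigenvectors n = w ` {..<n}" for n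
    by (induction n) (auto simp: w_def lessThan_Suc)
  have "w n \<in> orth (eigenvectors n) \<and> W (w n) = of_real (l n) *\<^sub>C w n \<and>
      (nrm (w n) = 1 \<or> w n = 0 \<and> l n = 0)" for n
  proof (induction n rule: less_induct)
    case (less n)
    have "\<exists>x\<in>orth (eigenvectors n). W x = of_real (top_value (eigenvectors n)) *\<^sub>C x \<and>
        (nrm x = 1 \<or> x = 0 \<and> top_value (eigenvectors n) = 0)"
      by (rule eigenvector_exists) (use less in \<open>auto simp: S\<close>)
    then show ?case
      unfolding w_def l_def top_eigenvector_def Bex_def by (rule someI_ex)
  qed
  then have w: "\<And>n. w n \<in> orth (eigenvectors n)" "\<And>n. W (w n) = of_real (l n) *\<^sub>C w n"
      "\<And>n. nrm (w n) = 1 \<or> w n = 0 \<and> l n = 0" by auto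
  have "ip (w n) (w m) = 0" if "m < n" for m n
    using w(1)[of n] that by (auto simp: orth_def S)
  then have orthw: "ip (w m) (w n) = 0" if "m \<noteq> n" for m n
    using that ip_commute[of "w m" "w n"] by (cases "m < n") auto
  have l: "0 \<le> l n" for n by (simp add: l_def top_value_nonneg)
  have dec: "decseq l"
    unfolding decseq_Suc_iff l_def by (intro allI top_value_antimono) auto
  have le: "Re (ip (W v) v) \<le> l n * (nrm v)\<^sup>2" if "\<forall>k<n. ip v (w k) = 0" for n v
    unfolding l_def by (rule form_le_top_value) (use that in \<open>auto simp: orth_def S\<close>)
  have lim: "l \<longlonglongrightarrow> 0"
    by (rule orthonormal_eigenvalues_tendsto_0[OF w(2) orthw w(3) l dec])
  show ?thesis
    unfolding eigensystem_def by (intro exI[of _ w] exI[of _ l]) (use w orthw l dec le lim in blast)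
qed

context
  fixes w :: "nat \<Rightarrow> 'a" and l :: "nat \<Rightarrow> real"
  assumes es: "eigensystem w l"
begin

lemma eigensystemD:
  "W (w n) = of_real (l n) *\<^sub>C w n" "m \<noteq> n \<Longrightarrow> ip (w m) (w n) = 0"
  "nrm (w n) = 1 \<or> w n = 0 \<and> l n = 0" "0 \<le> l n" "decseq l" "l \<longlonglongrightarrow> 0"
  "(\<And>k. k < n \<Longrightarrow> ip v (w k) = 0) \<Longrightarrow> Re (ip (W v) v) \<le> l n * (nrm v)\<^sup>2"
  using es unfolding eigensystem_def by blast+

lemma finite_eigenvalue_indices: "0 < t \<Longrightarrow> finite {k. t \<le> l k}"
proof -
  assume "0 < t"
  then obtain N where "\<And>n. n \<ge> N \<Longrightarrow> l n < t"
    using order_tendstoD(2)[OF eigensystemD(6)] by (auto simp: eventually_sequentially)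
  then have "{k. t \<le> l k} \<subseteq> {..<N}" by (auto simp: not_less[symmetric])
  then show ?thesis by (rule finite_subset) simp
qed

text \<open>The remainder \<open>y\<close> of \<open>x\<close> is again an eigenvector for
  \<open>t\<close> and is orthogonal to every \<open>w k\<close>, to those with another eigenvalue
  by symmetry of \<open>W\<close>. The extremal property then compares \<open>t\<close> with every
  \<open>l n\<close>, and these tend to \<open>0\<close>, so \<open>y\<close> vanishes.\<close>

lemma eigenspace_expansion:
  assumes "0 < t" and x: "W x = of_real t *\<^sub>C x"
  shows "x = (\<Sum>k | l k = t. ip x (w k) *\<^sub>C w k)"
proof -
  define I where "I = {k. l k = t}"
  have fin: "finite I" unfolding I_def
    by (rule finite_subset[OF _ finite_eigenvalue_indices[OF assms(1)]]) auto
  define y where "y = x - (\<Sum>k\<in>I. ip x (w k) *\<^sub>C w k)"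
  have unit: "ip (w k) (w k) = 1" if "k \<in> I" for k
    using eigensystemD(3)[of k] that assms(1) by (auto simp: I_def ip_self)
  have Wy: "W y = of_real t *\<^sub>C y"
    unfolding y_def W_diff clinear_sum[of W, OF W_add W_scale] x cvec.scale_right_diff_distrib
      cvec.scale_sum_right
    by (intro arg_cong2[where f = minus] refl sum.cong)
      (auto simp: eigensystemD(1) I_def scaleC_scaleC mult.commute)
  have "ip y (w k) = 0" for k
  proof (cases "k \<in> I")
    case True
    have "(\<Sum>j\<in>I. ip x (w j) * ip (w j) (w k)) = (\<Sum>j\<in>I. if j = k then ip x (w k) else 0)"
      using eigensystemD(2) unit[OF True] by (intro sum.cong) auto
    then show ?thesis using True fin
      by (simp add: y_def ip_diff_left ip_sum_left ip_scale_left)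
  next
    case False
    have "of_real t * ip y (w k) = ip (W y) (w k)" by (simp add: Wy ip_scale_left)
    also have "\<dots> = of_real (l k) * ip y (w k)"
      by (simp add: W_sym eigensystemD(1) ip_scale_right)
    finally show ?thesis using False by (auto simp: I_def)
  qed
  then have le: "t * (nrm y)\<^sup>2 \<le> l n * (nrm y)\<^sup>2" for n
    using eigensystemD(7)[of n y] by (simp add: Wy ip_scale_left ip_self)
  have "t * (nrm y)\<^sup>2 \<le> 0 * (nrm y)\<^sup>2"
    by (rule LIMSEQ_le_const[of "\<lambda>n. l n * (nrm y)\<^sup>2"])
      (use le in \<open>auto intro: tendsto_mult_left_zero eigensystemD(6)\<close>)
  then have "nrm y = 0" using assms(1)
    by (simp add: mult_le_0_iff)
  then show ?thesis by (simp add: y_def I_def)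
qed

lemma inj_on_eigenvectors:
  assumes "0 < t"
  shows "inj_on w {k. l k = t}"
proof (rule inj_onI, rule ccontr)
  fix a b assume ab: "a \<in> {k. l k = t}" "w a = w b" "a \<noteq> b"
  have "ip (w a) (w a) = 0" using eigensystemD(2)[OF ab(3)] by (simp only: ab(2))
  then have "w a = 0" by (rule ip_definite)
  then show False using eigensystemD(3)[of a] ab(1) assms by simp
qed

lemma eigenspace_span:
  assumes "0 < t"
  shows "{x. W x = of_real t *\<^sub>C x} \<subseteq> cvec.span (w ` {k. l k = t})"
proof
  fix x assume "x \<in> {x. W x = of_real t *\<^sub>C x}"
  then have "x = (\<Sum>k | l k = t. ip x (w k) *\<^sub>C w k)"
    using eigenspace_expansion[OF assms] by simp
  moreover have "(\<Sum>k | l k = t. ip x (w k) *\<^sub>C w k) \<in> cvec.span (w ` {k. l k = t})"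
    by (intro cvec.span_sum cvec.span_scale cvec.span_base) auto
  ultimately show "x \<in> cvec.span (w ` {k. l k = t})" by simp
qed

text \<open>Reconciles the repetitions in the eigensystem with the count by dimension in
  \<open>is_singular_numbers\<close>.\<close>

lemma dim_eigenspace:
  assumes "0 < t"
  shows "cvec.dim {x. W x = of_real t *\<^sub>C x} = card {k. l k = t}"
proof -
  define I where "I = {k. l k = t}"
  have fin: "finite I" unfolding I_def
    by (rule finite_subset[OF _ finite_eigenvalue_indices[OF assms(1)]]) auto
  have inj: "inj_on w I" unfolding I_def by (rule inj_on_eigenvectors[OF assms])
  have unit: "ip (w k) (w k) = 1" if "k \<in> I" for k
    using eigensystemD(3)[of k] that assms(1) by (auto simp: I_def ip_self)
  have "cvec.independent (w ` I)"
  proof (rule cvec.independent_if_scalars_zero)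
    fix c x assume c: "(\<Sum>x\<in>w ` I. c x *\<^sub>C x) = 0" and "x \<in> w ` I"
    then obtain k where k: "k \<in> I" "x = w k" by auto
    have "0 = ip (\<Sum>j\<in>I. c (w j) *\<^sub>C w j) (w k)" using c by (simp add: sum.reindex[OF inj])
    also have "\<dots> = (\<Sum>j\<in>I. if j = k then c (w k) else 0)"
      unfolding ip_sum_left ip_scale_left using eigensystemD(2) unit[OF k(1)]
      by (intro sum.cong) auto
    finally show "c x = 0" using k fin by simp
  qed (use fin in simp)
  moreover have "w ` I \<subseteq> {x. W x = of_real t *\<^sub>C x}"
    by (auto simp: I_def eigensystemD(1))
  ultimately have "cvec.dim {x. W x = of_real t *\<^sub>C x} = card (w ` I)"
    using eigenspace_span[OF assms] by (intro cvec.dim_unique) (auto simp: I_def)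
  then show ?thesis by (simp only: card_image[OF inj]) (simp add: I_def)
qed

end

end

section \<open>Operators on Hilbert spaces\<close>

lemma prehilbert_cinner: "prehilbert (cinner :: 'h::complex_hilbert \<Rightarrow> 'h \<Rightarrow> complex)"
proof
  fix x :: 'h
  show "0 \<le> Re (cinner x x)" by (simp flip: inner_eq_Re_cinner)
  assume "cinner x x = 0"
  then have "inner x x = 0" by (simp add: inner_eq_Re_cinner)
  then show "x = 0" by simp
qed (rule cinner_add_left cinner_scaleC_left cinner_commute)+

lemma nrm_cinner: "prehilbert.nrm (cinner :: 'h::complex_hilbert \<Rightarrow> 'h \<Rightarrow> complex) = norm"
  by (simp add: prehilbert.nrm_def[OF prehilbert_cinner] fun_eq_iff norm_eq_sqrt_inner
      inner_eq_Re_cinner)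

global_interpretation hil: prehilbert "cinner :: 'h::complex_hilbert \<Rightarrow> 'h \<Rightarrow> complex"
  rewrites "prehilbert.nrm (cinner :: 'h \<Rightarrow> 'h \<Rightarrow> complex) = norm"
  by (rule prehilbert_cinner nrm_cinner)+

lemma bounded_clinearD:
  assumes "bounded_clinear T"
  shows "bounded_linear T" "T (x + y) = T x + T y" "T (c *\<^sub>C x) = c *\<^sub>C T x"
    "T 0 = 0" "T (x - y) = T x - T y" "T (\<Sum>i\<in>I. f i) = (\<Sum>i\<in>I. T (f i))"
    "\<exists>K\<ge>0. \<forall>x. norm (T x) \<le> K * norm x"
proof -
  show bl: "bounded_linear T" "T (c *\<^sub>C x) = c *\<^sub>C T x" using assms by (auto simp: bounded_clinear_def)
  interpret bounded_linear T by (rule bl)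
  show "T (x + y) = T x + T y" "T 0 = 0" "T (x - y) = T x - T y"
    "T (\<Sum>i\<in>I. f i) = (\<Sum>i\<in>I. T (f i))" by (rule add zero diff sum)+
  show "\<exists>K\<ge>0. \<forall>x. norm (T x) \<le> K * norm x"
    using nonneg_bounded by (metis mult.commute)
qed

lemma bounded_clinearI:
  assumes "\<And>x y. T (x + y) = T x + T y" "\<And>c x. T (c *\<^sub>C x) = c *\<^sub>C T x"
    "\<And>x. norm (T x) \<le> K * norm x"
  shows "bounded_clinear T"
  unfolding bounded_clinear_def
proof (intro conjI allI assms)
  show "bounded_linear T"
    by (rule bounded_linear_intro[where K = K])
      (use assms in \<open>auto simp: scaleR_scaleC mult.commute\<close>)
qed

lemma minimal_norm_orthogonal:
  fixes z v :: "'h::complex_hilbert"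
  assumes "\<And>t. norm z \<le> norm (z - t *\<^sub>C v)"
  shows "cinner v z = 0"
proof (cases "v = 0")
  case False
  define b t where "b = cinner z v" and "t = b / of_real ((norm v)\<^sup>2)"
  have nv: "(norm v)\<^sup>2 \<noteq> 0" using False by simp
  have b': "cinner v z = cnj b" unfolding b_def by (rule cinner_commute)
  have "(norm z)\<^sup>2 \<le> (norm (z - t *\<^sub>C v))\<^sup>2" using assms by (intro power_mono) auto
  also have "\<dots> = Re (cinner z z - cnj t * b - t * cnj b + t * cnj t * cinner v v)"
    unfolding hil.nrm_sq hil.ip_diff_left hil.ip_diff_right hil.ip_scale_left hil.ip_scale_right
    by (simp add: b' algebra_simps flip: b_def)
  also have "t * cnj t * cinner v v = t * (cnj t * of_real ((norm v)\<^sup>2))"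
    by (simp add: hil.ip_self)
  also have "cnj t * of_real ((norm v)\<^sup>2) = cnj b"
    using nv by (simp add: t_def)
  also have "cinner z z - cnj t * b - t * cnj b + t * cnj b = of_real ((norm z)\<^sup>2) - cnj t * b"
    by (simp add: hil.ip_self)
  also have "cnj t * b = of_real ((cmod b)\<^sup>2 / (norm v)\<^sup>2)"
    unfolding of_real_divide complex_norm_square by (simp add: t_def mult.commute)
  finally have "(cmod b)\<^sup>2 / (norm v)\<^sup>2 \<le> 0" by (simp del: of_real_divide of_real_power)
  then have "b = 0" using nv by (simp add: divide_le_0_iff)
  then show ?thesis by (simp add: b')
qed simp

text \<open>The representing vector is a multiple of the point of least norm on the hyperplane
  \<open>\<phi> x = 1\<close>. This point exists by the parallelogram law and is orthogonal to the
  kernel.\<close>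

theorem Riesz_representation:
  fixes \<phi> :: "'h::complex_hilbert \<Rightarrow> complex"
  assumes "bounded_clinear \<phi>"
  shows "\<exists>y. \<forall>x. \<phi> x = cinner x y"
proof (cases "\<forall>x. \<phi> x = 0")
  case True
  then show ?thesis by (intro exI[of _ 0]) simp
next
  case False
  note \<phi> = bounded_clinearD[OF assms, unfolded scaleC_complex_def]
  obtain x0 where x0: "\<phi> x0 \<noteq> 0" using False by auto
  define C where "C = {x. \<phi> x = 1}"
  have "(1 / \<phi> x0) *\<^sub>C x0 \<in> C" using x0 by (simp add: C_def \<phi>)
  then have ne: "C \<noteq> {}" by auto
  define d where "d = (INF x\<in>C. norm x)"
  have bdd: "bdd_below (norm ` C)" by (intro bdd_belowI[of _ 0]) auto
  have d_le: "d \<le> norm x" if "x \<in> C" for x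
    unfolding d_def by (rule cINF_lower[OF bdd that])
  have d0: "0 \<le> d" unfolding d_def by (rule cINF_greatest[OF ne]) simp
  have "\<exists>x\<in>C. norm x < d + 1 / real (Suc n)" for n
    using cINF_less_iff[OF ne bdd, of "d + 1 / real (Suc n)"] by (simp add: d_def)
  then obtain X where X: "\<And>n. X n \<in> C" "\<And>n. norm (X n) < d + 1 / real (Suc n)" by metis
  have "(\<lambda>n. norm (X n)) \<longlonglongrightarrow> d"
  proof (rule tendsto_sandwich)
    show "(\<lambda>n. d) \<longlonglongrightarrow> d" by simp
    show "(\<lambda>n. d + 1 / real (Suc n)) \<longlonglongrightarrow> d"
      using tendsto_add[OF tendsto_const LIMSEQ_Suc[OF lim_1_over_n], of d] by simp
  qed (use X d_le in \<open>auto simp: less_imp_le\<close>)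
  then have "(\<lambda>n. (norm (X n))\<^sup>2) \<longlonglongrightarrow> d\<^sup>2" by (intro tendsto_intros)
  then have sq: "\<exists>N. \<forall>n\<ge>N. (norm (X n))\<^sup>2 < d\<^sup>2 + e" if "e > 0" for e
    unfolding eventually_sequentially[symmetric] by (rule order_tendstoD(2)) (use that in simp)
  have par: "(norm (x - y))\<^sup>2 \<le> 2 * (norm x)\<^sup>2 + 2 * (norm y)\<^sup>2 - 4 * d\<^sup>2" if "x \<in> C" "y \<in> C" for x y
  proof -
    have "(1/2) *\<^sub>C (x + y) \<in> C" using that by (simp add: C_def \<phi>)
    from d_le[OF this] have "d \<le> norm (x + y) / 2" by (simp add: norm_scaleC)
    then have "d\<^sup>2 \<le> (norm (x + y) / 2)\<^sup>2" using d0 by (intro power_mono)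
    moreover have "(norm (x + y))\<^sup>2 + (norm (x - y))\<^sup>2 = 2 * (norm x)\<^sup>2 + 2 * (norm y)\<^sup>2"
      by (simp add: power2_norm_eq_inner inner_add inner_diff algebra_simps)
    ultimately show ?thesis by (simp add: power_divide)
  qed
  have "Cauchy X"
  proof (rule metric_CauchyI)
    fix e :: real assume "0 < e"
    then obtain N where N: "\<And>n. n \<ge> N \<Longrightarrow> (norm (X n))\<^sup>2 < d\<^sup>2 + e\<^sup>2 / 4"
      using sq[of "e\<^sup>2 / 4"] by auto
    have "dist (X m) (X n) < e" if "m \<ge> N" "n \<ge> N" for m n
    proof -
      have "(norm (X m - X n))\<^sup>2 < e\<^sup>2"
        using par[OF X(1) X(1), of m n] N[OF that(1)] N[OF that(2)] by simp
      then show ?thesis using \<open>0 < e\<close> by (simp add: dist_norm power_less_imp_less_base)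
    qed
    then show "\<exists>N. \<forall>m\<ge>N. \<forall>n\<ge>N. dist (X m) (X n) < e" by blast
  qed
  then obtain z where z: "X \<longlonglongrightarrow> z" by (auto simp: Cauchy_convergent_iff convergent_def)
  have "(\<lambda>n. \<phi> (X n)) \<longlonglongrightarrow> \<phi> z" by (rule bounded_linear.tendsto[OF \<phi>(1) z])
  then have zC: "\<phi> z = 1" using X(1) by (simp add: C_def LIMSEQ_const_iff)
  have nz: "norm z = d"
    using LIMSEQ_unique[OF tendsto_norm[OF z] \<open>(\<lambda>n. norm (X n)) \<longlonglongrightarrow> d\<close>] .
  have orth: "cinner v z = 0" if "\<phi> v = 0" for v
  proof (rule minimal_norm_orthogonal)
    fix t show "norm z \<le> norm (z - t *\<^sub>C v)"
      unfolding nz by (rule d_le) (use that zC in \<open>simp add: C_def \<phi>\<close>)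
  qed
  have z0: "norm z \<noteq> 0" using zC \<phi>(4) by auto
  have "\<phi> x = cinner x (of_real (1 / (norm z)\<^sup>2) *\<^sub>C z)" for x
  proof -
    have "cinner (x - \<phi> x *\<^sub>C z) z = 0" by (rule orth) (simp add: \<phi> zC)
    then have "cinner x z = \<phi> x * of_real ((norm z)\<^sup>2)"
      by (simp add: hil.ip_diff_left hil.ip_scale_left hil.ip_self)
    then show ?thesis using z0 by (simp add: hil.ip_scale_right)
  qed
  then show ?thesis by blast
qed

lemma cinner_ext:
  fixes u v :: "'h::complex_hilbert"
  assumes "\<And>x. cinner x u = cinner x v"
  shows "u = v"
proof -
  have "cinner (u - v) (u - v) = 0" by (simp add: hil.ip_diff_right assms)
  then show ?thesis using hil.ip_definite[of "u - v"] by simp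
qed

text \<open>Riesz gives existence and \<open>cinner_ext\<close> uniqueness, so the description in
  \<open>cadjoint\<close> denotes an operator.\<close>

lemma cadjoint:
  fixes T :: "'a::complex_hilbert \<Rightarrow> 'b::complex_hilbert"
  assumes "bounded_clinear T"
  shows "cinner (T x) y = cinner x (cadjoint T y)"
proof -
  obtain K where K: "\<And>x. norm (T x) \<le> K * norm x" using bounded_clinearD(7)[OF assms] by auto
  have "bounded_clinear (\<lambda>x. cinner (T x) y)" for y
  proof (rule bounded_clinearI[where K = "K * norm y"])
    fix x
    have "norm (cinner (T x) y) \<le> norm (T x) * norm y" by (rule hil.Cauchy_Schwarz)
    also have "\<dots> \<le> (K * norm x) * norm y" by (intro mult_right_mono K) simp
    finally show "norm (cinner (T x) y) \<le> K * norm y * norm x" by (simp add: ac_simps)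
  qed (simp_all add: bounded_clinearD[OF assms] hil.ip_add_left hil.ip_scale_left scaleC_complex_def)
  then have "\<forall>y. \<exists>z. \<forall>x. cinner (T x) y = cinner x z" using Riesz_representation by blast
  then obtain S where S: "\<forall>x y. cinner (T x) y = cinner x (S y)" by metis
  have "\<forall>x y. cinner (T x) y = cinner x (cadjoint T y)"
    unfolding cadjoint_def
  proof (rule theI[of "\<lambda>S. \<forall>x y. cinner (T x) y = cinner x (S y)", OF S])
    fix S' assume S': "\<forall>x y. cinner (T x) y = cinner x (S' y)"
    show "S' = S" by (intro ext cinner_ext) (metis S S')
  qed
  then show ?thesis by blast
qed

lemma bounded_clinear_cadjoint:
  fixes T :: "'a::complex_hilbert \<Rightarrow> 'b::complex_hilbert"
  assumes "bounded_clinear T"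
  shows "bounded_clinear (cadjoint T)"
proof -
  obtain K where K: "0 \<le> K" "\<And>x. norm (T x) \<le> K * norm x" using bounded_clinearD(7)[OF assms] by auto
  show ?thesis
  proof (rule bounded_clinearI[where K = K])
    fix x y c
    show "cadjoint T (x + y) = cadjoint T x + cadjoint T y"
      by (rule cinner_ext) (simp add: hil.ip_add_right flip: cadjoint[OF assms])
    show "cadjoint T (c *\<^sub>C x) = c *\<^sub>C cadjoint T x"
      by (rule cinner_ext) (simp add: hil.ip_scale_right flip: cadjoint[OF assms])
    show "norm (cadjoint T x) \<le> K * norm x"
    proof (cases "cadjoint T x = 0")
      case False
      let ?s = "cadjoint T x"
      have "norm ?s * norm ?s = cmod (cinner ?s ?s)"
        by (simp only: hil.ip_self norm_of_real) (simp add: power2_eq_square)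
      also have "\<dots> = cmod (cinner (T ?s) x)" by (simp add: cadjoint[OF assms])
      also have "\<dots> \<le> norm (T ?s) * norm x" by (rule hil.Cauchy_Schwarz)
      also have "\<dots> \<le> (K * norm ?s) * norm x" by (intro mult_right_mono K) simp
      finally have "norm ?s * norm ?s \<le> (K * norm x) * norm ?s" by (simp only: ac_simps)
      then show ?thesis by (rule mult_right_le_imp_le) (use False in simp)
    qed (use K in simp)
  qed
qed

lemma compact_positive_adjoint_comp:
  fixes U :: "'h::complex_hilbert \<Rightarrow> 'h"
  assumes "compact_operator U"
  shows "compact_positive cinner (\<lambda>x. cadjoint U (U x))"
proof -
  have U: "bounded_clinear U" and comp: "compact (closure (U ` cball 0 1))"
    using assms by (auto simp: compact_operator_def)
  note U' = bounded_clinear_cadjoint[OF U]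
  have pos: "cinner (cadjoint U (U x)) y = cinner (U x) (U y)" for x y
    by (subst cinner_commute) (simp add: cadjoint[OF U, symmetric] flip: cinner_commute[of "U x"])
  have seq: "\<exists>l \<phi>. strict_mono (\<phi> :: nat \<Rightarrow> nat) \<and> (\<lambda>n. norm (cadjoint U (U (X (\<phi> n))) - l)) \<longlonglongrightarrow> 0"
    if X: "\<And>n. norm (X n) \<le> 1" for X :: "nat \<Rightarrow> 'h"
  proof -
    have "\<forall>n. U (X n) \<in> closure (U ` cball 0 1)"
      using X by (auto intro!: closure_subset[THEN subsetD])
    then obtain l \<phi> where \<phi>: "strict_mono \<phi>" "((\<lambda>n. U (X n)) \<circ> \<phi>) \<longlonglongrightarrow> l"
      using seq_compactE[OF comp[unfolded compact_eq_seq_compact_metric]] by metis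
    have "(\<lambda>n. cadjoint U (U (X (\<phi> n)))) \<longlonglongrightarrow> cadjoint U l"
      using bounded_linear.tendsto[OF bounded_clinearD(1)[OF U'] \<phi>(2)] by (simp add: o_def)
    then show ?thesis using \<phi>(1) by (auto simp: tendsto_norm_zero_iff LIM_zero_iff)
  qed
  show ?thesis
    by (intro compact_positive.intro prehilbert_cinner compact_positive_axioms.intro)
      (auto simp: bounded_clinearD[OF U] bounded_clinearD[OF U'] pos cadjoint[OF U, symmetric]
        hil.ip_nonneg nrm_cinner intro!: seq)
qed

lemma bounded_linear_scaleC_left: "bounded_linear (\<lambda>a. a *\<^sub>C (v :: 'a::complex_normed_vector))"
  by (rule bounded_linear_intro[where K = "norm v"])
    (auto simp: cvec.scale_left_distrib scaleR_conv_of_real scaleC_scaleC scaleR_scaleC norm_scaleC)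

text \<open>This is the product of the operator with columns \<open>y i\<close> and its adjoint; its
  eigenvalues are the squared singular numbers of that operator. For compactness, the finitely many
  coefficient sequences have a common convergent subsequence.\<close>

lemma compact_positive_finite_rank:
  fixes y :: "'i \<Rightarrow> 'h::complex_hilbert"
  assumes "finite I"
  shows "compact_positive cinner (\<lambda>v. \<Sum>i\<in>I. cinner v (y i) *\<^sub>C y i)"
proof (intro compact_positive.intro prehilbert_cinner compact_positive_axioms.intro)
  let ?W = "\<lambda>v. \<Sum>i\<in>I. cinner v (y i) *\<^sub>C y i"
  show "?W (u + v) = ?W u + ?W v" for u v
    by (simp add: hil.ip_add_left cvec.scale_left_distrib sum.distrib)
  show "?W (c *\<^sub>C v) = c *\<^sub>C ?W v" for c v
    by (simp add: hil.ip_scale_left cvec.scale_sum_right)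
  have c: "cinner v (y i) * cinner (y i) u = cinner v (y i) * cnj (cinner u (y i))" for u v i
    using cinner_commute[of "y i" u] by simp
  show "cinner (?W u) v = cinner u (?W v)" for u v
    unfolding hil.ip_sum_left hil.ip_scale_left hil.ip_sum_right hil.ip_scale_right c
    by (simp add: mult.commute)
  show "0 \<le> Re (cinner (?W v) v)" for v
    unfolding hil.ip_sum_left hil.ip_scale_left c complex_norm_square[symmetric]
    by (simp add: sum_nonneg del: of_real_power)
  fix X :: "nat \<Rightarrow> 'h" assume "\<And>n. prehilbert.nrm cinner (X n) \<le> 1"
  then have X: "norm (X n) \<le> 1" for n by (simp add: nrm_cinner)
  have "cmod (cinner (X n) (y i)) \<le> (\<Sum>i\<in>I. norm (y i))" if "i \<in> I" for i n
  proof -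
    have "cmod (cinner (X n) (y i)) \<le> norm (X n) * norm (y i)" by (rule hil.Cauchy_Schwarz)
    also have "\<dots> \<le> norm (y i)" using X[of n] by (intro mult_left_le_one_le) auto
    also have "\<dots> \<le> (\<Sum>i\<in>I. norm (y i))" using assms that by (intro member_le_sum) auto
    finally show ?thesis .
  qed
  then have "\<exists>\<phi>. strict_mono (\<phi> :: nat \<Rightarrow> nat) \<and> (\<forall>i\<in>I. \<exists>l. (\<lambda>n. cinner (X (\<phi> n)) (y i)) \<longlonglongrightarrow> l)"
    by (rule function_convergent_subsequence[OF countable_finite[OF assms],
          of "\<lambda>n i. cinner (X n) (y i)" "\<Sum>i\<in>I. norm (y i)"]) auto
  then obtain \<phi> where \<phi>: "strict_mono \<phi>" "\<And>i. i \<in> I \<Longrightarrow> \<exists>l. (\<lambda>n. cinner (X (\<phi> n)) (y i)) \<longlonglongrightarrow> l"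
    by blast
  then obtain c where c: "\<And>i. i \<in> I \<Longrightarrow> (\<lambda>n. cinner (X (\<phi> n)) (y i)) \<longlonglongrightarrow> c i" by metis
  have "(\<lambda>n. ?W (X (\<phi> n))) \<longlonglongrightarrow> (\<Sum>i\<in>I. c i *\<^sub>C y i)"
    by (intro tendsto_sum bounded_linear.tendsto[OF bounded_linear_scaleC_left] c)
  then show "\<exists>l \<phi>. strict_mono (\<phi> :: nat \<Rightarrow> nat) \<and>
      (\<lambda>n. prehilbert.nrm cinner (?W (X (\<phi> n)) - l)) \<longlonglongrightarrow> 0"
    using \<phi>(1) unfolding nrm_cinner tendsto_norm_zero_iff LIM_zero_iff by blast
qed

lemma hilbert_eigensystem:
  fixes W :: "'h::complex_hilbert \<Rightarrow> 'h"
  assumes "compact_positive cinner W"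
  obtains w l where
    "\<And>n. W (w n) = of_real (l n) *\<^sub>C w n" "\<And>m n. m \<noteq> n \<Longrightarrow> cinner (w m) (w n) = 0"
    "\<And>n. norm (w n) = 1 \<or> w n = 0 \<and> l n = 0" "\<And>n. 0 \<le> l n" "decseq l" "l \<longlonglongrightarrow> 0"
    "\<And>n v. (\<And>k. k < n \<Longrightarrow> cinner v (w k) = 0) \<Longrightarrow> Re (cinner (W v) v) \<le> l n * (norm v)\<^sup>2"
    "\<And>t. 0 < t \<Longrightarrow> cvec.dim {x. W x = of_real t *\<^sub>C x} = card {k. l k = t}"
proof -
  interpret W: compact_positive cinner W by (rule assms)
  obtain w l where es: "W.eigensystem w l" using W.eigensystem_exists by blast
  show ?thesis
    by (rule that[of w l]) (use W.eigensystemD[OF es] W.dim_eigenspace[OF es] in \<open>auto simp: nrm_cinner\<close>)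
qed

section \<open>Singular numbers\<close>

text \<open>At the level \<open>t = l n\<close> at least \<open>n + 1\<close> indices satisfy
  \<open>t <= l k\<close>, but at most \<open>n\<close> satisfy \<open>t <= a k\<close> if
  \<open>a n < l n\<close>; equal multiplicities make the two counts equal.\<close>

lemma decseq_le_if_card_eq:
  fixes l a :: "nat \<Rightarrow> real"
  assumes l: "decseq l" and a: "decseq a" and l0: "l \<longlonglongrightarrow> 0" and a0: "a \<longlonglongrightarrow> 0" and nonneg: "\<And>n. 0 \<le> a n"
    and card: "\<And>t. 0 < t \<Longrightarrow> card {k. l k = t} = card {k. a k = t}"
  shows "l n \<le> a n"
proof (rule ccontr)
  assume "\<not> l n \<le> a n"
  then have n: "a n < l n" by simp
  define t where "t = l n"
  have t: "0 < t" using n nonneg[of n] by (simp add: t_def)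
  have fin: "finite {k. t \<le> b k}" if b: "b \<longlonglongrightarrow> 0" for b :: "nat \<Rightarrow> real"
  proof -
    obtain N where "\<And>n. n \<ge> N \<Longrightarrow> b n < t"
      using order_tendstoD(2)[OF b t] by (auto simp: eventually_sequentially)
    then have "{k. t \<le> b k} \<subseteq> {..<N}" by (auto simp: not_less[symmetric])
    then show ?thesis by (rule finite_subset) simp
  qed
  define A B V where "A = {k. t \<le> l k}" "B = {k. t \<le> a k}" "V = l ` A \<union> a ` B"
  note ABV = this
  have finA: "finite A" "finite B" "finite V" using fin[OF l0] fin[OF a0] by (auto simp: ABV)
  have "card A = (\<Sum>x\<in>V. card {k \<in> A. l k = x})"
    using sum.group[of A V l "\<lambda>_. 1::nat"] finA by (auto simp: ABV)
  also have "\<dots> = (\<Sum>x\<in>V. card {k \<in> B. a k = x})"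
  proof (rule sum.cong[OF refl])
    fix x assume "x \<in> V"
    then have "t \<le> x" by (auto simp: ABV)
    then have "{k \<in> A. l k = x} = {k. l k = x}" "{k \<in> B. a k = x} = {k. a k = x}"
      by (auto simp: ABV)
    then show "card {k \<in> A. l k = x} = card {k \<in> B. a k = x}" using card[of x] t \<open>t \<le> x\<close> by simp
  qed
  also have "\<dots> = card B"
    using sum.group[of B V a "\<lambda>_. 1::nat"] finA by (auto simp: ABV)
  finally have "card A = card B" .
  moreover have "{..n} \<subseteq> A" using l by (auto simp: ABV t_def decseq_def)
  then have "Suc n \<le> card A" using card_mono[OF finA(1), of "{..n}"] by (simp only: card_atMost)
  moreover have "B \<subseteq> {..<n}"
  proof
    fix k assume "k \<in> B"
    then have "a n < a k" using n by (simp add: ABV t_def)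
    then show "k \<in> {..<n}" using decseqD[OF a, of n k] by (cases "n \<le> k") auto
  qed
  then have "card B \<le> n" using card_mono[of "{..<n}" B] by simp
  ultimately show False by simp
qed

lemma norm_adjoint_comp:
  assumes "bounded_clinear U"
  shows "Re (cinner (cadjoint U (U v)) v) = (norm (U v))\<^sup>2"
proof -
  have "cinner (cadjoint U (U v)) v = cnj (cinner v (cadjoint U (U v)))" by (rule cinner_commute)
  then show ?thesis by (simp add: cadjoint[OF assms, symmetric] hil.nrm_sq)
qed

text \<open>The given sequence need not come from the eigensystem, so the two are matched through
  their multiplicities. Besides summability, this decay on complements of \<open>n\<close> vectors
  is all that is used of singular numbers when a factorization is given.\<close>

lemma singular_numbers_bound:
  fixes U :: "'h::complex_hilbert \<Rightarrow> 'h"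
  assumes "compact_operator U" "is_singular_numbers U \<sigma>"
  shows "\<exists>w. \<forall>n v. (\<forall>k<n. cinner v (w k) = 0) \<longrightarrow> norm (U v) \<le> \<sigma> n * norm v"
proof -
  have U: "bounded_clinear U" using assms(1) by (simp add: compact_operator_def)
  have \<sigma>: "\<And>n. 0 \<le> \<sigma> n" "decseq \<sigma>" "\<sigma> \<longlonglongrightarrow> 0"
    "\<And>t. 0 < t \<Longrightarrow> card {n. \<sigma> n = t} =
        cvec.dim {x. cadjoint U (U x) = complex_of_real (t\<^sup>2) *\<^sub>C x}"
    using assms(2) by (auto simp: is_singular_numbers_def)
  obtain w l where w: "\<And>n. 0 \<le> l n" "decseq l" "l \<longlonglongrightarrow> 0"
    "\<And>n v. (\<And>k. k < n \<Longrightarrow> cinner v (w k) = 0) \<Longrightarrow>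
       Re (cinner (cadjoint U (U v)) v) \<le> l n * (norm v)\<^sup>2"
    "\<And>t. 0 < t \<Longrightarrow> cvec.dim {x. cadjoint U (U x) = of_real t *\<^sub>C x} = card {k. l k = t}"
    by (rule hilbert_eigensystem[OF compact_positive_adjoint_comp[OF assms(1)]]) blast
  have le: "l n \<le> (\<sigma> n)\<^sup>2" for n
  proof (rule decseq_le_if_card_eq[OF w(2) _ w(3)])
    show "decseq (\<lambda>n. (\<sigma> n)\<^sup>2)" using \<sigma>(1,2) by (auto simp: decseq_def intro!: power_mono)
    show "(\<lambda>n. (\<sigma> n)\<^sup>2) \<longlonglongrightarrow> 0" using tendsto_power[OF \<sigma>(3), of 2] by simp
    fix t :: real assume t: "0 < t"
    have "{k. (\<sigma> k)\<^sup>2 = t} = {k. \<sigma> k = sqrt t}"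
      using t \<sigma>(1) by (auto simp: real_sqrt_unique)
    then show "card {k. l k = t} = card {k. (\<sigma> k)\<^sup>2 = t}"
      using t \<sigma>(4)[of "sqrt t"] w(5)[of t] by simp
  qed simp
  have "norm (U v) \<le> \<sigma> n * norm v" if "\<forall>k<n. cinner v (w k) = 0" for n v
  proof (rule power2_le_imp_le)
    have "(norm (U v))\<^sup>2 \<le> l n * (norm v)\<^sup>2"
      using w(4)[of n v] that by (simp add: norm_adjoint_comp[OF U])
    also have "\<dots> \<le> (\<sigma> n)\<^sup>2 * (norm v)\<^sup>2" by (intro mult_right_mono le) simp
    finally show "(norm (U v))\<^sup>2 \<le> (\<sigma> n * norm v)\<^sup>2" by (simp add: power_mult_distrib)
  qed (simp add: \<sigma>(1))
  then show ?thesis by blast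
qed

lemma singular_numbers_exist:
  fixes U :: "'h::complex_hilbert \<Rightarrow> 'h"
  assumes "compact_operator U"
  obtains w \<sigma> where "is_singular_numbers U \<sigma>"
    "\<And>n. cadjoint U (U (w n)) = of_real ((\<sigma> n)\<^sup>2) *\<^sub>C w n" "\<And>m n. m \<noteq> n \<Longrightarrow> cinner (w m) (w n) = 0"
    "\<And>n. norm (w n) = 1 \<or> w n = 0 \<and> \<sigma> n = 0"
proof -
  obtain w l where w: "\<And>n. cadjoint U (U (w n)) = of_real (l n) *\<^sub>C w n"
    "\<And>m n. m \<noteq> n \<Longrightarrow> cinner (w m) (w n) = 0" "\<And>n. norm (w n) = 1 \<or> w n = 0 \<and> l n = 0"
    "\<And>n. 0 \<le> l n" "decseq l" "l \<longlonglongrightarrow> 0"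
    "\<And>t. 0 < t \<Longrightarrow> cvec.dim {x. cadjoint U (U x) = of_real t *\<^sub>C x} = card {k. l k = t}"
    by (rule hilbert_eigensystem[OF compact_positive_adjoint_comp[OF assms]]) blast
  have "is_singular_numbers U (\<lambda>n. sqrt (l n))"
    unfolding is_singular_numbers_def
  proof (intro conjI allI impI)
    show "decseq (\<lambda>n. sqrt (l n))" using w(5) by (simp add: decseq_def)
    show "(\<lambda>n. sqrt (l n)) \<longlonglongrightarrow> 0" using tendsto_real_sqrt[OF w(6)] by simp
    fix t :: real assume t: "0 < t"
    have "{n. sqrt (l n) = t} = {n. l n = t\<^sup>2}" using t w(4) by auto
    then show "card {n. sqrt (l n) = t} =
        cvec.dim {x. cadjoint U (U x) = complex_of_real (t\<^sup>2) *\<^sub>C x}"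
      using w(7)[of "t\<^sup>2"] t by simp
  qed (use w(4) in simp)
  then show ?thesis
  proof (rule that)
    show "cadjoint U (U (w n)) = of_real ((sqrt (l n))\<^sup>2) *\<^sub>C w n" for n
      using w(1,4) by simp
    show "norm (w n) = 1 \<or> w n = 0 \<and> sqrt (l n) = 0" for n
      using w(3)[of n] by auto
  qed (rule w(2))
qed

section \<open>Integration against a complex measure\<close>

lemma cmeasure_sums:
  fixes A :: "nat \<Rightarrow> 'a::topological_space set"
  shows "range A \<subseteq> sets borel \<Longrightarrow> disjoint_family A \<Longrightarrow>
    (\<lambda>n. cmeasure_of \<mu> (A n)) sums cmeasure_of \<mu> (\<Union>n. A n)"
  using cmeasure_of[of \<mu>] unfolding regular_complex_measures_def by blast

lemma cmeasure_empty [simp]: "cmeasure_of \<mu> {} = 0"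
proof -
  have "(\<lambda>n::nat. cmeasure_of \<mu> {}) sums cmeasure_of \<mu> (\<Union>n::nat. {})"
    by (rule cmeasure_sums) (auto simp: disjoint_family_on_def)
  then have "summable (\<lambda>n::nat. cmeasure_of \<mu> {})" by (rule sums_summable)
  then show ?thesis by (simp add: summable_const_iff)
qed

lemma cmeasure_Un:
  assumes "A \<in> sets borel" "B \<in> sets borel" "A \<inter> B = {}"
  shows "cmeasure_of \<mu> (A \<union> B) = cmeasure_of \<mu> A + cmeasure_of \<mu> B"
proof -
  have "(\<lambda>n. cmeasure_of \<mu> (binaryset A B n)) sums cmeasure_of \<mu> (\<Union>n. binaryset A B n)"
    by (rule cmeasure_sums)
      (use assms in \<open>auto simp: range_binaryset_eq disjoint_family_on_def binaryset_def\<close>)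
  moreover have "(\<lambda>n. cmeasure_of \<mu> (binaryset A B n)) sums (cmeasure_of \<mu> A + cmeasure_of \<mu> B)"
    by (rule binaryset_sums) simp
  ultimately show ?thesis unfolding UN_binaryset_eq by (rule sums_unique2)
qed

lemma cmeasure_UN:
  assumes "finite I" "\<And>i. i \<in> I \<Longrightarrow> A i \<in> sets borel" "disjoint_family_on A I"
  shows "cmeasure_of \<mu> (\<Union>i\<in>I. A i) = (\<Sum>i\<in>I. cmeasure_of \<mu> (A i))"
  using assms
proof (induction I rule: finite_induct)
  case (insert i I)
  have "cmeasure_of \<mu> (A i \<union> (\<Union>i\<in>I. A i)) = cmeasure_of \<mu> (A i) + cmeasure_of \<mu> (\<Union>i\<in>I. A i)"
    by (rule cmeasure_Un) (use insert in \<open>auto simp: disjoint_family_on_def\<close>)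
  moreover have "disjoint_family_on A I"
    using insert.prems(2) by (rule disjoint_family_on_mono[rotated]) auto
  ultimately show ?case using insert by simp
qed simp

lemma variation_finite: "variation (cmeasure_of \<mu>) UNIV < \<infinity>"
  using cmeasure_of[of \<mu>] unfolding regular_complex_measures_def by blast

lemma cmeasure_sum_le_norm:
  assumes "finite P" "disjoint P" "P \<subseteq> sets borel"
  shows "(\<Sum>A\<in>P. cmod (cmeasure_of \<mu> A)) \<le> norm \<mu>"
proof -
  have "ennreal (\<Sum>A\<in>P. cmod (cmeasure_of \<mu> A)) = (\<Sum>A\<in>P. ennreal (cmod (cmeasure_of \<mu> A)))"
    by (simp add: sum_ennreal)
  also have "\<dots> \<le> variation (cmeasure_of \<mu>) UNIV"
    unfolding variation_def by (rule SUP_upper) (use assms in auto)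
  finally have "enn2real (ennreal (\<Sum>A\<in>P. cmod (cmeasure_of \<mu> A))) \<le> enn2real (variation (cmeasure_of \<mu>) UNIV)"
    by (rule enn2real_mono) (use variation_finite in auto)
  then show ?thesis by (simp add: norm_cmeasure.rep_eq sum_nonneg)
qed

definition simple_integral :: "'a::topological_space cmeasure \<Rightarrow> ('a \<Rightarrow> complex) \<Rightarrow> complex" where
  "simple_integral \<mu> s = (\<Sum>c\<in>range s. c * cmeasure_of \<mu> (s -` {c}))"

lemma simple_functionD':
  assumes "simple_function borel p"
  shows "finite (range p)" "p -` X \<in> sets borel"
  using simple_functionD(1)[OF assms] simple_functionD(2)[OF assms, of X] by simp_all

text \<open>Used with \<open>p\<close> the pair of two simple functions: the pair is a common
  refinement, and sums and differences of the two have the form \<open>h (p x)\<close>.\<close>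

lemma simple_integral_comp:
  assumes p: "simple_function borel p"
  shows "simple_integral \<mu> (\<lambda>x. h (p x)) = (\<Sum>b\<in>range p. h b * cmeasure_of \<mu> (p -` {b}))"
proof -
  note fin = simple_functionD'(1)[OF p]
  have r: "range (\<lambda>x. h (p x)) = h ` range p" by auto
  have "cmeasure_of \<mu> ((\<lambda>x. h (p x)) -` {c}) = (\<Sum>b | b \<in> range p \<and> h b = c. cmeasure_of \<mu> (p -` {b}))" for c
  proof -
    have "(\<lambda>x. h (p x)) -` {c} = (\<Union>b\<in>{b \<in> range p. h b = c}. p -` {b})" by auto
    then show ?thesis
      by (simp only:, intro cmeasure_UN)
        (use fin simple_functionD'(2)[OF p] in \<open>auto simp: disjoint_family_on_def\<close>)
  qed
  then have "simple_integral \<mu> (\<lambda>x. h (p x)) =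
      (\<Sum>c\<in>h ` range p. \<Sum>b | b \<in> range p \<and> h b = c. h b * cmeasure_of \<mu> (p -` {b}))"
    unfolding simple_integral_def r by (auto simp: sum_distrib_left intro!: sum.cong)
  also have "\<dots> = (\<Sum>b\<in>range p. h b * cmeasure_of \<mu> (p -` {b}))"
    by (rule sum.group) (use fin in auto)
  finally show ?thesis .
qed

lemma simple_integral_diff:
  assumes "simple_function borel s" "simple_function borel t"
  shows "simple_integral \<mu> (\<lambda>x. s x - t x) = simple_integral \<mu> s - simple_integral \<mu> t"
proof -
  have p: "simple_function borel (\<lambda>x. (s x, t x))" by (rule simple_function_Pair[OF assms])
  show ?thesis
    using simple_integral_comp[OF p, of \<mu> fst] simple_integral_comp[OF p, of \<mu> snd]
      simple_integral_comp[OF p, of \<mu> "\<lambda>b. fst b - snd b"]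
    by (simp add: left_diff_distrib sum_subtractf)
qed

lemma simple_integral_add:
  assumes "simple_function borel s" "simple_function borel t"
  shows "simple_integral \<mu> (\<lambda>x. s x + t x) = simple_integral \<mu> s + simple_integral \<mu> t"
proof -
  have p: "simple_function borel (\<lambda>x. (s x, t x))" by (rule simple_function_Pair[OF assms])
  show ?thesis
    using simple_integral_comp[OF p, of \<mu> fst] simple_integral_comp[OF p, of \<mu> snd]
      simple_integral_comp[OF p, of \<mu> "\<lambda>b. fst b + snd b"]
    by (simp add: distrib_right sum.distrib)
qed

lemma simple_integral_scale:
  assumes "simple_function borel s"
  shows "simple_integral \<mu> (\<lambda>x. c * s x) = c * simple_integral \<mu> s"
  using simple_integral_comp[OF assms, of \<mu> "\<lambda>b. c * b"]
  by (simp add: simple_integral_def sum_distrib_left mult.assoc)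

text \<open>The fibres of \<open>s\<close> form a finite Borel partition, so the variation norm
  dominates the sum of their measures.\<close>

lemma simple_integral_bound:
  assumes s: "simple_function borel s" and K: "\<And>x. cmod (s x) \<le> K"
  shows "cmod (simple_integral \<mu> s) \<le> K * norm \<mu>"
proof -
  note fin = simple_functionD'(1)[OF s]
  have K0: "0 \<le> K" using K[of undefined] by (meson norm_ge_zero order_trans)
  have inj: "inj_on (\<lambda>c. s -` {c}) (range s)" by (auto simp: inj_on_def)
  have "cmod (simple_integral \<mu> s) \<le> (\<Sum>c\<in>range s. cmod c * cmod (cmeasure_of \<mu> (s -` {c})))"
    unfolding simple_integral_def by (intro sum_norm_le) (simp add: norm_mult)
  also have "\<dots> \<le> (\<Sum>c\<in>range s. K * cmod (cmeasure_of \<mu> (s -` {c})))"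
    by (intro sum_mono mult_right_mono) (use K in auto)
  also have "\<dots> = K * (\<Sum>A\<in>(\<lambda>c. s -` {c}) ` range s. cmod (cmeasure_of \<mu> A))"
    by (simp add: sum_distrib_left sum.reindex[OF inj])
  also have "\<dots> \<le> K * norm \<mu>"
    by (intro mult_left_mono cmeasure_sum_le_norm K0)
      (use fin simple_functionD'(2)[OF s] in \<open>auto simp: disjoint_def\<close>)
  finally show ?thesis .
qed

lemma simple_integral_cmeasure_add:
  "simple_integral (\<mu> + \<nu>) s = simple_integral \<mu> s + simple_integral \<nu> s"
  by (simp add: simple_integral_def plus_cmeasure.rep_eq distrib_left sum.distrib)

lemma simple_integral_cmeasure_scale: "simple_integral (c *\<^sub>C \<mu>) s = c * simple_integral \<mu> s"
  by (simp add: simple_integral_def scaleC_cmeasure.rep_eq sum_distrib_left ac_simps)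

lemma uniform_limit_dist:
  assumes "uniform_limit UNIV s f sequentially" "0 < e"
  shows "\<exists>N. \<forall>n\<ge>N. \<forall>x. dist (s n x) (f x) < e"
  using uniform_limitD[OF assms] by (simp add: eventually_sequentially)

text \<open>Applied to one sequence twice it gives convergence, to two sequences the independence of
  the limit.\<close>

lemma simple_integral_approx:
  assumes s: "\<And>n. simple_function borel (s n)" "uniform_limit UNIV s f sequentially"
    and t: "\<And>n. simple_function borel (t n)" "uniform_limit UNIV t f sequentially"
    and "0 < e"
  shows "\<exists>N. \<forall>m\<ge>N. \<forall>n\<ge>N. dist (simple_integral \<mu> (s m)) (simple_integral \<mu> (t n)) < e"
proof -
  \<comment> \<open>The summand \<open>1\<close> covers the zero measure.\<close>
  define d where "d = e / (2 * (norm \<mu> + 1))"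
  have np: "0 < norm \<mu> + 1" by (smt (verit) norm_ge_zero)
  have d: "0 < d" using assms(5) np by (simp add: d_def)
  obtain N1 N2 where N: "\<And>n x. n \<ge> N1 \<Longrightarrow> dist (s n x) (f x) < d" "\<And>n x. n \<ge> N2 \<Longrightarrow> dist (t n x) (f x) < d"
    using uniform_limit_dist[OF s(2) d] uniform_limit_dist[OF t(2) d] by blast
  have "dist (simple_integral \<mu> (s m)) (simple_integral \<mu> (t n)) < e" if "m \<ge> max N1 N2" "n \<ge> max N1 N2" for m n
  proof -
    have "cmod (s m x - t n x) \<le> 2 * d" for x
      using N(1)[of m x] N(2)[of n x] that dist_triangle2[of "s m x" "t n x" "f x"]
      by (simp add: dist_norm)
    then have "cmod (simple_integral \<mu> (\<lambda>x. s m x - t n x)) \<le> 2 * d * norm \<mu>"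
      by (intro simple_integral_bound simple_function_diff s t)
    also have "\<dots> < 2 * d * (norm \<mu> + 1)" using d by simp
    also have "\<dots> = e" using np unfolding d_def by (simp add: field_simps)
    finally show ?thesis by (simp add: dist_norm simple_integral_diff s t)
  qed
  then show ?thesis by blast
qed

text \<open>An approximating sequence must exist for the description in \<open>cm_integral\<close>
  to be unique; then all others share its limit.\<close>

lemma cm_integral_LIMSEQ:
  assumes s: "\<And>n. simple_function borel (s n)" "uniform_limit UNIV s f sequentially"
  shows "(\<lambda>n. simple_integral \<mu> (s n)) \<longlonglongrightarrow> cm_integral \<mu> f"
proof -
  have "Cauchy (\<lambda>n. simple_integral \<mu> (s n))"
    unfolding Cauchy_def using simple_integral_approx[OF s s] by blast
  then obtain I where I: "(\<lambda>n. simple_integral \<mu> (s n)) \<longlonglongrightarrow> I"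
    by (auto simp: Cauchy_convergent_iff convergent_def)
  have all: "(\<lambda>n. simple_integral \<mu> (t n)) \<longlonglongrightarrow> I"
    if t: "\<And>n. simple_function borel (t n)" "uniform_limit UNIV t f sequentially" for t
  proof -
    have "(\<lambda>n. simple_integral \<mu> (t n) - simple_integral \<mu> (s n)) \<longlonglongrightarrow> 0"
      unfolding lim_sequentially using simple_integral_approx[OF t s] by (simp add: dist_norm) blast
    from tendsto_add[OF this I] show ?thesis by simp
  qed
  have "cm_integral \<mu> f = I"
    unfolding cm_integral_def
  proof (rule the_equality)
    fix J assume "\<forall>s. (\<forall>n. simple_function borel (s n)) \<longrightarrow> uniform_limit UNIV s f sequentially \<longrightarrow>
       (\<lambda>n. \<Sum>c\<in>range (s n). c * cmeasure_of \<mu> (s n -` {c})) \<longlonglongrightarrow> J"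
    then have "(\<lambda>n. simple_integral \<mu> (s n)) \<longlonglongrightarrow> J" using s by (simp add: simple_integral_def)
    then show "J = I" using I by (rule LIMSEQ_unique)
  qed (use all in \<open>auto simp: simple_integral_def\<close>)
  then show ?thesis using I by simp
qed

definition grid :: "nat \<Rightarrow> complex \<Rightarrow> complex" where
  "grid n z = Complex (\<lfloor>Re z * real (Suc n)\<rfloor> / real (Suc n)) (\<lfloor>Im z * real (Suc n)\<rfloor> / real (Suc n))"

lemma dist_floor_grid: "\<bar>\<lfloor>x * real (Suc n)\<rfloor> / real (Suc n) - x\<bar> \<le> 1 / real (Suc n)"
proof -
  have "\<lfloor>x * real (Suc n)\<rfloor> / real (Suc n) - x = (\<lfloor>x * real (Suc n)\<rfloor> - x * real (Suc n)) / real (Suc n)"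
    by (simp add: diff_divide_distrib del: of_nat_Suc)
  also have "\<bar>\<dots>\<bar> = \<bar>\<lfloor>x * real (Suc n)\<rfloor> - x * real (Suc n)\<bar> / real (Suc n)" by simp
  also have "\<dots> \<le> 1 / real (Suc n)"
    by (intro divide_right_mono) linarith+
  finally show ?thesis .
qed

lemma dist_grid: "dist (grid n z) z \<le> 2 / real (Suc n)"
proof -
  have "dist (grid n z) z \<le> \<bar>Re (grid n z - z)\<bar> + \<bar>Im (grid n z - z)\<bar>"
    unfolding dist_norm by (rule cmod_le)
  also have "\<dots> \<le> 1 / real (Suc n) + 1 / real (Suc n)"
    by (intro add_mono) (use dist_floor_grid in \<open>simp_all add: grid_def del: of_nat_Suc\<close>)
  finally show ?thesis by simp
qed

text \<open>Rounding to a grid approximates uniformly, and a bounded function meets only finitely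
  many grid points.\<close>

lemma simple_approximation:
  fixes f :: "'a::topological_space \<Rightarrow>\<^sub>C complex"
  shows "simple_function borel (\<lambda>x. grid n (f x))" "uniform_limit UNIV (\<lambda>n x. grid n (f x)) f sequentially"
proof -
  have "continuous_on UNIV (apply_bcontfun f)" by (rule continuous_on_apply_bcontfun)
  then have [measurable]: "apply_bcontfun f \<in> borel_measurable borel"
    by (rule borel_measurable_continuous_onI)
  have meas: "(\<lambda>x. grid n (f x)) \<in> borel_measurable borel"
    unfolding grid_def borel_measurable_complex_iff by (simp del: of_nat_Suc)
  define N where "N = real (Suc n)"
  define K where "K = {\<lfloor>- norm f * N\<rfloor> .. \<lfloor>norm f * N\<rfloor>}"
  have K: "\<lfloor>a * N\<rfloor> \<in> K" if "\<bar>a\<bar> \<le> norm f" for a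
  proof -
    have "- norm f \<le> a" "a \<le> norm f" using that by auto
    then have "- norm f * N \<le> a * N" "a * N \<le> norm f * N"
      by (intro mult_right_mono; simp add: N_def)+
    then show ?thesis unfolding K_def by (intro atLeastAtMost_iff[THEN iffD2] conjI floor_mono)
  qed
  have "range (\<lambda>x. grid n (f x)) \<subseteq>
      (\<lambda>(a, b). Complex (real_of_int a / N) (real_of_int b / N)) ` (K \<times> K)"
  proof (rule image_subsetI)
    fix x
    have "\<bar>Re (f x)\<bar> \<le> norm f" "\<bar>Im (f x)\<bar> \<le> norm f"
      using abs_Re_le_cmod[of "f x"] abs_Im_le_cmod[of "f x"] norm_bounded[of f x] by linarith+
    then show "grid n (f x) \<in> (\<lambda>(a, b). Complex (real_of_int a / N) (real_of_int b / N)) ` (K \<times> K)"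
      using K by (intro image_eqI[where x = "(\<lfloor>Re (f x) * N\<rfloor>, \<lfloor>Im (f x) * N\<rfloor>)"])
        (auto simp: grid_def N_def)
  qed
  then have "finite (range (\<lambda>x. grid n (f x)))" by (rule finite_subset) (simp add: K_def)
  then show "simple_function borel (\<lambda>x. grid n (f x))"
    using simple_function_borel_measurable[OF meas] by simp
  show "uniform_limit UNIV (\<lambda>n x. grid n (f x)) f sequentially"
  proof (rule uniform_limitI)
    fix e :: real assume "0 < e"
    have "(\<lambda>n. 2 * (1 / real (Suc n))) \<longlonglongrightarrow> 2 * 0"
      by (intro tendsto_mult tendsto_const LIMSEQ_Suc[OF lim_1_over_n])
    then have "\<forall>\<^sub>F n in sequentially. 2 / real (Suc n) < e"
      using order_tendstoD(2)[of "\<lambda>n. 2 * (1 / real (Suc n))" 0] \<open>0 < e\<close> by simp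
    then show "\<forall>\<^sub>F n in sequentially. \<forall>x\<in>UNIV. dist (grid n (f x)) (f x) < e"
      by eventually_elim (meson dist_grid le_less_trans)
  qed
qed

lemma cm_integral_grid: "(\<lambda>n. simple_integral \<mu> (\<lambda>x. grid n (f x))) \<longlonglongrightarrow> cm_integral \<mu> (apply_bcontfun f)"
  for f :: "'a::topological_space \<Rightarrow>\<^sub>C complex"
  by (rule cm_integral_LIMSEQ) (rule simple_approximation)+

lemma scaleC_bcontfun_apply [simp]:
  "apply_bcontfun (c *\<^sub>C (f :: 'a::topological_space \<Rightarrow>\<^sub>C complex)) x = c * apply_bcontfun f x"
  by (simp add: scaleC_bcontfun.rep_eq scaleC_complex_def)

lemma cm_integral_add:
  "cm_integral \<mu> (apply_bcontfun (f + g)) = cm_integral \<mu> (apply_bcontfun f) + cm_integral \<mu> (apply_bcontfun g)"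
  for f g :: "'a::topological_space \<Rightarrow>\<^sub>C complex"
proof (rule LIMSEQ_unique)
  show "(\<lambda>n. simple_integral \<mu> (\<lambda>x. grid n (f x) + grid n (g x))) \<longlonglongrightarrow> cm_integral \<mu> (apply_bcontfun (f + g))"
  proof (rule cm_integral_LIMSEQ)
    show "uniform_limit UNIV (\<lambda>n x. grid n (f x) + grid n (g x)) (apply_bcontfun (f + g)) sequentially"
      using uniform_limit_add[OF simple_approximation(2)[of f] simple_approximation(2)[of g]]
      by (simp add: plus_bcontfun.rep_eq[abs_def])
  qed (intro simple_function_add simple_approximation)
  show "(\<lambda>n. simple_integral \<mu> (\<lambda>x. grid n (f x) + grid n (g x))) \<longlonglongrightarrow>
      cm_integral \<mu> (apply_bcontfun f) + cm_integral \<mu> (apply_bcontfun g)"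
    by (simp add: simple_integral_add simple_approximation tendsto_add cm_integral_grid)
qed

lemma cm_integral_scale: "cm_integral \<mu> (apply_bcontfun (c *\<^sub>C f)) = c * cm_integral \<mu> (apply_bcontfun f)"
  for f :: "'a::topological_space \<Rightarrow>\<^sub>C complex"
proof (rule LIMSEQ_unique)
  show "(\<lambda>n. simple_integral \<mu> (\<lambda>x. c * grid n (f x))) \<longlonglongrightarrow> cm_integral \<mu> (apply_bcontfun (c *\<^sub>C f))"
  proof (rule cm_integral_LIMSEQ)
    have eq: "apply_bcontfun (c *\<^sub>C f) = (\<lambda>x. c * f x)" by (simp add: fun_eq_iff)
    show "uniform_limit UNIV (\<lambda>n x. c * grid n (f x)) (apply_bcontfun (c *\<^sub>C f)) sequentially"
      unfolding eq
      using bounded_linear.uniform_limit[OF bounded_linear_mult_right simple_approximation(2)[of f], of c]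
      by simp
    show "simple_function borel (\<lambda>x. c * grid n (f x))" for n
      by (intro simple_function_mult simple_approximation) simp
  qed
  show "(\<lambda>n. simple_integral \<mu> (\<lambda>x. c * grid n (f x))) \<longlonglongrightarrow> c * cm_integral \<mu> (apply_bcontfun f)"
    by (simp add: simple_integral_scale simple_approximation tendsto_mult cm_integral_grid)
qed

lemma cm_integral_bound: "cmod (cm_integral \<mu> (apply_bcontfun f)) \<le> norm f * norm \<mu>"
  for f :: "'a::topological_space \<Rightarrow>\<^sub>C complex"
proof (rule LIMSEQ_le[OF tendsto_norm[OF cm_integral_grid]])
  have "(\<lambda>n. 1 / real (Suc n)) \<longlonglongrightarrow> 0" by (rule LIMSEQ_Suc[OF lim_1_over_n])
  then have "(\<lambda>n. (norm f + 2 * (1 / real (Suc n))) * norm \<mu>) \<longlonglongrightarrow> (norm f + 2 * 0) * norm \<mu>"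
    by (intro tendsto_intros)
  then show "(\<lambda>n. (norm f + 2 / real (Suc n)) * norm \<mu>) \<longlonglongrightarrow> norm f * norm \<mu>" by simp
  have "cmod (grid n (f x)) \<le> norm f + 2 / real (Suc n)" for n x
    using dist_grid[of n "f x"] norm_bounded[of f x] norm_triangle_sub[of "grid n (f x)" "f x"]
    by (simp add: dist_norm del: of_nat_Suc)
  then have "cmod (simple_integral \<mu> (\<lambda>x. grid n (f x))) \<le> (norm f + 2 / real (Suc n)) * norm \<mu>" for n
    by (intro simple_integral_bound simple_approximation)
  then show "\<exists>N. \<forall>n\<ge>N. cmod (simple_integral \<mu> (\<lambda>x. grid n (f x))) \<le> (norm f + 2 / real (Suc n)) * norm \<mu>"
    by blast
qed

lemma bounded_clinear_cm_integral:
  "bounded_clinear (\<lambda>f :: 'a::topological_space \<Rightarrow>\<^sub>C complex. cm_integral \<mu> (apply_bcontfun f))"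
  by (rule bounded_clinearI[where K = "norm \<mu>"])
    (use cm_integral_add cm_integral_scale cm_integral_bound in \<open>auto simp: scaleC_complex_def mult.commute\<close>)

lemma cm_integral_cmeasure_add:
  "cm_integral (\<mu> + \<nu>) (apply_bcontfun f) = cm_integral \<mu> (apply_bcontfun f) + cm_integral \<nu> (apply_bcontfun f)"
  by (rule LIMSEQ_unique[OF cm_integral_grid])
    (simp add: simple_integral_cmeasure_add tendsto_add cm_integral_grid)

lemma cm_integral_cmeasure_scale:
  "cm_integral (c *\<^sub>C \<mu>) (apply_bcontfun f) = c * cm_integral \<mu> (apply_bcontfun f)"
  by (rule LIMSEQ_unique[OF cm_integral_grid])
    (simp add: simple_integral_cmeasure_scale tendsto_mult cm_integral_grid)

section \<open>Measures with continuous densities\<close>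

text \<open>The properties of Haar measure that turn continuous densities into members of
  \<open>'a cmeasure\<close>; translation plays no part yet.\<close>

locale finite_regular_measure = finite_measure m
  for m :: "'a::topological_space measure" +
  assumes sets_m: "sets m = sets borel"
    and inner_regular: "E \<in> sets borel \<Longrightarrow> emeasure m E = (SUP K\<in>{K. compact K \<and> K \<subseteq> E}. emeasure m K)"
    and outer_regular: "E \<in> sets borel \<Longrightarrow> emeasure m E = (INF U\<in>{U. open U \<and> E \<subseteq> U}. emeasure m U)"
begin

lemma space_m [simp]: "space m = UNIV"
  using sets_eq_imp_space_eq[OF sets_m] by simp

lemma bcontfun_measurable [measurable]:
  fixes u :: "'a \<Rightarrow>\<^sub>C complex"
  shows "apply_bcontfun u \<in> borel_measurable m"
  using borel_measurable_continuous_onI[of "apply_bcontfun u"] continuous_on_apply_bcontfun[of UNIV u]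
    measurable_cong_sets[OF sets_m refl, of borel] by auto

lemma integrable_bcontfun [simp]: "integrable m (apply_bcontfun (u :: 'a \<Rightarrow>\<^sub>C complex))"
  by (rule integrable_const_bound[where B = "norm u"]) (auto intro: norm_bounded)

definition density_set :: "('a \<Rightarrow>\<^sub>C complex) \<Rightarrow> 'a set \<Rightarrow> complex" where
  "density_set u E = (if E \<in> sets borel then \<integral>x. indicat_real E x *\<^sub>R u x \<partial>m else 0)"

lemma integrable_indicator_scale: "E \<in> sets borel \<Longrightarrow> integrable m (\<lambda>x. indicat_real E x *\<^sub>R u x)"
  for u :: "'a \<Rightarrow>\<^sub>C complex"
  by (intro integrable_mult_indicator) (auto simp: sets_m)

lemma sum_indicator_disjoint:
  "finite I \<Longrightarrow> disjoint_family_on A I \<Longrightarrow> (\<Sum>i\<in>I. indicat_real (A i) x) = indicat_real (\<Union>i\<in>I. A i) x"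
  by (simp add: indicator_UN_disjoint)

lemma density_set_sums:
  assumes A: "range A \<subseteq> sets borel" "disjoint_family A"
  shows "(\<lambda>n. density_set u (A n)) sums density_set u (\<Union>n. A n)"
proof -
  have [measurable]: "A i \<in> sets m" for i using A(1) by (auto simp: sets_m)
  have disj: "disjoint_family_on A I" for I
    using A(2) by (rule disjoint_family_on_mono[rotated]) simp
  have sum: "(\<Sum>i<n. indicat_real (A i) x) = indicat_real (\<Union>i<n. A i) x" for n x
    by (rule sum_indicator_disjoint) (auto intro: disj)
  have "(\<lambda>n. \<integral>x. (\<Sum>i<n. indicat_real (A i) x) *\<^sub>R u x \<partial>m) \<longlonglongrightarrow>
      (\<integral>x. indicat_real (\<Union>n. A n) x *\<^sub>R u x \<partial>m)"
  proof (rule integral_dominated_convergence[where w = "\<lambda>x. norm u"])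
    show "AE x in m. (\<lambda>n. (\<Sum>i<n. indicat_real (A i) x) *\<^sub>R u x) \<longlonglongrightarrow> indicat_real (\<Union>n. A n) x *\<^sub>R u x"
      using indicator_sums[of A] A(2)
      by (intro AE_I2 tendsto_scaleR tendsto_const) (auto simp: sums_def disjoint_family_on_def)
    show "AE x in m. norm ((\<Sum>i<n. indicat_real (A i) x) *\<^sub>R u x) \<le> norm u" for n
      unfolding sum by (intro AE_I2) (auto simp: indicator_def intro: norm_bounded)
  qed (auto simp: sum)
  moreover have "(\<integral>x. (\<Sum>i<n. indicat_real (A i) x) *\<^sub>R u x \<partial>m) = (\<Sum>i<n. density_set u (A i))" for n
  proof -
    have Ab: "A i \<in> sets borel" for i using A(1) by auto
    show ?thesis
      unfolding scaleR_sum_left density_set_def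
      by (simp only: Ab if_True, rule Bochner_Integration.integral_sum) (intro integrable_indicator_scale Ab)
  qed
  moreover have "(\<Union>n. A n) \<in> sets borel" using A(1) by auto
  ultimately show ?thesis by (simp add: sums_def density_set_def)
qed

lemma cmod_density_set_le:
  assumes "E \<in> sets borel"
  shows "cmod (density_set u E) \<le> (\<integral>x. indicat_real E x * cmod (u x) \<partial>m)"
  using integral_norm_bound[of m "\<lambda>x. indicat_real E x *\<^sub>R u x"] assms by (simp add: density_set_def)

lemma variation_density_set_le:
  assumes S: "S \<in> sets borel"
  shows "variation (density_set u) S \<le> ennreal (\<integral>x. indicat_real S x * cmod (u x) \<partial>m)"
  unfolding variation_def
proof (rule SUP_least)
  fix P assume "P \<in> {P. finite P \<and> disjoint P \<and> P \<subseteq> sets borel \<and> \<Union>P \<subseteq> S}"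
  then have P: "finite P" "disjoint P" "P \<subseteq> sets borel" "\<Union>P \<subseteq> S" by auto
  have int: "integrable m (\<lambda>x. indicat_real E x * cmod (u x))" if "E \<in> sets borel" for E
    using integrable_norm[OF integrable_indicator_scale[OF that, of u]] by simp
  have "(\<Sum>A\<in>P. cmod (density_set u A)) \<le> (\<Sum>A\<in>P. \<integral>x. indicat_real A x * cmod (u x) \<partial>m)"
    using P by (intro sum_mono cmod_density_set_le) auto
  also have "\<dots> = (\<integral>x. (\<Sum>A\<in>P. indicat_real A x) * cmod (u x) \<partial>m)"
    unfolding sum_distrib_right using P(3)
    by (intro Bochner_Integration.integral_sum[symmetric] int) auto
  also have "(\<lambda>x. \<Sum>A\<in>P. indicat_real A x) = indicat_real (\<Union>P)"
    using sum_indicator_disjoint[of P "\<lambda>A. A"] P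
    by (auto simp: disjoint_family_on_def disjoint_def fun_eq_iff)
  also have "(\<integral>x. indicat_real (\<Union>P) x * cmod (u x) \<partial>m) \<le> (\<integral>x. indicat_real S x * cmod (u x) \<partial>m)"
  proof -
    have "\<Union>P \<in> sets borel" using P by (intro sets.finite_Union) auto
    then show ?thesis using P(4) S by (intro integral_mono mult_right_mono int) (auto simp: indicator_def)
  qed
  finally show "(\<Sum>A\<in>P. ennreal (cmod (density_set u A))) \<le> ennreal (\<integral>x. indicat_real S x * cmod (u x) \<partial>m)"
    by (simp add: sum_ennreal ennreal_leI)
qed

lemma regular_approximation:
  assumes E: "E \<in> sets borel" and e: "0 < e" and cl: "\<And>K :: 'a set. compact K \<Longrightarrow> closed K"
  shows "\<exists>K U. compact K \<and> open U \<and> K \<subseteq> E \<and> E \<subseteq> U \<and> measure m (U - K) < e"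
proof -
  define d where "d = e / 2"
  have d: "0 < d" using e by (simp add: d_def)
  \<comment> \<open>For measure below \<open>d\<close> the empty set serves; otherwise
    \<open>measure m E - d\<close> is nonnegative and can be compared in
    \<open>ennreal\<close>.\<close>
  have "\<exists>K. compact K \<and> K \<subseteq> E \<and> measure m E < measure m K + d"
  proof (cases "measure m E < d")
    case True
    then show ?thesis by (intro exI[of _ "{}"]) auto
  next
    case False
    have "ennreal (measure m E - d) < emeasure m E"
      unfolding emeasure_eq_measure using False d by (intro ennreal_lessI) auto
    then obtain K where "compact K" "K \<subseteq> E" "ennreal (measure m E - d) < emeasure m K"
      unfolding inner_regular[OF E] less_SUP_iff by auto
    then show ?thesis
      using False by (intro exI[of _ K]) (auto simp: emeasure_eq_measure ennreal_less_iff)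
  qed
  then obtain K where K: "compact K" "K \<subseteq> E" "measure m E < measure m K + d" by auto
  have "emeasure m E < ennreal (measure m E + d)"
    unfolding emeasure_eq_measure using d by (intro ennreal_lessI) (auto simp: add_nonneg_pos)
  then obtain U where U: "open U" "E \<subseteq> U" "emeasure m U < ennreal (measure m E + d)"
    unfolding outer_regular[OF E] INF_less_iff by auto
  have U': "measure m U < measure m E + d"
    using U(3) d by (simp add: emeasure_eq_measure ennreal_less_iff flip: ennreal_plus)
  have "measure m (U - K) = measure m U - measure m K"
    using K U cl[OF K(1)] by (intro finite_measure_Diff) (auto simp: sets_m borel_open borel_closed)
  then show ?thesis using K U U' by (intro exI[of _ K] exI[of _ U]) (auto simp: d_def)
qed

lemma density_set_regular:
  assumes cl: "\<And>K :: 'a set. compact K \<Longrightarrow> closed K"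
  shows "density_set u \<in> regular_complex_measures"
proof -
  have fin: "variation (density_set u) UNIV < \<infinity>"
    using variation_density_set_le[of UNIV u] by (auto simp: less_top[symmetric] top_unique)
  have "\<exists>K U. compact K \<and> open U \<and> K \<subseteq> E \<and> E \<subseteq> U \<and> variation (density_set u) (U - K) < e"
    if E: "E \<in> sets borel" and e: "0 < e" for E and e :: ennreal
  proof -
    \<comment> \<open>\<open>e\<close> may be infinite; \<open>e'\<close> is a positive real number
      not above it.\<close>
    define e' where "e' = enn2real (min e 1)"
    have me: "min e 1 < top" by (simp add: min_less_iff_disj)
    then have ee: "ennreal e' = min e 1" by (simp add: e'_def)
    then have e': "0 < e'" "ennreal e' \<le> e" using e by (auto simp flip: ennreal_less_zero_iff)
    have nu: "0 < norm u + 1" by (smt (verit) norm_ge_zero)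
    obtain K U where KU: "compact K" "open U" "K \<subseteq> E" "E \<subseteq> U" "measure m (U - K) < e' / (norm u + 1)"
      using regular_approximation[OF E _ cl, of "e' / (norm u + 1)"] e' nu by auto
    have meas: "U - K \<in> sets borel" using KU cl by (auto intro!: sets.Diff borel_open borel_closed)
    have "(\<integral>x. indicat_real (U - K) x * cmod (u x) \<partial>m) \<le> (\<integral>x. indicat_real (U - K) x * (norm u + 1) \<partial>m)"
      using integrable_norm[OF integrable_indicator_scale[OF meas, of u]] meas
        integrable_real_indicator[of "U - K" m]
      by (intro integral_mono mult_left_mono integrable_mult_left)
        (auto simp: sets_m emeasure_eq_measure intro!: order_trans[OF norm_bounded])
    also have "\<dots> = measure m (U - K) * (norm u + 1)" using meas by (simp add: sets_m)
    also have "\<dots> < e'" using KU(5) nu by (simp add: pos_less_divide_eq)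
    finally have "ennreal (\<integral>x. indicat_real (U - K) x * cmod (u x) \<partial>m) < ennreal e'"
      using e' by (intro ennreal_lessI)
    then have "variation (density_set u) (U - K) < e"
      using variation_density_set_le[OF meas, of u] e'(2) by (meson le_less_trans less_le_trans)
    then show ?thesis using KU by blast
  qed
  moreover have "\<forall>E. E \<notin> sets borel \<longrightarrow> density_set u E = 0" by (simp add: density_set_def)
  ultimately show ?thesis
    using density_set_sums fin unfolding regular_complex_measures_def by auto
qed

definition density_cmeasure :: "('a \<Rightarrow>\<^sub>C complex) \<Rightarrow> 'a cmeasure" where
  "density_cmeasure u = Abs_cmeasure (density_set u)"

context
  assumes cl: "\<And>K :: 'a set. compact K \<Longrightarrow> closed K"
begin

lemma cmeasure_of_density: "cmeasure_of (density_cmeasure u) = density_set u"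
  unfolding density_cmeasure_def by (rule Abs_cmeasure_inverse[OF density_set_regular[OF cl]])

lemma norm_density_cmeasure: "norm (density_cmeasure u) \<le> (\<integral>x. cmod (u x) \<partial>m)"
proof -
  have "variation (density_set u) UNIV \<le> ennreal (\<integral>x. cmod (u x) \<partial>m)"
    using variation_density_set_le[of UNIV u] by simp
  then have "enn2real (variation (density_set u) UNIV) \<le> (\<integral>x. cmod (u x) \<partial>m)"
    by (rule enn2real_leI[rotated]) simp
  then show ?thesis by (simp add: norm_cmeasure.rep_eq cmeasure_of_density)
qed

lemma density_cmeasure_sum:
  assumes "finite I"
  shows "density_cmeasure (\<Sum>i\<in>I. c i *\<^sub>C u i) = (\<Sum>i\<in>I. c i *\<^sub>C density_cmeasure (u i))"
proof (rule clinear_sum)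
  show "density_cmeasure (u + v) = density_cmeasure u + density_cmeasure v" for u v
    by (rule cmeasure_of_inject[THEN iffD1])
      (auto simp: cmeasure_of_density plus_cmeasure.rep_eq density_set_def fun_eq_iff scaleR_add_right
        plus_bcontfun.rep_eq integrable_indicator_scale)
  show "density_cmeasure (c *\<^sub>C u) = c *\<^sub>C density_cmeasure u" for c u
    by (rule cmeasure_of_inject[THEN iffD1])
      (auto simp: cmeasure_of_density scaleC_cmeasure.rep_eq density_set_def fun_eq_iff
        simp flip: mult_scaleR_right)
qed

lemma cm_integral_density:
  "cm_integral (density_cmeasure u) (apply_bcontfun f) = (\<integral>x. f x * u x \<partial>m)"
proof (rule LIMSEQ_unique[OF cm_integral_grid])
  have "simple_integral (density_cmeasure u) (\<lambda>x. grid n (f x)) = (\<integral>x. grid n (f x) * u x \<partial>m)" for n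
  proof -
    let ?s = "\<lambda>x. grid n (f x)"
    note s = simple_functionD'[OF simple_approximation(1)[of n f]]
    have "simple_integral (density_cmeasure u) ?s =
        (\<Sum>c\<in>range ?s. \<integral>x. c * (indicat_real (?s -` {c}) x *\<^sub>R u x) \<partial>m)"
      unfolding simple_integral_def cmeasure_of_density density_set_def
      by (simp only: s(2) if_True integral_mult_right_zero)
    also have "\<dots> = (\<integral>x. (\<Sum>c\<in>range ?s. c * (indicat_real (?s -` {c}) x *\<^sub>R u x)) \<partial>m)"
      by (rule Bochner_Integration.integral_sum[symmetric])
        (intro integrable_mult_right integrable_indicator_scale s(2))
    also have "(\<lambda>x. \<Sum>c\<in>range ?s. c * (indicat_real (?s -` {c}) x *\<^sub>R u x)) = (\<lambda>x. ?s x * u x)"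
    proof
      fix x
      have "(\<Sum>c\<in>range ?s. c * (indicat_real (?s -` {c}) x *\<^sub>R u x)) =
          (\<Sum>c\<in>range ?s. if c = ?s x then ?s x * u x else 0)"
        by (intro sum.cong) (auto simp: indicator_def)
      also have "\<dots> = ?s x * u x" using s(1) by (subst sum.delta) auto
      finally show "(\<Sum>c\<in>range ?s. c * (indicat_real (?s -` {c}) x *\<^sub>R u x)) = ?s x * u x" .
    qed
    finally show ?thesis .
  qed
  moreover have "(\<lambda>n. \<integral>x. grid n (f x) * u x \<partial>m) \<longlonglongrightarrow> (\<integral>x. f x * u x \<partial>m)"
  proof (rule integral_dominated_convergence[where w = "\<lambda>x. (norm f + 2) * norm u"])
    have [measurable]: "(\<lambda>x. grid n (f x)) \<in> borel_measurable m" for n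
      using borel_measurable_simple_function[OF simple_approximation(1)[of n f]]
        measurable_cong_sets[OF sets_m refl, of borel] by auto
    show "(\<lambda>x. grid n (f x) * u x) \<in> borel_measurable m" for n by measurable
    show "AE x in m. (\<lambda>n. grid n (f x) * u x) \<longlonglongrightarrow> f x * u x"
      by (intro AE_I2 tendsto_mult tendsto_const tendsto_uniform_limitI[OF simple_approximation(2)]) simp
    show "AE x in m. norm (grid n (f x) * u x) \<le> (norm f + 2) * norm u" for n
    proof (rule AE_I2)
      fix x
      have "cmod (grid n (f x)) \<le> cmod (f x) + 2 / real (Suc n)"
        using dist_grid[of n "f x"] norm_triangle_sub[of "grid n (f x)" "f x"] by (simp add: dist_norm)
      also have "\<dots> \<le> norm f + 2" by (intro add_mono norm_bounded) (simp add: field_simps)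
      finally show "norm (grid n (f x) * u x) \<le> (norm f + 2) * norm u"
        unfolding norm_mult by (intro mult_mono norm_bounded) auto
    qed
  qed auto
  ultimately show "(\<lambda>n. simple_integral (density_cmeasure u) (\<lambda>x. grid n (f x))) \<longlonglongrightarrow> (\<integral>x. f x * u x \<partial>m)"
    by simp
qed

end

end

section \<open>Harmonic analysis on a compact Abelian group\<close>

lemma continuous_on_bcontfun_comp [continuous_intros]:
  fixes u :: "'a::topological_space \<Rightarrow>\<^sub>C 'b::metric_space"
  shows "continuous_on S g \<Longrightarrow> continuous_on S (\<lambda>x. apply_bcontfun u (g x))"
  by (rule continuous_on_compose2[OF continuous_on_apply_bcontfun[of UNIV u]]) auto

lemma vimage_translate: "(+) a -` E = (+) (- a) ` E" for a :: "'a::ab_group_add"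
proof (intro set_eqI iffI)
  fix x assume "x \<in> (+) a -` E"
  then show "x \<in> (+) (- a) ` E" by (intro image_eqI[of _ _ "a + x"]) auto
qed auto

lemma borel_list_index:
  fixes X :: "nat \<Rightarrow> 'a::topological_space set"
  assumes "\<And>i. open (X i)" "\<And>x. \<exists>i. x \<in> X i"
  shows "{x. (LEAST i. x \<in> X i) = k} \<in> sets borel"
proof -
  have "{x. (LEAST i. x \<in> X i) = k} = X k - (\<Union>j<k. X j)"
  proof (intro equalityI subsetI)
    fix x assume "x \<in> {x. (LEAST i. x \<in> X i) = k}"
    then have k: "k = (LEAST i. x \<in> X i)" by simp
    have "x \<in> X k" unfolding k by (rule LeastI_ex[OF assms(2)])
    moreover have "x \<notin> X j" if "j < k" for j using not_less_Least that unfolding k by blast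
    ultimately show "x \<in> X k - (\<Union>j<k. X j)" by blast
  next
    fix x assume x: "x \<in> X k - (\<Union>j<k. X j)"
    have "(LEAST i. x \<in> X i) = k"
    proof (rule Least_equality)
      show "k \<le> j" if "x \<in> X j" for j using x that by (cases "j < k") auto
    qed (use x in blast)
    then show "x \<in> {x. (LEAST i. x \<in> X i) = k}" by simp
  qed
  also have "\<dots> \<in> sets borel" using assms(1) by (intro sets.Diff sets.finite_UN) (auto intro: borel_open)
  finally show ?thesis .
qed

locale haar =
  fixes m :: "'g::{topological_ab_group_add, t2_space} measure"
  assumes compact_G: "compact (UNIV :: 'g set)" and haar: "normalized_haar_measure m"
begin

sublocale finite_regular_measure m
proof (intro finite_regular_measure.intro finite_measureI finite_regular_measure_axioms.intro)
  show "sets m = sets borel" using haar by (simp add: normalized_haar_measure_def)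
  from sets_eq_imp_space_eq[OF this] show "emeasure m (space m) \<noteq> \<infinity>"
    using haar by (simp add: normalized_haar_measure_def)
qed (use haar[unfolded normalized_haar_measure_def] in blast)+

lemma measure_UNIV [simp]: "measure m UNIV = 1"
  using haar by (simp add: normalized_haar_measure_def measure_def)

lemma emeasure_translate: "E \<in> sets borel \<Longrightarrow> emeasure m ((+) a ` E) = emeasure m E"
  using haar unfolding normalized_haar_measure_def by blast

lemma emeasure_UNIV [simp]: "emeasure m UNIV = 1"
  using haar unfolding normalized_haar_measure_def by blast

lemma apply_Bcontfun: "continuous_on UNIV (f :: 'g \<Rightarrow> complex) \<Longrightarrow> apply_bcontfun (Bcontfun f) = f"
  by (rule Bcontfun_inverse)
    (auto simp: bcontfun_def intro: compact_imp_bounded compact_continuous_image compact_G)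

lemma integrable_continuous: "continuous_on UNIV (f :: 'g \<Rightarrow> complex) \<Longrightarrow> integrable m f"
  using integrable_bcontfun[of "Bcontfun f"] by (simp add: apply_Bcontfun)

lemma continuous_measurable: "continuous_on UNIV f \<Longrightarrow> f \<in> borel_measurable m"
  for f :: "'g \<Rightarrow> 'b::topological_space"
  using borel_measurable_continuous_onI[of f] measurable_cong_sets[OF sets_m refl, of borel] by auto

lemma norm_integral_le: "cmod (\<integral>x. f x \<partial>m) \<le> C" if "\<And>x. cmod (f x) \<le> C" "continuous_on UNIV f"
proof -
  have "cmod (\<integral>x. f x \<partial>m) \<le> (\<integral>x. cmod (f x) \<partial>m)" by (rule integral_norm_bound)
  also have "\<dots> \<le> (\<integral>x. C \<partial>m)"
    by (intro integral_mono integrable_norm integrable_continuous that) auto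
  finally show ?thesis by simp
qed

text \<open>Near each \<open>x0\<close> the values \<open>F (x, y)\<close> vary by at most
  \<open>e\<close>, uniformly in \<open>y\<close>, by compactness; \<open>r\<close> sends a point to
  the centre of the first such neighbourhood in a finite cover. Letting \<open>e\<close> tend to
  \<open>0\<close> gives countably many test points even if \<open>G\<close> is not
  metrizable.\<close>

lemma finite_range_approximation:
  fixes F :: "'g \<times> 'g \<Rightarrow> complex"
  assumes F: "continuous_on UNIV F" and "0 < e"
  obtains r :: "'g \<Rightarrow> 'g" where "finite (range r)" "\<And>z. r -` {z} \<in> sets borel"
    "\<And>x y. dist (F (x, y)) (F (r x, y)) \<le> e"
proof -
  have "\<exists>X0. x0 \<in> X0 \<and> open X0 \<and> (\<forall>x\<in>X0. \<forall>y. dist (F (x, y)) (F (x0, y)) \<le> e)" for x0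
    by (rule continuous_on_prod_compactE[of UNIV UNIV F x0 e]) (use F compact_G \<open>0 < e\<close> in auto)
  then obtain X where X: "\<And>x. x \<in> X x" "\<And>x. open (X x)"
      "\<And>x0 x y. x \<in> X x0 \<Longrightarrow> dist (F (x, y)) (F (x0, y)) \<le> e" by metis
  have "UNIV \<subseteq> (\<Union>x\<in>UNIV. X x)" using X(1) by blast
  with X(2) obtain D where D: "finite D" "UNIV \<subseteq> (\<Union>x\<in>D. X x)"
    by (rule compactE_image[OF compact_G])
  obtain xs where xs: "set xs = D" using finite_list[OF D(1)] by auto
  define Y where "Y i = (if i < length xs then X (xs ! i) else {})" for i
  have Y: "open (Y i)" for i by (simp add: Y_def X(2))
  have cov: "\<exists>i. x \<in> Y i" for x
  proof -
    obtain d where "d \<in> set xs" "x \<in> X d" using D xs by auto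
    then obtain i where "i < length xs" "xs ! i = d" by (auto simp: in_set_conv_nth)
    then show ?thesis using \<open>x \<in> X d\<close> by (intro exI[of _ i]) (simp add: Y_def)
  qed
  define I where "I x = (LEAST i. x \<in> Y i)" for x
  have I: "x \<in> Y (I x)" for x unfolding I_def by (rule LeastI_ex[OF cov])
  have Il: "I x < length xs" for x using I[of x] by (auto simp: Y_def split: if_splits)
  show ?thesis
  proof (rule that[of "\<lambda>x. xs ! I x"])
    show "finite (range (\<lambda>x. xs ! I x))"
      by (rule finite_subset[of _ "set xs"]) (use Il in auto)
    have "(\<lambda>x. xs ! I x) -` {z} = (\<Union>k\<in>{k. k < length xs \<and> xs ! k = z}. {x. I x = k})" for z
      using Il by auto
    then show "(\<lambda>x. xs ! I x) -` {z} \<in> sets borel" for z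
      by (simp only:, intro sets.finite_UN) (auto simp: I_def intro: borel_list_index[OF Y cov])
    show "dist (F (x, y)) (F (xs ! I x, y)) \<le> e" for x y
      using I[of x] Il[of x] by (intro X(3)) (simp add: Y_def)
  qed
qed

text \<open>If \<open>G\<close> is not second countable, then the Borel sets of \<open>G \<times> G\<close> need not belong to the product
  \<open>\<sigma>\<close>-algebra, but continuous functions are still measurable for it.\<close>

lemma borel_measurable_pair:
  fixes F :: "'g \<times> 'g \<Rightarrow> complex"
  assumes F: "continuous_on UNIV F"
  shows "F \<in> borel_measurable (m \<Otimes>\<^sub>M m)"
proof -
  have "\<exists>r :: 'g \<Rightarrow> 'g. finite (range r) \<and> (\<forall>z. r -` {z} \<in> sets borel) \<and>
      (\<forall>x y. dist (F (x, y)) (F (r x, y)) \<le> 1 / real (Suc n))" for n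
    by (rule finite_range_approximation[OF F, of "1 / real (Suc n)"]) auto
  then obtain r :: "nat \<Rightarrow> 'g \<Rightarrow> 'g" where r: "\<And>n. finite (range (r n))" "\<And>n z. r n -` {z} \<in> sets borel"
      "\<And>n x y. dist (F (x, y)) (F (r n x, y)) \<le> 1 / real (Suc n)"
    by metis
  show ?thesis
  proof (rule borel_measurable_LIMSEQ_metric[where f = "\<lambda>n p. F (r n (fst p), snd p)"])
    fix n
    have [measurable]: "(\<lambda>y. F (d, y)) \<in> borel_measurable m" for d
      by (intro continuous_measurable continuous_on_compose2[OF F] continuous_intros) auto
    have [measurable]: "r n -` {d} \<in> sets m" for d by (simp add: r sets_m)
    \<comment> \<open>A finite sum of products of functions of one variable each, hence measurable
      for the product.\<close>
    have "(\<lambda>p. F (r n (fst p), snd p)) =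
        (\<lambda>p. \<Sum>d\<in>range (r n). indicator (r n -` {d}) (fst p) * F (d, snd p))"
    proof
      fix p
      have "(\<Sum>d\<in>range (r n). indicator (r n -` {d}) (fst p) * F (d, snd p)) =
          (\<Sum>d\<in>range (r n). if d = r n (fst p) then F (r n (fst p), snd p) else 0)"
        by (intro sum.cong) (auto simp: indicator_def)
      then show "F (r n (fst p), snd p) = (\<Sum>d\<in>range (r n). indicator (r n -` {d}) (fst p) * F (d, snd p))"
        using r(1)[of n] by simp
    qed
    then show "(\<lambda>p. F (r n (fst p), snd p)) \<in> borel_measurable (m \<Otimes>\<^sub>M m)" by simp
  next
    fix p
    show "(\<lambda>n. F (r n (fst p), snd p)) \<longlonglongrightarrow> F p"
    proof (rule metric_LIMSEQ_I)
      fix e :: real assume "0 < e"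
      then obtain N where N: "1 / real (Suc N) < e" using nat_approx_posE by blast
      have "dist (F (r n (fst p), snd p)) (F p) < e" if "n \<ge> N" for n
      proof -
        have "dist (F (r n (fst p), snd p)) (F p) \<le> 1 / real (Suc n)"
          using r(3)[of "fst p" "snd p" n] by (simp add: dist_commute)
        also have "\<dots> \<le> 1 / real (Suc N)" using that by (simp add: frac_le)
        finally show ?thesis using N by simp
      qed
      then show "\<exists>N. \<forall>n\<ge>N. dist (F (r n (fst p), snd p)) (F p) < e" by blast
    qed
  qed
qed

lemma integral_swap:
  fixes F :: "'g \<times> 'g \<Rightarrow> complex"
  assumes F: "continuous_on UNIV F"
  shows "(\<integral>y. (\<integral>x. F (x, y) \<partial>m) \<partial>m) = (\<integral>x. (\<integral>y. F (x, y) \<partial>m) \<partial>m)"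
proof -
  interpret P: pair_sigma_finite m m ..
  interpret Q: finite_measure "m \<Otimes>\<^sub>M m" by (rule finite_measure_pair_measure) unfold_locales
  have "compact (UNIV :: ('g \<times> 'g) set)" using compact_Times[OF compact_G compact_G] by simp
  then have "bounded (range F)" by (intro compact_imp_bounded compact_continuous_image F)
  then obtain B where "\<And>p. cmod (F p) \<le> B" by (auto simp: bounded_iff)
  then have "integrable (m \<Otimes>\<^sub>M m) F"
    by (intro Q.integrable_const_bound[where B = B]) (auto intro: borel_measurable_pair F)
  then show ?thesis by (intro P.Fubini_integral[of "\<lambda>x y. F (x, y)"]) (simp add: case_prod_beta')
qed

lemma continuous_on_integral:
  fixes F :: "'g \<times> 'g \<Rightarrow> complex"
  assumes F: "continuous_on UNIV F"
  shows "continuous_on UNIV (\<lambda>x. \<integral>y. F (x, y) \<partial>m)"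
proof -
  have Fc: "continuous_on UNIV (\<lambda>y. F (x, y))" for x
    by (intro continuous_on_compose2[OF F] continuous_intros) auto
  have "\<forall>\<^sub>F x in at x0. dist (\<integral>y. F (x, y) \<partial>m) (\<integral>y. F (x0, y) \<partial>m) < e" if "0 < e" for x0 e
  proof (rule continuous_on_prod_compactE[of UNIV UNIV F x0 "e/2"])
    fix X0 assume X0: "x0 \<in> X0" "open X0" "\<forall>x\<in>X0 \<inter> UNIV. \<forall>t\<in>UNIV. dist (F (x, t)) (F (x0, t)) \<le> e/2"
    have "dist (\<integral>y. F (x, y) \<partial>m) (\<integral>y. F (x0, y) \<partial>m) < e" if "x \<in> X0" for x
    proof -
      have "(\<integral>y. F (x, y) \<partial>m) - (\<integral>y. F (x0, y) \<partial>m) = (\<integral>y. F (x, y) - F (x0, y) \<partial>m)"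
        by (intro Bochner_Integration.integral_diff[symmetric] integrable_continuous Fc)
      also have "cmod \<dots> \<le> e/2"
        by (intro norm_integral_le continuous_intros Fc) (use X0 that in \<open>simp add: dist_norm\<close>)
      finally show ?thesis using \<open>0 < e\<close> by (simp add: dist_norm)
    qed
    then show ?thesis using X0 by (auto simp: eventually_at_topological)
  qed (use F compact_G that in auto)
  then show ?thesis
    by (auto simp: continuous_on_eq_continuous_within continuous_within tendsto_iff)
qed

section \<open>Invariance and positivity of the Haar integral\<close>

lemma distr_translate: "distr m m ((+) a) = m"
proof (rule measure_eqI)
  have cont: "continuous_on UNIV ((+) a)" by (intro continuous_intros)
  have meas: "(+) a \<in> measurable m m"
    using borel_measurable_continuous_onI[OF cont] measurable_cong_sets[OF sets_m sets_m] by auto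
  fix E assume "E \<in> sets (distr m m ((+) a))"
  then have E: "E \<in> sets m" by simp
  have "emeasure m ((+) a -` E) = emeasure m E"
    unfolding vimage_translate using E by (intro emeasure_translate) (simp add: sets_m)
  then show "emeasure (distr m m ((+) a)) E = emeasure m E"
    using E by (simp add: emeasure_distr[OF meas])
qed simp

lemma integral_translate:
  fixes f :: "'g \<Rightarrow> complex"
  assumes "continuous_on UNIV f"
  shows "(\<integral>x. f (x + a) \<partial>m) = (\<integral>x. f x \<partial>m)"
proof -
  have cont: "continuous_on UNIV ((+) a)" by (intro continuous_intros)
  have meas: "(+) a \<in> measurable m m"
    using borel_measurable_continuous_onI[OF cont] measurable_cong_sets[OF sets_m sets_m] by auto
  have "(\<integral>x. f (a + x) \<partial>m) = (\<integral>x. f x \<partial>(distr m m ((+) a)))"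
    by (rule integral_distr[symmetric, OF meas continuous_measurable[OF assms]])
  then show ?thesis by (simp add: distr_translate add.commute)
qed

text \<open>The double integral of \<open>f (x - y)\<close> is the integral of \<open>f\<close> if
  \<open>x\<close> is integrated first, and that of \<open>f (- y)\<close> if \<open>y\<close> is.
  This avoids the uniqueness of Haar measure.\<close>

lemma integral_reflect:
  fixes f :: "'g \<Rightarrow> complex"
  assumes f: "continuous_on UNIV f"
  shows "(\<integral>y. f (a - y) \<partial>m) = (\<integral>y. f y \<partial>m)"
proof -
  have F: "continuous_on UNIV (\<lambda>p :: 'g \<times> 'g. f (fst p - snd p))"
    by (intro continuous_on_compose2[OF f] continuous_intros) auto
  have fm: "continuous_on UNIV (\<lambda>y. f (b - y))" for b
    by (intro continuous_on_compose2[OF f] continuous_intros) auto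
  have refl: "(\<integral>y. f (b - y) \<partial>m) = (\<integral>y. f (- y) \<partial>m)" for b
    using integral_translate[of "\<lambda>y. f (b - y)" b] fm[of b] by (simp add: algebra_simps)
  have "(\<integral>x. f x \<partial>m) = (\<integral>y. (\<integral>x. f (x - y) \<partial>m) \<partial>m)"
    using integral_translate[OF f, of "- y" for y] by simp
  also have "\<dots> = (\<integral>x. (\<integral>y. f (x - y) \<partial>m) \<partial>m)" using integral_swap[OF F] by simp
  also have "\<dots> = (\<integral>y. f (- y) \<partial>m)" by (simp add: refl)
  finally show ?thesis by (simp add: refl)
qed

text \<open>Finitely many translates of \<open>U\<close> cover \<open>G\<close>; if \<open>U\<close>
  were null, so would be \<open>G\<close>.\<close>

lemma open_measure_pos:
  fixes U :: "'g set"
  assumes U: "open U" "x0 \<in> U"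
  shows "0 < measure m U"
proof (rule ccontr)
  assume "\<not> 0 < measure m U"
  then have 0: "emeasure m U = 0" using measure_nonneg[of m U] by (simp add: emeasure_eq_measure)
  have V: "open ((+) a ` U)" for a
  proof -
    have "(+) a ` U = (+) (- a) -` U"
      by (simp only: vimage_translate minus_minus)
    moreover have "open ((+) (- a) -` U)"
      by (intro open_vimage U) (intro continuous_intros)
    ultimately show ?thesis by simp
  qed
  have "x \<in> (+) (x - x0) ` U" for x using U(2) by (auto simp: image_iff intro!: bexI[of _ x0])
  then have "UNIV \<subseteq> (\<Union>a\<in>UNIV. (+) a ` U)" by blast
  with V obtain D where D: "finite D" "UNIV \<subseteq> (\<Union>a\<in>D. (+) a ` U)"
    by (rule compactE_image[OF compact_G])
  have "emeasure m ((+) a ` U) = 0" for a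
    using emeasure_translate[of U a] U(1) 0 by (simp add: borel_open)
  then have "emeasure m (\<Union>a\<in>D. (+) a ` U) \<le> (\<Sum>a\<in>D. 0)"
    using emeasure_subadditive_finite[OF D(1), of "\<lambda>a. (+) a ` U" m] V
    by (auto simp: sets_m intro: borel_open)
  then show False using D(2) by (simp add: top.extremum_unique)
qed

lemma integral_nonneg_eq_0:
  fixes f :: "'g \<Rightarrow> real"
  assumes f: "continuous_on UNIV f" "\<And>x. 0 \<le> f x" and 0: "(\<integral>x. f x \<partial>m) = 0"
  shows "f x = 0"
proof (rule ccontr)
  assume "f x \<noteq> 0"
  then have pos: "0 < f x" using f(2)[of x] by simp
  define U where "U = f -` {f x / 2 <..}"
  have U: "open U" unfolding U_def by (intro open_vimage f(1)) simp
  then have Um: "U \<in> sets m" by (simp add: sets_m borel_open)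
  have int: "integrable m f"
    using integrable_Re[OF integrable_continuous[OF continuous_on_of_real[OF f(1)]]] by simp
  have "0 < f x / 2 * measure m U"
    using open_measure_pos[OF U, of x] pos by (simp add: U_def)
  also have "\<dots> = (\<integral>y. f x / 2 * indicat_real U y \<partial>m)" using Um by simp
  also have "\<dots> \<le> (\<integral>y. f y \<partial>m)"
    using f(2) pos Um int by (intro integral_mono integrable_mult_right integrable_real_indicator)
      (auto simp: indicator_def U_def emeasure_eq_measure less_imp_le)
  finally show False using 0 by simp
qed

end

text \<open>The library has completeness of \<open>'a \<Rightarrow>\<^sub>C 'b\<close> only for metric domains.\<close>

lemma bcontfun_uniformly_Cauchy_convergent:
  fixes X :: "nat \<Rightarrow> 'a::topological_space \<Rightarrow>\<^sub>C 'b::complete_space"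
  assumes "uniformly_Cauchy_on UNIV (\<lambda>n. apply_bcontfun (X n))"
  shows "\<exists>l. X \<longlonglongrightarrow> l"
proof -
  obtain g where "uniform_limit UNIV (\<lambda>n. apply_bcontfun (X n)) g sequentially"
    using Cauchy_uniformly_convergent[OF assms] by (auto simp: uniformly_convergent_on_def)
  then show ?thesis by (rule uniform_limit_bcontfunE) auto
qed

section \<open>The \<open>L_2\<close> inner product on continuous functions, and convolution\<close>

context haar
begin

definition ip2 :: "('g \<Rightarrow>\<^sub>C complex) \<Rightarrow> ('g \<Rightarrow>\<^sub>C complex) \<Rightarrow> complex" where
  "ip2 u v = (\<integral>x. u x * cnj (v x) \<partial>m)"

lemma integrable_mult_cnj: "integrable m (\<lambda>x. apply_bcontfun u x * cnj (apply_bcontfun v x))"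
  by (intro integrable_continuous continuous_intros)

lemma Re_ip2_self: "Re (ip2 u u) = (\<integral>x. (cmod (u x))\<^sup>2 \<partial>m)"
proof -
  have "Re (ip2 u u) = (\<integral>x. Re (u x * cnj (u x)) \<partial>m)"
    unfolding ip2_def by (rule integral_Re[symmetric, OF integrable_mult_cnj])
  then show ?thesis by (simp only: complex_norm_square[symmetric] Re_complex_of_real)
qed

sublocale L2: prehilbert ip2
proof
  fix u v w :: "'g \<Rightarrow>\<^sub>C complex" and c
  show "ip2 (u + v) w = ip2 u w + ip2 v w"
    unfolding ip2_def plus_bcontfun.rep_eq distrib_right
    by (intro Bochner_Integration.integral_add integrable_mult_cnj)
  show "ip2 (c *\<^sub>C u) v = c * ip2 u v"
    unfolding ip2_def scaleC_bcontfun_apply mult.assoc by simp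
  show "ip2 u v = cnj (ip2 v u)"
    unfolding ip2_def by (simp add: mult.commute flip: Bochner_Integration.integral_cnj)
  show "0 \<le> Re (ip2 u u)" unfolding Re_ip2_self by (intro Bochner_Integration.integral_nonneg) auto
  assume "ip2 u u = 0"
  then have 0: "(\<integral>x. (cmod (u x))\<^sup>2 \<partial>m) = 0" using Re_ip2_self[of u] by simp
  have "(cmod (u x))\<^sup>2 = 0" for x
    by (rule integral_nonneg_eq_0[OF _ _ 0]) (auto intro!: continuous_intros)
  then show "u = 0" by (intro bcontfun_eqI) simp
qed

lemma L2_nrm_sq: "(L2.nrm u)\<^sup>2 = (\<integral>x. (cmod (u x))\<^sup>2 \<partial>m)"
  unfolding L2.nrm_sq by (rule Re_ip2_self)

lemma L2_nrm_le_norm: "L2.nrm u \<le> norm u"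
proof (rule power2_le_imp_le)
  have "L2.nrm u ^ 2 = cmod (ip2 u u)" by (simp only: L2.ip_self norm_of_real abs_power2)
  also have "\<dots> \<le> (norm u)\<^sup>2"
    unfolding ip2_def
    by (intro norm_integral_le continuous_intros)
      (simp add: norm_mult power2_eq_square mult_mono norm_bounded)
  finally show "(L2.nrm u)\<^sup>2 \<le> (norm u)\<^sup>2" .
qed simp

lemma integral_cmod_le_L2_nrm: "(\<integral>x. cmod (u x) \<partial>m) \<le> L2.nrm u" for u :: "'g \<Rightarrow>\<^sub>C complex"
proof -
  define v where "v = Bcontfun (\<lambda>x. of_real (cmod (apply_bcontfun u x)) :: complex)"
  define one where "one = Bcontfun (\<lambda>x::'g. 1::complex)"
  have v: "apply_bcontfun v = (\<lambda>x. of_real (cmod (u x)))"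
    unfolding v_def by (rule apply_Bcontfun) (intro continuous_intros)
  have one: "apply_bcontfun one = (\<lambda>x. 1)"
    unfolding one_def by (rule apply_Bcontfun) (intro continuous_intros)
  have "(\<integral>x. cmod (u x) \<partial>m) = cmod (ip2 v one)"
    unfolding ip2_def v one by (simp add: integral_nonneg)
  also have "\<dots> \<le> L2.nrm v * L2.nrm one" by (rule L2.Cauchy_Schwarz)
  also have "L2.nrm v = L2.nrm u" by (simp add: L2.nrm_def Re_ip2_self v)
  also have "L2.nrm one = 1" by (simp add: L2.nrm_def Re_ip2_self one)
  finally show ?thesis by simp
qed

definition conv :: "('g \<Rightarrow>\<^sub>C complex) \<Rightarrow> ('g \<Rightarrow>\<^sub>C complex) \<Rightarrow> ('g \<Rightarrow>\<^sub>C complex)" where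
  "conv k u = Bcontfun (\<lambda>x. \<integral>y. k (x - y) * u y \<partial>m)"

lemma conv_apply: "conv k u x = (\<integral>y. k (x - y) * u y \<partial>m)"
proof -
  have "continuous_on UNIV (\<lambda>x. \<integral>y. (\<lambda>p. k (fst p - snd p) * u (snd p)) (x, y) \<partial>m)"
    by (intro continuous_on_integral continuous_intros)
  then have "continuous_on UNIV (\<lambda>x. \<integral>y. k (x - y) * u y \<partial>m)" by simp
  from apply_Bcontfun[OF this] show ?thesis unfolding conv_def by simp
qed

lemma integrable_conv: "integrable m (\<lambda>y. apply_bcontfun k (x - y) * apply_bcontfun u y)"
  for k u :: "'g \<Rightarrow>\<^sub>C complex"
  by (intro integrable_continuous continuous_intros)

lemma conv_add: "conv k (u + v) = conv k u + conv k v"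
  by (rule bcontfun_eqI)
    (simp add: conv_apply plus_bcontfun.rep_eq distrib_left integrable_conv)

lemma conv_diff: "conv k (u - v) = conv k u - conv k v"
  by (rule bcontfun_eqI)
    (simp add: conv_apply minus_bcontfun.rep_eq right_diff_distrib integrable_conv)

lemma conv_scale: "conv k (c *\<^sub>C u) = c *\<^sub>C conv k u"
  by (rule bcontfun_eqI) (simp add: conv_apply mult.left_commute)

lemma cmod_conv_diff_le:
  fixes k :: "'g \<Rightarrow>\<^sub>C complex"
  assumes "\<And>y. cmod (k (x - y) - k (x' - y)) \<le> e"
  shows "cmod (conv k u x - conv k u x') \<le> e * L2.nrm u"
proof -
  have e: "0 \<le> e" using assms[of undefined] by (meson norm_ge_zero order_trans)
  have "conv k u x - conv k u x' = (\<integral>y. (k (x - y) - k (x' - y)) * u y \<partial>m)"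
    unfolding conv_apply left_diff_distrib
    by (intro Bochner_Integration.integral_diff[symmetric] integrable_conv)
  also have "cmod \<dots> \<le> (\<integral>y. cmod ((k (x - y) - k (x' - y)) * u y) \<partial>m)"
    by (rule integral_norm_bound)
  also have "\<dots> \<le> (\<integral>y. e * cmod (u y) \<partial>m)"
    unfolding norm_mult
    by (intro integral_mono mult_right_mono assms integrable_mult_right integrable_norm integrable_bcontfun)
      (auto simp flip: norm_mult intro!: integrable_norm integrable_continuous continuous_intros)
  also have "\<dots> = e * (\<integral>y. cmod (u y) \<partial>m)" by simp
  also have "\<dots> \<le> e * L2.nrm u" by (intro mult_left_mono integral_cmod_le_L2_nrm e)
  finally show ?thesis .
qed

lemma cmod_conv_le: "cmod (conv k u x) \<le> norm k * L2.nrm u"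
proof -
  have "cmod (conv k u x) \<le> (\<integral>y. cmod (k (x - y) * u y) \<partial>m)"
    unfolding conv_apply by (rule integral_norm_bound)
  also have "\<dots> \<le> (\<integral>y. norm k * cmod (u y) \<partial>m)"
    unfolding norm_mult
    by (intro integral_mono mult_right_mono norm_bounded integrable_mult_right integrable_norm integrable_bcontfun)
      (auto simp flip: norm_mult intro!: integrable_norm integrable_continuous continuous_intros)
  also have "\<dots> = norm k * (\<integral>y. cmod (u y) \<partial>m)" by simp
  also have "\<dots> \<le> norm k * L2.nrm u" by (intro mult_left_mono integral_cmod_le_L2_nrm) simp
  finally show ?thesis .
qed

lemma norm_conv_le: "norm (conv k u) \<le> norm k * L2.nrm u"
  by (rule norm_bound) (rule cmod_conv_le)

text \<open>Arzela-Ascoli for the image of the \<open>L_2\<close> unit ball: a diagonal subsequence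
  converges on the countable union of the finite nets \<open>range (r n)\<close>, and equicontinuity
  makes it uniformly Cauchy.\<close>

lemma conv_compact:
  assumes X: "\<And>n. L2.nrm (X n) \<le> 1"
  shows "\<exists>l \<phi>. strict_mono (\<phi> :: nat \<Rightarrow> nat) \<and> (\<lambda>n. conv k (X (\<phi> n))) \<longlonglongrightarrow> l"
proof -
  have "\<exists>r :: 'g \<Rightarrow> 'g. finite (range r) \<and> (\<forall>x y. cmod (k (x - y) - k (r x - y)) \<le> 1 / real (Suc n))" for n
  proof (rule finite_range_approximation[where F = "\<lambda>p. k (fst p - snd p)" and e = "1 / real (Suc n)"])
    show "continuous_on UNIV (\<lambda>p :: 'g \<times> 'g. apply_bcontfun k (fst p - snd p))"
      by (intro continuous_intros)
  qed (auto simp: dist_norm)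
  then obtain r :: "nat \<Rightarrow> 'g \<Rightarrow> 'g" where r: "\<And>n. finite (range (r n))"
      "\<And>n x y. cmod (k (x - y) - k (r n x - y)) \<le> 1 / real (Suc n)" by metis
  define D where "D = (\<Union>n. range (r n))"
  have D: "countable D" unfolding D_def by (intro countable_UN) (auto intro: countable_finite r)
  have near: "cmod (conv k (X n) x - conv k (X n) (r j x)) \<le> 1 / real (Suc j)" for n j x
  proof -
    have "cmod (conv k (X n) x - conv k (X n) (r j x)) \<le> 1 / real (Suc j) * L2.nrm (X n)"
      by (rule cmod_conv_diff_le) (rule r)
    also have "\<dots> \<le> 1 / real (Suc j)" using X[of n] by (intro mult_left_le) auto
    finally show ?thesis .
  qed
  have "cmod (conv k (X n) x) \<le> norm k" for n x
    using cmod_conv_le[of k "X n" x] mult_left_le[OF X[of n] norm_ge_zero[of k]] by linarith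
  then have "\<exists>\<phi>. strict_mono (\<phi> :: nat \<Rightarrow> nat) \<and> (\<forall>x\<in>D. \<exists>l. (\<lambda>n. conv k (X (\<phi> n)) x) \<longlonglongrightarrow> l)"
    by (rule function_convergent_subsequence[OF D, of "\<lambda>n x. conv k (X n) x" "norm k"]) auto
  then obtain \<phi> where \<phi>: "strict_mono (\<phi> :: nat \<Rightarrow> nat)"
      "\<And>x. x \<in> D \<Longrightarrow> \<exists>l. (\<lambda>n. conv k (X (\<phi> n)) x) \<longlonglongrightarrow> l" by blast
  have "uniformly_Cauchy_on UNIV (\<lambda>n. apply_bcontfun (conv k (X (\<phi> n))))"
  proof (rule uniformly_Cauchy_onI)
    fix e :: real assume "0 < e"
    then obtain j where j: "1 / real (Suc j) < e / 4" using nat_approx_posE[of "e / 4"] by auto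
    define c where "c n x = conv k (X (\<phi> n)) x" for n x
    have "\<exists>M. \<forall>p\<ge>M. \<forall>n\<ge>M. dist (c p d) (c n d) < e / 4" if "d \<in> range (r j)" for d
    proof -
      have "Cauchy (\<lambda>n. c n d)" unfolding c_def using \<phi>(2)[of d] that
        by (auto simp: D_def Cauchy_convergent_iff convergent_def)
      then show ?thesis using \<open>0 < e\<close> unfolding Cauchy_def by (meson zero_less_divide_iff zero_less_numeral)
    qed
    then obtain M where M: "\<And>d p n. d \<in> range (r j) \<Longrightarrow> p \<ge> M d \<Longrightarrow> n \<ge> M d \<Longrightarrow> dist (c p d) (c n d) < e / 4"
      by metis
    define N where "N = Max (M ` range (r j))"
    have N: "M d \<le> N" if "d \<in> range (r j)" for d
      unfolding N_def using r(1)[of j] that by (intro Max_ge) auto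
    have "dist (c p x) (c n x) < e" if "p \<ge> N" "n \<ge> N" for p n x
    proof -
      have "dist (c p x) (c n x) \<le> dist (c p x) (c p (r j x)) + dist (c p (r j x)) (c n (r j x)) +
          dist (c n (r j x)) (c n x)"
        using dist_triangle[of "c p x" "c n x" "c p (r j x)"]
          dist_triangle[of "c p (r j x)" "c n x" "c n (r j x)"] by linarith
      moreover have "dist (c p (r j x)) (c n (r j x)) < e / 4"
        by (rule M) (use N[of "r j x"] that in \<open>auto intro: order_trans\<close>)
      moreover have near': "dist (c q x) (c q (r j x)) < e / 4" for q
        unfolding c_def dist_norm using near[of "\<phi> q" x j] j by linarith
      have "dist (c n (r j x)) (c n x) < e / 4" using near'[of n] by (simp only: dist_commute)
      ultimately show ?thesis using near'[of p] \<open>0 < e\<close> by linarith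
    qed
    then show "\<exists>M. \<forall>x\<in>UNIV. \<forall>p\<ge>M. \<forall>n\<ge>M. dist (conv k (X (\<phi> p)) x) (conv k (X (\<phi> n)) x) < e"
      unfolding c_def by blast
  qed
  from bcontfun_uniformly_Cauchy_convergent[OF this] show ?thesis using \<phi>(1) by blast
qed

lemma conv_symmetric:
  fixes k :: "'g \<Rightarrow>\<^sub>C complex"
  assumes k: "\<And>x. k (- x) = cnj (k x)"
  shows "ip2 (conv k u) v = ip2 u (conv k v)"
proof -
  have "ip2 (conv k u) v = (\<integral>x. (\<integral>y. (\<lambda>p. k (fst p - snd p) * u (snd p) * cnj (v (fst p))) (x, y) \<partial>m) \<partial>m)"
    unfolding ip2_def conv_apply by (simp flip: integral_mult_left_zero)
  also have "\<dots> = (\<integral>y. (\<integral>x. (\<lambda>p. k (fst p - snd p) * u (snd p) * cnj (v (fst p))) (x, y) \<partial>m) \<partial>m)"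
    by (rule integral_swap[symmetric]) (intro continuous_intros)
  also have "\<dots> = (\<integral>y. u y * cnj (\<integral>x. k (y - x) * v x \<partial>m) \<partial>m)"
  proof -
    have "(\<integral>x. k (x - y) * u y * cnj (v x) \<partial>m) = u y * cnj (\<integral>x. k (y - x) * v x \<partial>m)" for y
    proof -
      have "k (x - y) * u y * cnj (v x) = u y * cnj (k (y - x) * v x)" for x
        using k[of "y - x"] by simp
      then show ?thesis by (simp only: Bochner_Integration.integral_cnj integral_mult_right_zero)
    qed
    then show ?thesis by simp
  qed
  finally show ?thesis by (simp add: ip2_def conv_apply)
qed

section \<open>Translations and characters\<close>

definition shift :: "'g \<Rightarrow> ('g \<Rightarrow>\<^sub>C complex) \<Rightarrow> ('g \<Rightarrow>\<^sub>C complex)" where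
  "shift a u = Bcontfun (\<lambda>x. u (x + a))"

lemma shift_apply [simp]: "shift a u x = u (x + a)"
proof -
  have "continuous_on UNIV (\<lambda>x. u (x + a))" by (intro continuous_intros)
  from apply_Bcontfun[OF this] show ?thesis unfolding shift_def by simp
qed

text \<open>Hence the eigenspaces of convolutions are translation invariant.\<close>

lemma conv_shift: "conv k (shift a u) = shift a (conv k u)"
proof (rule bcontfun_eqI)
  fix x
  have "(\<integral>y. k (x + a - (y + a)) * u (y + a) \<partial>m) = (\<integral>y. k (x + a - y) * u y \<partial>m)"
    by (rule integral_translate[of "\<lambda>y. k (x + a - y) * u y"]) (intro continuous_intros)
  then show "conv k (shift a u) x = shift a (conv k u) x" by (simp add: conv_apply)
qed

lemma charactersD:
  fixes \<gamma> :: "'g \<Rightarrow> complex"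
  assumes "\<gamma> \<in> characters"
  shows "continuous_on UNIV \<gamma>" "cmod (\<gamma> x) = 1" "\<gamma> (x + y) = \<gamma> x * \<gamma> y" "\<gamma> 0 = 1"
    "\<gamma> (- x) = cnj (\<gamma> x)" "\<gamma> (x - y) = \<gamma> x * cnj (\<gamma> y)" "\<gamma> x * cnj (\<gamma> x) = 1"
proof -
  show c: "continuous_on UNIV \<gamma>" "cmod (\<gamma> x) = 1" "\<gamma> (x + y) = \<gamma> x * \<gamma> y" for x y
    using assms by (auto simp: characters_def)
  have "\<gamma> 0 * \<gamma> 0 = \<gamma> 0" using c(3)[of 0 0] by simp
  then show 0: "\<gamma> 0 = 1" using c(2)[of 0] by (metis mult_cancel_right1 norm_zero zero_neq_one)
  show unit: "\<gamma> x * cnj (\<gamma> x) = 1" for x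
    using c(2)[of x] by (simp add: complex_norm_square[symmetric])
  show neg: "\<gamma> (- x) = cnj (\<gamma> x)" for x
  proof -
    have "\<gamma> x * \<gamma> (- x) = \<gamma> x * cnj (\<gamma> x)" using c(3)[of x "- x"] by (simp add: 0 unit)
    then show ?thesis using c(2)[of x] by (metis mult_left_cancel norm_zero zero_neq_one)
  qed
  show "\<gamma> (x - y) = \<gamma> x * cnj (\<gamma> y)" using c(3)[of x "- y"] by (simp add: neg)
qed

text \<open>The substitution of \<open>x - y\<close> for \<open>y\<close> brings out the factor
  \<open>\<gamma> x\<close>: characters are eigenvectors of every convolution.\<close>

lemma integral_conv_character:
  fixes f :: "'g \<Rightarrow>\<^sub>C complex"
  assumes \<gamma>: "\<gamma> \<in> characters"
  shows "(\<integral>y. f (x - y) * \<gamma> y \<partial>m) = fourier_coeff m f \<gamma> * \<gamma> x"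
proof -
  have [continuous_intros]: "continuous_on S g \<Longrightarrow> continuous_on S (\<lambda>x. \<gamma> (g x))" for S :: "'g set" and g
    by (rule continuous_on_compose2[OF charactersD(1)[OF \<gamma>]]) auto
  have "(\<integral>y. f (x - y) * \<gamma> (x - (x - y)) \<partial>m) = (\<integral>y. f y * \<gamma> (x - y) \<partial>m)"
    by (rule integral_reflect[of "\<lambda>y. f y * \<gamma> (x - y)" x]) (intro continuous_intros)
  also have "\<dots> = (\<integral>y. cnj (\<gamma> y) * f y \<partial>m) * \<gamma> x"
    by (simp add: charactersD(6)[OF \<gamma>] ac_simps flip: integral_mult_left_zero)
  finally show ?thesis by (simp add: fourier_coeff_def)
qed

text \<open>The eigenvalue of the shift by \<open>a\<close> is \<open>u a / u 0\<close> and is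
  multiplicative in \<open>a\<close>. A shift does not increase the supremum norm, so the
  eigenvalues for \<open>a\<close> and \<open>- a\<close> have modulus at most \<open>1\<close>,
  while their product is \<open>1\<close>.\<close>

lemma invariant_function_character:
  fixes u :: "'g \<Rightarrow>\<^sub>C complex"
  assumes "u \<noteq> 0" and z: "\<And>a. \<exists>z. shift a u = z *\<^sub>C u"
  shows "u 0 \<noteq> 0" "(\<lambda>a. u a / u 0) \<in> characters"
proof -
  obtain ch where ch: "\<And>a. shift a u = ch a *\<^sub>C u" using z by metis
  have u: "u (x + a) = ch a * u x" for x a
    using arg_cong[OF ch[of a], of "\<lambda>v. apply_bcontfun v x"] by simp
  show u0: "u 0 \<noteq> 0"
  proof
    assume "u 0 = 0"
    then have "u a = 0" for a using u[of 0 a] by simp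
    then have "u = 0" by (intro bcontfun_eqI) simp
    then show False using assms(1) by simp
  qed
  have chu: "ch a = u a / u 0" for a using u[of 0 a] u0 by simp
  have ch0: "ch 0 = 1" using u0 by (simp add: chu)
  have mult: "ch (x + y) = ch x * ch y" for x y
    using u[of x y] u0 by (simp add: chu)
  have le: "cmod (ch a) \<le> 1" for a
  proof -
    have "norm (shift a u) \<le> norm u" by (rule norm_bound) (simp add: norm_bounded)
    then show ?thesis using assms(1) by (simp add: ch norm_scaleC)
  qed
  have "cmod (ch a) = 1" for a
  proof -
    have "cmod (ch a) * cmod (ch (- a)) = 1"
      using mult[of a "- a"] ch0 by (metis add.right_inverse norm_mult norm_one)
    moreover have "cmod (ch a) * cmod (ch (- a)) \<le> cmod (ch a) * 1"
      by (intro mult_left_mono le) simp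
    ultimately show ?thesis using le[of a] by simp
  qed
  moreover have "continuous_on UNIV ch"
    unfolding chu[abs_def] using u0 by (intro continuous_intros) auto
  ultimately have "ch \<in> characters" using mult by (simp add: characters_def)
  then show "(\<lambda>a. u a / u 0) \<in> characters" by (simp add: chu[abs_def])
qed

text \<open>Convolution with a hermitian kernel is symmetric but may have negative eigenvalues; the
  form of its square at \<open>u\<close> is the squared \<open>L_2\<close> norm of
  \<open>conv k u\<close>. The inner convolution supplies a uniformly convergent subsequence, and
  the outer one preserves convergence.\<close>

lemma compact_positive_conv:
  fixes k :: "'g \<Rightarrow>\<^sub>C complex"
  assumes k: "\<And>x. k (- x) = cnj (k x)"
  shows "compact_positive ip2 (\<lambda>u. conv k (conv k u))"
proof (unfold_locales)
  show "conv k (conv k (u + v)) = conv k (conv k u) + conv k (conv k v)" for u v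
    by (simp add: conv_add)
  show "conv k (conv k (c *\<^sub>C u)) = c *\<^sub>C conv k (conv k u)" for c u by (simp add: conv_scale)
  show "ip2 (conv k (conv k u)) v = ip2 u (conv k (conv k v))" for u v
    by (simp add: conv_symmetric[OF k])
  show "0 \<le> Re (ip2 (conv k (conv k u)) u)" for u
    unfolding conv_symmetric[OF k, of "conv k u" u] by (rule L2.ip_nonneg)
  fix X :: "nat \<Rightarrow> 'g \<Rightarrow>\<^sub>C complex" assume "\<And>n. L2.nrm (X n) \<le> 1"
  then obtain l \<phi> where \<phi>: "strict_mono (\<phi> :: nat \<Rightarrow> nat)" "(\<lambda>n. conv k (X (\<phi> n))) \<longlonglongrightarrow> l"
    using conv_compact by blast
  have "(\<lambda>n. norm k * norm (conv k (X (\<phi> n)) - l)) \<longlonglongrightarrow> norm k * 0"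
    using \<phi>(2) by (intro tendsto_mult tendsto_const) (simp add: tendsto_norm_zero_iff LIM_zero_iff)
  then have lim: "(\<lambda>n. norm k * norm (conv k (X (\<phi> n)) - l)) \<longlonglongrightarrow> 0" by simp
  have "L2.nrm (conv k (conv k (X (\<phi> n))) - conv k l) \<le> norm k * norm (conv k (X (\<phi> n)) - l)" for n
  proof -
    have "L2.nrm (conv k (conv k (X (\<phi> n)) - l)) \<le> norm (conv k (conv k (X (\<phi> n)) - l))"
      by (rule L2_nrm_le_norm)
    also have "\<dots> \<le> norm k * L2.nrm (conv k (X (\<phi> n)) - l)" by (rule norm_conv_le)
    also have "\<dots> \<le> norm k * norm (conv k (X (\<phi> n)) - l)"
      by (intro mult_left_mono L2_nrm_le_norm) simp
    finally show ?thesis by (simp add: conv_diff)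
  qed
  then have "(\<lambda>n. L2.nrm (conv k (conv k (X (\<phi> n))) - conv k l)) \<longlonglongrightarrow> 0"
    by (intro Lim_null_comparison[OF _ lim] always_eventually allI) simp
  then show "\<exists>l \<phi>. strict_mono (\<phi> :: nat \<Rightarrow> nat) \<and> (\<lambda>n. L2.nrm (conv k (conv k (X (\<phi> n))) - l)) \<longlonglongrightarrow> 0"
    using \<phi>(1) by blast
qed

theorem hermitian_nonzero_coefficient:
  fixes k :: "'g \<Rightarrow>\<^sub>C complex"
  assumes k: "\<And>x. k (- x) = cnj (k x)" and "k \<noteq> 0"
  shows "\<exists>\<gamma>\<in>characters. fourier_coeff m k \<gamma> \<noteq> 0"
proof -
  let ?W = "\<lambda>u. conv k (conv k u)"
  interpret W: compact_positive ip2 ?W by (rule compact_positive_conv[OF k])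
  obtain w l where es: "W.eigensystem w l" using W.eigensystem_exists by blast
  \<comment> \<open>Otherwise \<open>conv k k = 0\<close>, whose value at \<open>0\<close> is
    \<open>ip2 k k\<close> because \<open>k\<close> is hermitian.\<close>
  have pos: "0 < l 0"
  proof (rule ccontr)
    assume "\<not> 0 < l 0"
    then have "Re (ip2 (?W k) k) \<le> 0"
      using W.eigensystemD(7)[OF es, of 0 k] W.eigensystemD(4)[OF es, of 0] by simp
    then have "(L2.nrm (conv k k))\<^sup>2 \<le> 0"
      unfolding L2.nrm_sq conv_symmetric[OF k, of "conv k k" k] .
    then have "conv k k = 0" by simp
    then have "conv k k 0 = 0" by simp
    then have "ip2 k k = 0" by (simp add: conv_apply k ip2_def mult.commute)
    then show False using \<open>k \<noteq> 0\<close> L2.ip_definite by blast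
  qed
  define E where "E = {u. ?W u = of_real (l 0) *\<^sub>C u}"
  have sub: "cvec.subspace E"
    unfolding E_def cvec.subspace_def
    by (auto simp: W.W_add W.W_scale scaleC_add_right scaleC_scaleC mult.commute simp del: W.W_zero)
      (rule W.W_zero)
  have fin: "finite (w ` {k. l k = l 0})"
    by (intro finite_imageI finite_subset[OF _ W.finite_eigenvalue_indices[OF es pos]]) auto
  have span: "E \<subseteq> cvec.span (w ` {k. l k = l 0})"
    unfolding E_def by (rule W.eigenspace_span[OF es pos])
  have w0: "w 0 \<noteq> 0" "w 0 \<in> E"
    using W.eigensystemD(1,3)[OF es, of 0] pos by (auto simp: E_def)
  have "\<exists>u. u \<in> E \<and> u \<noteq> 0 \<and> (\<forall>a. \<exists>z. shift a u = z *\<^sub>C u)"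
  proof (rule commuting_common_eigenvector[OF _ _ _ sub fin span _ w0(2,1)])
    show "shift a (x + y) = shift a x + shift a y" for a x y
      by (rule bcontfun_eqI) (simp add: plus_bcontfun.rep_eq)
    show sc: "shift a (c *\<^sub>C x) = c *\<^sub>C shift a x" for a c x by (rule bcontfun_eqI) simp
    show "shift a (shift b x) = shift b (shift a x)" for a b x
      by (rule bcontfun_eqI) (simp add: ac_simps)
    show "shift a x \<in> E" if "x \<in> E" for a x
      using that by (simp add: E_def conv_shift sc)
  qed
  then obtain u where u: "u \<in> E" "u \<noteq> 0" "\<And>a. \<exists>z. shift a u = z *\<^sub>C u" by blast
  define \<gamma> where "\<gamma> = (\<lambda>a. u a / u 0)"
  have u0: "u 0 \<noteq> 0" and \<gamma>: "\<gamma> \<in> characters"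
    unfolding \<gamma>_def using invariant_function_character[OF u(2,3)] by auto
  have ux: "u x = u 0 * \<gamma> x" for x using u0 by (simp add: \<gamma>_def)
  have "conv k u x = fourier_coeff m k \<gamma> * u x" for x
  proof -
    have "k (x - y) * u y = u 0 * (k (x - y) * \<gamma> y)" for y
      by (subst ux) (simp only: ac_simps)
    then have "conv k u x = u 0 * (fourier_coeff m k \<gamma> * \<gamma> x)"
      by (simp only: conv_apply integral_mult_right_zero integral_conv_character[OF \<gamma>])
    also have "\<dots> = fourier_coeff m k \<gamma> * u x" by (subst (2) ux) (simp only: ac_simps)
    finally show ?thesis .
  qed
  then have cu: "conv k u = fourier_coeff m k \<gamma> *\<^sub>C u" by (intro bcontfun_eqI) simp
  \<comment> \<open>\<open>u\<close> is an eigenvector of \<open>conv k\<close> for this coefficient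
    and of its square for \<open>l 0 > 0\<close>.\<close>
  have "fourier_coeff m k \<gamma> \<noteq> 0"
  proof
    assume "fourier_coeff m k \<gamma> = 0"
    then have "conv k u = 0" by (simp add: cu)
    then have "?W u = 0" using W.W_zero by (simp add: conv_scale[of k 0 0, simplified])
    then show False using u pos by (simp add: E_def)
  qed
  then show ?thesis using \<gamma> by blast
qed

text \<open>The reflected conjugate \<open>g\<close> of \<open>f\<close> has the conjugate
  coefficients, and the combinations \<open>f + g\<close> and \<open>\<i> (f - g)\<close> are
  hermitian, so the previous theorem makes both vanish.\<close>

theorem fourier_uniqueness:
  fixes f :: "'g \<Rightarrow>\<^sub>C complex"
  assumes 0: "\<And>\<gamma>. \<gamma> \<in> characters \<Longrightarrow> fourier_coeff m f \<gamma> = 0"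
  shows "f = 0"
proof -
  define g where "g = Bcontfun (\<lambda>x. cnj (apply_bcontfun f (- x)))"
  have g: "g x = cnj (f (- x))" for x
  proof -
    have "continuous_on UNIV (\<lambda>x. cnj (f (- x)))" by (intro continuous_intros)
    from apply_Bcontfun[OF this] show ?thesis unfolding g_def by simp
  qed
  have g0: "fourier_coeff m g \<gamma> = 0" if \<gamma>: "\<gamma> \<in> characters" for \<gamma>
  proof -
    have [continuous_intros]: "continuous_on S h \<Longrightarrow> continuous_on S (\<lambda>x. \<gamma> (h x))" for S :: "'g set" and h
      by (rule continuous_on_compose2[OF charactersD(1)[OF \<gamma>]]) auto
    have "fourier_coeff m g \<gamma> = (\<integral>h. \<gamma> (0 - h) * cnj (f (0 - h)) \<partial>m)"
      by (simp add: fourier_coeff_def g charactersD(5)[OF \<gamma>])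
    also have "\<dots> = (\<integral>h. \<gamma> h * cnj (f h) \<partial>m)"
      by (rule integral_reflect[of "\<lambda>h. \<gamma> h * cnj (f h)" 0]) (intro continuous_intros)
    also have "\<dots> = cnj (fourier_coeff m f \<gamma>)"
      by (simp add: fourier_coeff_def flip: Bochner_Integration.integral_cnj)
    finally show ?thesis using 0[OF \<gamma>] by simp
  qed
  have lin: "fourier_coeff m (a *\<^sub>C f + b *\<^sub>C g) \<gamma> = 0" if \<gamma>: "\<gamma> \<in> characters" for a b \<gamma>
  proof -
    have int: "integrable m (\<lambda>x. cnj (\<gamma> x) * apply_bcontfun v x)" for v
      by (intro integrable_continuous continuous_intros charactersD(1)[OF \<gamma>])
    have "fourier_coeff m (a *\<^sub>C f + b *\<^sub>C g) \<gamma> = a * fourier_coeff m f \<gamma> + b * fourier_coeff m g \<gamma>"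
      unfolding fourier_coeff_def plus_bcontfun.rep_eq
      by (simp add: distrib_left mult.left_commute int)
    then show ?thesis using 0[OF \<gamma>] g0[OF \<gamma>] by simp
  qed
  have van: "a *\<^sub>C f + b *\<^sub>C g = 0"
    if h: "\<And>x. apply_bcontfun (a *\<^sub>C f + b *\<^sub>C g) (- x) = cnj (apply_bcontfun (a *\<^sub>C f + b *\<^sub>C g) x)" for a b
  proof (rule ccontr)
    assume "\<not> ?thesis"
    from hermitian_nonzero_coefficient[OF h this] lin show False by blast
  qed
  have "1 *\<^sub>C f + 1 *\<^sub>C g = 0"
    by (rule van) (simp add: plus_bcontfun.rep_eq g)
  moreover have "\<i> *\<^sub>C f + (- \<i>) *\<^sub>C g = 0"
    by (rule van) (simp add: plus_bcontfun.rep_eq g)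
  ultimately have "apply_bcontfun (1 *\<^sub>C f + 1 *\<^sub>C g) x = 0" "apply_bcontfun (\<i> *\<^sub>C f + (- \<i>) *\<^sub>C g) x = 0" for x
    by simp_all
  then have "f x + g x = 0" "f x - g x = 0" for x
    by (simp_all add: plus_bcontfun.rep_eq flip: right_diff_distrib)
  then have "f x = 0" for x by (metis add_diff_cancel diff_add_cancel eq_iff_diff_eq_0 mult_2 mult_eq_0_iff zero_neq_numeral)
  then show ?thesis by (intro bcontfun_eqI) simp
qed

end

section \<open>Diagonal operators\<close>

lemma ell2_nth_Abs: "(\<lambda>i. (cmod (v i))\<^sup>2) summable_on UNIV \<Longrightarrow> ell2_nth (Abs_ell2 v) = v"
  by (rule Abs_ell2_inverse) simp

lemma ell2_comparison:
  assumes "\<And>i. cmod (v i) \<le> D * cmod (ell2_nth y i)"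
  shows "(\<lambda>i. (cmod (v i))\<^sup>2) summable_on UNIV"
proof (rule summable_on_comparison_test)
  show "(\<lambda>i. D\<^sup>2 * (cmod (ell2_nth y i))\<^sup>2) summable_on UNIV"
    by (intro summable_on_cmult_right ell2_sq_summable)
  show "(cmod (v i))\<^sup>2 \<le> D\<^sup>2 * (cmod (ell2_nth y i))\<^sup>2" for i
    using power_mono[OF assms, of i 2] by (simp add: power_mult_distrib)
qed simp

lemma norm_ell2_le:
  assumes "\<And>i. cmod (ell2_nth x i) \<le> D * cmod (ell2_nth y i)" "0 \<le> D"
  shows "norm x \<le> D * norm y"
proof (rule power2_le_imp_le)
  have "(norm x)\<^sup>2 \<le> (\<Sum>\<^sub>\<infinity>i. D\<^sup>2 * (cmod (ell2_nth y i))\<^sup>2)"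
    unfolding norm_ell2_sq
    using power_mono[OF assms(1), of _ 2]
    by (intro infsum_mono summable_on_cmult_right ell2_sq_summable) (auto simp: power_mult_distrib)
  also have "\<dots> = (D * norm y)\<^sup>2"
    by (simp add: infsum_cmult_right' norm_ell2_sq power_mult_distrib)
  finally show "(norm x)\<^sup>2 \<le> (D * norm y)\<^sup>2" .
qed (use assms in simp)

lemma has_sum_finite_sum:
  fixes f :: "'n \<Rightarrow> 'i \<Rightarrow> real"
  assumes "\<And>n. n \<in> I \<Longrightarrow> (f n has_sum S n) A"
  shows "((\<lambda>i. \<Sum>n\<in>I. f n i) has_sum (\<Sum>n\<in>I. S n)) A"
  using assms by (induction I rule: infinite_finite_induct) (auto intro: has_sum_add)

definition unit_ell2 :: "'i \<Rightarrow> 'i ell2" where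
  "unit_ell2 i = Abs_ell2 (\<lambda>j. if j = i then 1 else 0)"

lemma unit_ell2_nth [simp]: "ell2_nth (unit_ell2 i) j = (if j = i then 1 else 0)"
proof -
  have "(\<lambda>j. (cmod (if j = i then 1 else 0))\<^sup>2) summable_on UNIV \<longleftrightarrow>
      (\<lambda>j. (cmod (if j = i then 1 else 0))\<^sup>2) summable_on {i}"
    by (rule summable_on_cong_neutral) auto
  then show ?thesis unfolding unit_ell2_def by (subst ell2_nth_Abs) simp_all
qed

lemma norm_unit_ell2 [simp]: "norm (unit_ell2 i) = 1"
proof -
  have "(norm (unit_ell2 i))\<^sup>2 = (\<Sum>\<^sub>\<infinity>j\<in>{i}. (cmod (ell2_nth (unit_ell2 i) j))\<^sup>2)"
    unfolding norm_ell2_sq by (rule infsum_cong_neutral) auto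
  then have "(norm (unit_ell2 i))\<^sup>2 = 1\<^sup>2" by simp
  then show ?thesis by (rule power2_eq_imp_eq) auto
qed

lemma cinner_unit_ell2: "cinner (unit_ell2 i) x = cnj (ell2_nth x i)"
proof -
  have "cinner (unit_ell2 i) x = (\<Sum>\<^sub>\<infinity>j\<in>{i}. ell2_nth (unit_ell2 i) j * cnj (ell2_nth x j))"
    unfolding cinner_ell2_def cinner_ell2_aux.rep_eq by (rule infsum_cong_neutral) auto
  then show ?thesis by simp
qed

lemma ell2_nth_sum: "ell2_nth (\<Sum>i\<in>I. x i) j = (\<Sum>i\<in>I. ell2_nth (x i) j)"
  by (induction I rule: infinite_finite_induct) auto

text \<open>Real entries suffice, because the phases of the Fourier coefficients are absorbed into
  another factor; \<open>diag d\<close> is then its own adjoint.\<close>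

definition diag :: "('i \<Rightarrow> real) \<Rightarrow> 'i ell2 \<Rightarrow> 'i ell2" where
  "diag d x = Abs_ell2 (\<lambda>i. of_real (d i) * ell2_nth x i)"

context
  fixes d :: "'i \<Rightarrow> real" and D :: real
  assumes d: "\<And>i. 0 \<le> d i" "\<And>i. d i \<le> D"
begin

lemma diag_nth: "ell2_nth (diag d x) i = of_real (d i) * ell2_nth x i"
proof -
  have "(\<lambda>i. (cmod (of_real (d i) * ell2_nth x i))\<^sup>2) summable_on UNIV"
    by (rule ell2_comparison[where D = D and y = x]) (use d in \<open>simp add: norm_mult mult_right_mono\<close>)
  then show ?thesis unfolding diag_def by (simp add: ell2_nth_Abs)
qed

lemma bounded_clinear_diag: "bounded_clinear (diag d)"
proof (rule bounded_clinearI[where K = D])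
  show "norm (diag d x) \<le> D * norm x" for x
    by (rule norm_ell2_le)
      (use d order_trans[OF d(1) d(2)] in \<open>auto simp: diag_nth norm_mult mult_right_mono\<close>)
qed (auto intro!: ell2_eqI simp: diag_nth algebra_simps)

lemma cadjoint_diag: "cadjoint (diag d) = diag d"
proof (intro ext cinner_ext)
  fix x y :: "'i ell2"
  show "cinner x (cadjoint (diag d) y) = cinner x (diag d y)"
    unfolding cadjoint[OF bounded_clinear_diag, symmetric]
    unfolding cinner_ell2_def cinner_ell2_aux.rep_eq by (simp add: diag_nth ac_simps)
qed

lemma compact_finite_combinations:
  assumes "finite I"
  shows "compact {\<Sum>i\<in>I. z i *\<^sub>C unit_ell2 i | z :: 'i \<Rightarrow> complex. \<forall>i\<in>I. cmod (z i) \<le> D}"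
  using assms
proof (induction I rule: finite_induct)
  case empty
  then show ?case by simp
next
  case (insert j I)
  let ?C = "\<lambda>I. {\<Sum>i\<in>I. z i *\<^sub>C unit_ell2 i | z :: 'i \<Rightarrow> complex. \<forall>i\<in>I. cmod (z i) \<le> D}"
  have "?C (insert j I) = (\<lambda>(a, x). a *\<^sub>C unit_ell2 j + x) ` (cball 0 D \<times> ?C I)"
  proof (intro equalityI subsetI)
    fix x assume "x \<in> ?C (insert j I)"
    then obtain z where z: "x = (\<Sum>i\<in>insert j I. z i *\<^sub>C unit_ell2 i)" "\<forall>i\<in>insert j I. cmod (z i) \<le> D"
      by auto
    then show "x \<in> (\<lambda>(a, x). a *\<^sub>C unit_ell2 j + x) ` (cball 0 D \<times> ?C I)"
      using insert by (intro image_eqI[where x = "(z j, \<Sum>i\<in>I. z i *\<^sub>C unit_ell2 i)"]) auto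
  next
    fix x assume "x \<in> (\<lambda>(a, x). a *\<^sub>C unit_ell2 j + x) ` (cball 0 D \<times> ?C I)"
    then obtain a z where z: "x = a *\<^sub>C unit_ell2 j + (\<Sum>i\<in>I. z i *\<^sub>C unit_ell2 i)"
        "cmod a \<le> D" "\<forall>i\<in>I. cmod (z i) \<le> D" by auto
    have "(\<Sum>i\<in>insert j I. (z(j := a)) i *\<^sub>C unit_ell2 i) = x"
    proof -
      have "(\<Sum>i\<in>I. (z(j := a)) i *\<^sub>C unit_ell2 i) = (\<Sum>i\<in>I. z i *\<^sub>C unit_ell2 i)"
        using insert by (intro sum.cong) auto
      then show ?thesis using insert z by simp
    qed
    then show "x \<in> ?C (insert j I)"
      using z by (intro CollectI exI[of _ "z(j := a)"]) auto
  qed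
  moreover have "continuous_on S (\<lambda>(a, x). a *\<^sub>C unit_ell2 j + x)" for S :: "(complex \<times> 'i ell2) set"
    unfolding case_prod_beta' by (intro continuous_intros bounded_linear.continuous_on[OF bounded_linear_scaleC_left])
  ultimately show ?case
    using insert.IH by (simp only:) (intro compact_continuous_image compact_Times compact_cball)
qed

text \<open>Off the finite set \<open>I\<close> the operator has norm at most \<open>e / 4\<close>;
  on \<open>I\<close> it maps the ball into a compact set, covered with radius \<open>e / 2\<close>.
  The total \<open>3 * e / 4\<close> leaves room for the closure.\<close>

lemma compact_operator_diag:
  assumes fin: "\<And>e. 0 < e \<Longrightarrow> finite {i. e \<le> d i}"
  shows "compact_operator (diag d)"
proof -
  let ?C = "\<lambda>I. {\<Sum>i\<in>I. z i *\<^sub>C unit_ell2 i | z :: 'i \<Rightarrow> complex. \<forall>i\<in>I. cmod (z i) \<le> D}"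
  have D0: "0 \<le> D" using order_trans[OF d(1) d(2)] .
  have "\<exists>k. finite k \<and> closure (diag d ` cball 0 1) \<subseteq> (\<Union>x\<in>k. ball x e)" if "0 < e" for e
  proof -
    define I where "I = {i. e / 4 \<le> d i}"
    have finI: "finite I" unfolding I_def by (rule fin) (use that in simp)
    have "0 < e / 2" using that by simp
    from conjunct2[OF compact_finite_combinations[OF finI, unfolded compact_eq_totally_bounded],
        rule_format, OF this]
    obtain k where k: "finite k" "?C I \<subseteq> (\<Union>x\<in>k. ball x (e/2))" by blast
    have "diag d ` cball 0 1 \<subseteq> (\<Union>x\<in>k. cball x (3 * e / 4))"
    proof (rule image_subsetI)
      fix x :: "'i ell2" assume "x \<in> cball 0 1"
      then have x: "norm x \<le> 1" by simp
      define y where "y = (\<Sum>i\<in>I. (of_real (d i) * ell2_nth x i) *\<^sub>C unit_ell2 i)"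
      have "d i * cmod (ell2_nth x i) \<le> D * 1" for i
        using d ell2_nth_le_norm[of x i] x D0 by (intro mult_mono) (auto intro: order_trans)
      then have "y \<in> ?C I" unfolding y_def
        using d(1) by (intro CollectI exI[of _ "\<lambda>i. of_real (d i) * ell2_nth x i"]) (auto simp: norm_mult)
      then obtain c where c: "c \<in> k" "dist c y < e / 2" using k(2) by auto
      have y_nth: "ell2_nth y i = (if i \<in> I then of_real (d i) * ell2_nth x i else 0)" for i
        unfolding y_def ell2_nth_sum using finI by (simp add: if_distrib[of "\<lambda>t. _ * t"] cong: if_cong)
      have "norm (diag d x - y) \<le> e / 4 * norm x"
      proof (rule norm_ell2_le)
        fix i
        show "cmod (ell2_nth (diag d x - y) i) \<le> e / 4 * cmod (ell2_nth x i)"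
        proof (cases "i \<in> I")
          case False
          then have "d i * cmod (ell2_nth x i) \<le> e / 4 * cmod (ell2_nth x i)"
            by (intro mult_right_mono) (auto simp: I_def)
          then show ?thesis using False d(1)[of i] by (simp add: diag_nth y_nth norm_mult)
        qed (use that in \<open>simp add: diag_nth y_nth\<close>)
      qed (use that in simp)
      also have "\<dots> \<le> e / 4" using x that by (intro mult_left_le) auto
      finally have "dist y (diag d x) \<le> e / 4" by (simp add: dist_norm norm_minus_commute)
      then have "dist c (diag d x) \<le> 3 * e / 4"
        using c(2) dist_triangle[of c "diag d x" y] by linarith
      then show "diag d x \<in> (\<Union>x\<in>k. cball x (3 * e / 4))" using c(1) by auto
    qed
    then have "closure (diag d ` cball 0 1) \<subseteq> (\<Union>x\<in>k. cball x (3 * e / 4))"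
      by (rule closure_minimal) (intro closed_UN k(1) ballI closed_cball)
    also have "\<dots> \<subseteq> (\<Union>x\<in>k. ball x e)" using that by (intro UN_mono) auto
    finally show ?thesis using k(1) by blast
  qed
  then have "compact (closure (diag d ` cball 0 1))"
    unfolding compact_eq_totally_bounded by (auto simp: complete_eq_closed)
  then show ?thesis by (simp add: compact_operator_def bounded_clinear_diag)
qed

text \<open>The index set may be uncountable, so the entries are not sorted into a sequence.
  Instead, each eigenvector \<open>w n\<close> is supported where \<open>d i = \<sigma> n\<close>,
  which spreads \<open>\<sigma> n powr r\<close> over the coordinates, weighted by the squared
  moduli of the entries of \<open>w n\<close>. At each coordinate the weights sum to at most
  \<open>1\<close> over \<open>n\<close>, by Bessel.\<close>

lemma diag_schatten:
  assumes r: "0 < r" and sum: "(\<lambda>i. d i powr r) summable_on UNIV"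
  shows "diag d \<in> schatten_class (ereal r)"
proof -
  have fin: "finite {i. e \<le> d i}" if "0 < e" for e
  proof (rule ccontr)
    assume inf: "infinite {i. e \<le> d i}"
    define S where "S = (\<Sum>\<^sub>\<infinity>i. d i powr r)"
    obtain n where n: "S / e powr r < real n" using reals_Archimedean2 by blast
    obtain F where F: "F \<subseteq> {i. e \<le> d i}" "finite F" "card F = n"
      using infinite_arbitrarily_large[OF inf] by blast
    have "real n * e powr r = (\<Sum>i\<in>F. e powr r)" using F by simp
    also have "\<dots> \<le> (\<Sum>i\<in>F. d i powr r)"
      using F that r by (intro sum_mono powr_mono2) auto
    also have "\<dots> \<le> S" unfolding S_def by (rule finite_sum_le_infsum) (use F sum in auto)
    finally show False using n that by (simp add: pos_divide_less_eq)
  qed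
  have comp: "compact_operator (diag d)" by (rule compact_operator_diag[OF fin])
  obtain w \<sigma> where sing: "is_singular_numbers (diag d) \<sigma>"
    and w: "\<And>n. cadjoint (diag d) (diag d (w n)) = of_real ((\<sigma> n)\<^sup>2) *\<^sub>C w n"
    "\<And>m n. m \<noteq> n \<Longrightarrow> cinner (w m) (w n) = 0" "\<And>n. norm (w n) = 1 \<or> w n = 0 \<and> \<sigma> n = 0"
    by (rule singular_numbers_exist[OF comp]) blast
  have \<sigma>0: "0 \<le> \<sigma> n" for n using sing by (simp add: is_singular_numbers_def)
  have eq: "\<sigma> n powr r * (cmod (ell2_nth (w n) i))\<^sup>2 = d i powr r * (cmod (ell2_nth (w n) i))\<^sup>2" for n i
  proof (cases "ell2_nth (w n) i = 0")
    case False
    have "of_real ((d i)\<^sup>2) * ell2_nth (w n) i = of_real ((\<sigma> n)\<^sup>2) * ell2_nth (w n) i"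
      using arg_cong[OF w(1)[of n, unfolded cadjoint_diag], of "\<lambda>v. ell2_nth v i"]
      by (simp add: diag_nth power2_eq_square mult.assoc)
    then have "(d i)\<^sup>2 = (\<sigma> n)\<^sup>2" using False by (simp del: of_real_power)
    then have "d i = \<sigma> n" using d(1) \<sigma>0 by (simp add: power2_eq_iff_nonneg)
    then show ?thesis by simp
  qed simp
  have s1: "(\<lambda>i. d i powr r * (cmod (ell2_nth (w n) i))\<^sup>2) summable_on UNIV" for n
    unfolding eq[symmetric] by (intro summable_on_cmult_right ell2_sq_summable)
  have s: "((\<lambda>i. d i powr r * (cmod (ell2_nth (w n) i))\<^sup>2) has_sum (\<sigma> n powr r)) UNIV" for n
  proof -
    have "(\<Sum>\<^sub>\<infinity>i. d i powr r * (cmod (ell2_nth (w n) i))\<^sup>2) = \<sigma> n powr r * (norm (w n))\<^sup>2"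
      unfolding eq[symmetric] norm_ell2_sq by (simp add: infsum_cmult_right')
    then show ?thesis using w(3)[of n] has_sum_infsum[OF s1[of n]] by auto
  qed
  have "summable (\<lambda>n. \<sigma> n powr r)"
  proof (rule bounded_imp_summable)
    fix N
    show "(\<Sum>n\<le>N. \<sigma> n powr r) \<le> (\<Sum>\<^sub>\<infinity>i. d i powr r)"
    proof (rule has_sum_mono[OF has_sum_finite_sum[OF s] has_sum_infsum[OF sum]])
      fix i
      have "(\<Sum>n\<le>N. (cmod (cinner (unit_ell2 i) (w n)))\<^sup>2) \<le> (norm (unit_ell2 i))\<^sup>2"
        by (rule hil.Bessel) (use w(2,3) in \<open>auto intro: order_eq_refl\<close>, metis norm_zero order_refl zero_le_one)
      then have "(\<Sum>n\<le>N. (cmod (ell2_nth (w n) i))\<^sup>2) \<le> 1" by (simp add: cinner_unit_ell2)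
      then show "(\<Sum>n\<le>N. d i powr r * (cmod (ell2_nth (w n) i))\<^sup>2) \<le> d i powr r"
        by (simp add: mult_left_le flip: sum_distrib_left)
    qed
  qed simp
  then show ?thesis using comp sing by (auto simp: schatten_class_def)
qed

end

section \<open>Absolutely convergent Fourier series\<close>

lemma bcontfun_has_sum:
  fixes u :: "'i \<Rightarrow> 'a::topological_space \<Rightarrow>\<^sub>C complex"
  assumes "\<And>i. i \<in> A \<Longrightarrow> norm (u i) \<le> M i" "M summable_on A"
  shows "(u has_sum infsum u A) A"
proof -
  have "uniform_limit UNIV (\<lambda>I x. \<Sum>i\<in>I. u i x) (\<lambda>x. \<Sum>\<^sub>\<infinity>i\<in>A. u i x) (finite_subsets_at_top A)"
    by (rule Weierstrass_m_test_general[OF _ assms(2)]) (use assms(1) norm_bounded order_trans in blast)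
  moreover have "(\<lambda>x. \<Sum>i\<in>I. u i x) = apply_bcontfun (\<Sum>i\<in>I. u i)" for I
    by (induction I rule: infinite_finite_induct) (auto simp: plus_bcontfun.rep_eq fun_eq_iff)
  ultimately have "uniform_limit UNIV (\<lambda>I. apply_bcontfun (\<Sum>i\<in>I. u i)) (\<lambda>x. \<Sum>\<^sub>\<infinity>i\<in>A. u i x)
      (finite_subsets_at_top A)" by simp
  then obtain F where "((\<lambda>I. \<Sum>i\<in>I. u i) \<longlongrightarrow> F) (finite_subsets_at_top A)"
    by (rule uniform_limit_bcontfunE) auto
  then have "(u has_sum F) A" by (simp add: has_sum_def)
  then show ?thesis by (simp add: infsumI)
qed

lemma bounded_linear_apply_bcontfun: "bounded_linear (\<lambda>u :: 'a::topological_space \<Rightarrow>\<^sub>C complex. u x)"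
  by (rule bounded_linear_intro[where K = 1])
    (auto simp: plus_bcontfun.rep_eq scaleR_bcontfun.rep_eq norm_bounded)

lemma cinner_ell2_has_sum: "((\<lambda>i. ell2_nth x i * cnj (ell2_nth y i)) has_sum cinner x y) UNIV"
  unfolding cinner_ell2_def cinner_ell2_aux.rep_eq by (rule has_sum_infsum[OF ell2_prod_summable])

context haar
begin

definition char_fun :: "('g \<Rightarrow> complex) \<Rightarrow> ('g \<Rightarrow>\<^sub>C complex)" where
  "char_fun \<gamma> = Bcontfun \<gamma>"

lemma char_fun_apply: "\<gamma> \<in> characters \<Longrightarrow> apply_bcontfun (char_fun \<gamma>) = \<gamma>"
  unfolding char_fun_def by (rule apply_Bcontfun) (rule charactersD)

lemma cnj_character: "\<gamma> \<in> characters \<Longrightarrow> (\<lambda>x. cnj (\<gamma> x)) \<in> characters"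
  by (auto simp: characters_def intro: continuous_intros)

lemma norm_char_fun: "\<gamma> \<in> characters \<Longrightarrow> norm (char_fun \<gamma>) \<le> 1"
  by (rule norm_bound) (simp add: char_fun_apply charactersD)

text \<open>For distinct characters, translation by a point where they differ multiplies the
  integral by a factor other than \<open>1\<close>.\<close>

lemma character_orthogonality:
  assumes \<gamma>: "\<gamma> \<in> characters" and \<delta>: "\<delta> \<in> characters"
  shows "(\<integral>x. cnj (\<delta> x) * \<gamma> x \<partial>m) = (if \<gamma> = \<delta> then 1 else 0)"
proof (cases "\<gamma> = \<delta>")
  case True
  then have "cnj (\<delta> x) * \<gamma> x = 1" for x using charactersD(7)[OF \<gamma>, of x] by (simp add: mult.commute)
  then show ?thesis using True by simp
next
  case False
  then obtain a where a: "\<gamma> a \<noteq> \<delta> a" by auto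
  define I where "I = (\<integral>x. cnj (\<delta> x) * \<gamma> x \<partial>m)"
  have "I = (\<integral>x. cnj (\<delta> (x + a)) * \<gamma> (x + a) \<partial>m)"
    unfolding I_def
    by (rule integral_translate[symmetric, of "\<lambda>x. cnj (\<delta> x) * \<gamma> x"])
      (intro continuous_intros charactersD(1) \<gamma> \<delta>)
  also have "\<dots> = (\<integral>x. (cnj (\<delta> a) * \<gamma> a) * (cnj (\<delta> x) * \<gamma> x) \<partial>m)"
    by (simp add: charactersD(3)[OF \<gamma>] charactersD(3)[OF \<delta>] ac_simps)
  also have "\<dots> = (cnj (\<delta> a) * \<gamma> a) * I" unfolding I_def by (rule integral_mult_right_zero)
  finally have "I = (cnj (\<delta> a) * \<gamma> a) * I" .
  moreover have "cnj (\<delta> a) * \<gamma> a \<noteq> 1"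
  proof
    assume *: "cnj (\<delta> a) * \<gamma> a = 1"
    have "\<gamma> a = (\<delta> a * cnj (\<delta> a)) * \<gamma> a" by (simp add: charactersD(7)[OF \<delta>])
    also have "\<dots> = \<delta> a" using * by (simp add: mult.assoc)
    finally show False using a by simp
  qed
  ultimately show ?thesis using False unfolding I_def by (metis mult_cancel_right1)
qed

lemma bounded_linear_fourier_coeff:
  assumes \<gamma>: "\<gamma> \<in> characters"
  shows "bounded_linear (\<lambda>f. fourier_coeff m f \<gamma>)"
proof (rule bounded_linear_intro[where K = 1])
  have int: "integrable m (\<lambda>x. cnj (\<gamma> x) * apply_bcontfun v x)" for v
    by (intro integrable_continuous continuous_intros charactersD(1)[OF \<gamma>])
  show "fourier_coeff m (u + v) \<gamma> = fourier_coeff m u \<gamma> + fourier_coeff m v \<gamma>" for u v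
    unfolding fourier_coeff_def plus_bcontfun.rep_eq distrib_left
    by (rule Bochner_Integration.integral_add) (rule int)+
  show "fourier_coeff m (c *\<^sub>R u) \<gamma> = c *\<^sub>R fourier_coeff m u \<gamma>" for c u
    unfolding fourier_coeff_def scaleR_bcontfun.rep_eq by simp
  show "norm (fourier_coeff m u \<gamma>) \<le> norm u * 1" for u
    unfolding fourier_coeff_def
    by (intro norm_integral_le continuous_intros charactersD(1)[OF \<gamma>])
      (simp add: norm_mult charactersD(2)[OF \<gamma>] norm_bounded)
qed

lemma fourier_coeff_scale: "fourier_coeff m (c *\<^sub>C u) \<gamma> = c * fourier_coeff m u \<gamma>"
  unfolding fourier_coeff_def scaleC_bcontfun_apply mult.left_commute[of _ c]
  by (rule integral_mult_right_zero)

lemma fourier_coeff_char_fun: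
  "\<gamma> \<in> characters \<Longrightarrow> \<delta> \<in> characters \<Longrightarrow>
    fourier_coeff m (char_fun \<gamma>) \<delta> = (if \<gamma> = \<delta> then 1 else 0)"
  by (simp add: fourier_coeff_def char_fun_apply character_orthogonality)

lemma fourier_series:
  assumes sum: "(\<lambda>\<gamma>. cmod (fourier_coeff m f \<gamma>)) summable_on characters"
  shows "((\<lambda>\<gamma>. fourier_coeff m f \<gamma> *\<^sub>C char_fun \<gamma>) has_sum f) characters"
proof -
  let ?u = "\<lambda>\<gamma>. fourier_coeff m f \<gamma> *\<^sub>C char_fun \<gamma>"
  define F where "F = infsum ?u characters"
  have F: "(?u has_sum F) characters"
    unfolding F_def
    by (rule bcontfun_has_sum[OF _ sum]) (simp add: norm_scaleC mult_left_le norm_char_fun)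
  have "fourier_coeff m (f - F) \<delta> = 0" if \<delta>: "\<delta> \<in> characters" for \<delta>
  proof -
    have "((\<lambda>\<gamma>. fourier_coeff m (?u \<gamma>) \<delta>) has_sum fourier_coeff m F \<delta>) characters"
      by (rule has_sum_bounded_linear[OF bounded_linear_fourier_coeff[OF \<delta>] F])
    moreover have "((\<lambda>\<gamma>. fourier_coeff m (?u \<gamma>) \<delta>) has_sum fourier_coeff m f \<delta>) characters"
    proof -
      have "((\<lambda>\<gamma>. fourier_coeff m (?u \<gamma>) \<delta>) has_sum (\<Sum>\<gamma>\<in>{\<delta>}. fourier_coeff m (?u \<gamma>) \<delta>)) characters"
        by (rule has_sum_finite_neutralI[of "{\<delta>}"])
          (use \<delta> in \<open>auto simp: fourier_coeff_scale fourier_coeff_char_fun\<close>)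
      then show ?thesis using \<delta> by (simp add: fourier_coeff_scale fourier_coeff_char_fun)
    qed
    ultimately have "fourier_coeff m F \<delta> = fourier_coeff m f \<delta>" by (rule has_sum_unique)
    then show ?thesis
      using linear_diff[OF bounded_linear.linear[OF bounded_linear_fourier_coeff[OF \<delta>]], of f F] by simp
  qed
  then have "f - F = 0" by (rule fourier_uniqueness)
  then show ?thesis using F by simp
qed

section \<open>Fourier coefficients of measures, and the factorization of the convolution
  operator\<close>

definition fourier_stieltjes :: "'g cmeasure \<Rightarrow> ('g \<Rightarrow> complex) \<Rightarrow> complex" where
  "fourier_stieltjes \<mu> \<gamma> = cm_integral \<mu> (apply_bcontfun (char_fun (\<lambda>x. cnj (\<gamma> x))))"

lemma cmod_fourier_stieltjes: "\<gamma> \<in> characters \<Longrightarrow> cmod (fourier_stieltjes \<mu> \<gamma>) \<le> norm \<mu>"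
  unfolding fourier_stieltjes_def
  by (rule order_trans[OF cm_integral_bound])
    (simp add: mult_left_le_one_le norm_char_fun cnj_character)

definition reflect :: "'g \<Rightarrow> ('g \<Rightarrow>\<^sub>C complex) \<Rightarrow> ('g \<Rightarrow>\<^sub>C complex)" where
  "reflect a u = Bcontfun (\<lambda>x. u (a - x))"

lemma reflect_apply: "apply_bcontfun (reflect a u) = (\<lambda>x. u (a - x))"
  unfolding reflect_def by (rule apply_Bcontfun) (intro continuous_intros)

lemma bounded_linear_reflect: "bounded_linear (reflect a)"
proof (rule bounded_linear_intro[where K = 1])
  show "norm (reflect a u) \<le> norm u * 1" for u
    using norm_bounded[of u] by (intro norm_bound) (simp add: reflect_apply)
qed (rule bcontfun_eqI, simp add: reflect_apply plus_bcontfun.rep_eq scaleR_bcontfun.rep_eq)+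

lemma reflect_char_fun:
  assumes "\<gamma> \<in> characters"
  shows "reflect a (c *\<^sub>C char_fun \<gamma>) = (c * \<gamma> a) *\<^sub>C char_fun (\<lambda>x. cnj (\<gamma> x))"
  using assms
  by (intro bcontfun_eqI)
    (simp add: reflect_apply char_fun_apply cnj_character charactersD(6) ac_simps)

text \<open>The value at \<open>g\<close> integrates the reflection \<open>reflect g f\<close>.
  Reflection and integration are continuous for the supremum norm, so the Fourier series of
  \<open>f\<close> may be integrated term by term.\<close>

lemma conv_operator_fourier:
  assumes sum: "(\<lambda>\<gamma>. cmod (fourier_coeff m f \<gamma>)) summable_on characters"
  shows "conv_operator f \<mu> =
    (\<Sum>\<^sub>\<infinity>\<gamma>\<in>characters. (fourier_coeff m f \<gamma> * fourier_stieltjes \<mu> \<gamma>) *\<^sub>C char_fun \<gamma>)"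
proof -
  let ?c = "fourier_coeff m f"
  let ?v = "\<lambda>\<gamma>. (?c \<gamma> * fourier_stieltjes \<mu> \<gamma>) *\<^sub>C char_fun \<gamma>"
  have "(?v has_sum infsum ?v characters) characters"
  proof (rule bcontfun_has_sum)
    show "(\<lambda>\<gamma>. cmod (?c \<gamma>) * norm \<mu>) summable_on characters"
      by (rule summable_on_cmult_left[OF sum])
    show "norm (?v \<gamma>) \<le> cmod (?c \<gamma>) * norm \<mu>" if "\<gamma> \<in> characters" for \<gamma>
      using mult_mono[OF mult_left_mono[OF cmod_fourier_stieltjes[OF that, of \<mu>], of "cmod (?c \<gamma>)"]
          norm_char_fun[OF that]]
      by (simp add: norm_scaleC norm_mult)
  qed
  note v = has_sum_bounded_linear[OF bounded_linear_apply_bcontfun this]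
  have "cm_integral \<mu> (\<lambda>h. f (g - h)) = apply_bcontfun (infsum ?v characters) g" for g
  proof (rule has_sum_unique)
    have "((\<lambda>\<gamma>. cm_integral \<mu> (apply_bcontfun (reflect g (?c \<gamma> *\<^sub>C char_fun \<gamma>)))) has_sum
        cm_integral \<mu> (apply_bcontfun (reflect g f))) characters"
      by (rule has_sum_bounded_linear[OF bounded_clinearD(1)[OF bounded_clinear_cm_integral]
            has_sum_bounded_linear[OF bounded_linear_reflect fourier_series[OF sum]]])
    then show "((\<lambda>\<gamma>. cm_integral \<mu> (apply_bcontfun (reflect g (?c \<gamma> *\<^sub>C char_fun \<gamma>)))) has_sum
        cm_integral \<mu> (\<lambda>h. f (g - h))) characters"
      by (simp only: reflect_apply)
    have "cm_integral \<mu> (apply_bcontfun (reflect g (?c \<gamma> *\<^sub>C char_fun \<gamma>))) = apply_bcontfun (?v \<gamma>) g"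
      if "\<gamma> \<in> characters" for \<gamma>
      by (simp add: reflect_char_fun[OF that] cm_integral_scale char_fun_apply[OF that]
          fourier_stieltjes_def[symmetric] ac_simps)
    then show "((\<lambda>\<gamma>. cm_integral \<mu> (apply_bcontfun (reflect g (?c \<gamma> *\<^sub>C char_fun \<gamma>)))) has_sum
        apply_bcontfun (infsum ?v characters) g) characters"
      using v[of g] by (simp cong: has_sum_cong)
  qed
  then show ?thesis by (simp add: conv_operator_def apply_bcontfun_inverse)
qed

lemma cmod_fourier_coeff_le: "\<gamma> \<in> characters \<Longrightarrow> cmod (fourier_coeff m f \<gamma>) \<le> norm f"
  unfolding fourier_coeff_def
  by (intro norm_integral_le continuous_intros charactersD(1))
    (simp_all add: norm_mult charactersD(2) norm_bounded)

lemma summable_coefficients: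
  assumes s: "0 < s" "s \<le> 1"
    and sum: "(\<lambda>\<gamma>. cmod (fourier_coeff m f \<gamma>) powr s) summable_on characters"
  shows "(\<lambda>\<gamma>. cmod (fourier_coeff m f \<gamma>)) summable_on characters"
proof (rule summable_on_comparison_test)
  let ?c = "fourier_coeff m f"
  show "(\<lambda>\<gamma>. cmod (?c \<gamma>) powr s * norm f powr (1 - s)) summable_on characters"
    by (rule summable_on_cmult_left[OF sum])
  fix \<gamma> :: "'g \<Rightarrow> complex" assume \<gamma>: "\<gamma> \<in> characters"
  have "cmod (?c \<gamma>) = cmod (?c \<gamma>) powr s * cmod (?c \<gamma>) powr (1 - s)"
    by (simp flip: powr_add)
  also have "\<dots> \<le> cmod (?c \<gamma>) powr s * norm f powr (1 - s)"
    using s cmod_fourier_coeff_le[OF \<gamma>] by (intro mult_left_mono powr_mono2) auto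
  finally show "cmod (?c \<gamma>) \<le> cmod (?c \<gamma>) powr s * norm f powr (1 - s)" .
qed simp

theorem summable_imp_factors:
  assumes s: "0 < s" "s \<le> 1" and r: "0 < r" "1 / r = 1 / ereal s - 1"
    and sum: "(\<lambda>\<gamma>. cmod (fourier_coeff m f \<gamma>) powr s) summable_on characters"
  shows "factors_through_schatten TYPE(('g \<Rightarrow> complex) ell2) r (conv_operator f)"
proof -
  define c where "c = fourier_coeff m f"
  define \<Gamma> where "\<Gamma> = (characters :: ('g \<Rightarrow> complex) set)"
  have sum1: "(\<lambda>\<gamma>. cmod (c \<gamma>)) summable_on \<Gamma>"
    unfolding c_def \<Gamma>_def by (rule summable_coefficients[OF s sum])
  \<comment> \<open>The index type contains all functions on \<open>G\<close>, so families are
    extended by \<open>0\<close> off the characters. For \<open>s = 1\<close> the entry of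
    \<open>d\<close> is \<open>1\<close> where the coefficient is nonzero, and
    \<open>0 powr 0 = 0\<close> elsewhere.\<close>
  define a where "a \<gamma> = (if \<gamma> \<in> \<Gamma> then cmod (c \<gamma>) powr (s / 2) else 0)" for \<gamma>
  define d where "d \<gamma> = (if \<gamma> \<in> \<Gamma> then cmod (c \<gamma>) powr (1 - s) else 0)" for \<gamma>
  have ada: "a \<gamma> * d \<gamma> * a \<gamma> = cmod (c \<gamma>)" if "\<gamma> \<in> \<Gamma>" for \<gamma>
    using that by (simp add: a_def d_def flip: powr_add)
  have a0: "0 \<le> a \<gamma>" for \<gamma> by (simp add: a_def)
  have d0: "0 \<le> d \<gamma>" for \<gamma> by (simp add: d_def)
  have dD: "d \<gamma> \<le> norm f powr (1 - s)" for \<gamma>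
    using s cmod_fourier_coeff_le[of \<gamma> f] by (auto simp: d_def c_def \<Gamma>_def intro!: powr_mono2)
  have a2: "(a \<gamma>)\<^sup>2 = (if \<gamma> \<in> \<Gamma> then cmod (c \<gamma>) powr s else 0)" for \<gamma>
    by (simp add: a_def power2_eq_square flip: powr_add)
  have suma: "(\<lambda>\<gamma>. (a \<gamma>)\<^sup>2) summable_on UNIV"
    using sum unfolding a2 c_def \<Gamma>_def
    by (subst summable_on_cong_neutral[where T = characters and g = "\<lambda>\<gamma>. cmod (fourier_coeff m f \<gamma>) powr s"]) auto
  define \<alpha> where "\<alpha> = Abs_ell2 (\<lambda>\<gamma>. complex_of_real (a \<gamma>))"
  have \<alpha>: "ell2_nth \<alpha> \<gamma> = of_real (a \<gamma>)" for \<gamma>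
    unfolding \<alpha>_def by (subst ell2_nth_Abs) (use suma in simp_all)

  define B where "B \<mu> = Abs_ell2 (\<lambda>\<gamma>. of_real (a \<gamma>) * (if \<gamma> \<in> \<Gamma> then fourier_stieltjes \<mu> \<gamma> else 0))" for \<mu>
  have Ble: "cmod (of_real (a \<gamma>) * (if \<gamma> \<in> \<Gamma> then fourier_stieltjes \<mu> \<gamma> else 0)) \<le> norm \<mu> * cmod (ell2_nth \<alpha> \<gamma>)" for \<mu> \<gamma>
    using mult_left_mono[OF cmod_fourier_stieltjes[of \<gamma> \<mu>] a0[of \<gamma>]] a0[of \<gamma>]
    by (auto simp: \<alpha> norm_mult \<Gamma>_def mult.commute)
  have B: "ell2_nth (B \<mu>) \<gamma> = of_real (a \<gamma>) * (if \<gamma> \<in> \<Gamma> then fourier_stieltjes \<mu> \<gamma> else 0)" for \<mu> \<gamma>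
    unfolding B_def by (subst ell2_nth_Abs) (rule ell2_comparison[OF Ble], rule refl)
  have bB: "bounded_clinear B"
  proof (rule bounded_clinearI[where K = "norm \<alpha>"])
    show "B (\<mu> + \<nu>) = B \<mu> + B \<nu>" for \<mu> \<nu>
      by (rule ell2_eqI) (simp add: B fourier_stieltjes_def cm_integral_cmeasure_add distrib_left)
    show "B (k *\<^sub>C \<mu>) = k *\<^sub>C B \<mu>" for k \<mu>
      by (rule ell2_eqI) (simp add: B fourier_stieltjes_def cm_integral_cmeasure_scale)
    show "norm (B \<mu>) \<le> norm \<alpha> * norm \<mu>" for \<mu>
      using norm_ell2_le[of "B \<mu>" "norm \<mu>" \<alpha>] Ble by (simp add: B mult.commute)
  qed

  define A where "A x = (\<Sum>\<^sub>\<infinity>\<gamma>\<in>\<Gamma>. (of_real (a \<gamma>) * sgn (c \<gamma>) * ell2_nth x \<gamma>) *\<^sub>C char_fun \<gamma>)" for x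
  \<comment> \<open>\<open>b g\<close> represents evaluation of \<open>A x\<close> at
    \<open>g\<close>. Its norm is at most that of \<open>\<alpha>\<close> for every
    \<open>g\<close>, which makes \<open>A\<close> bounded for the supremum norm; the phases
    \<open>sgn (c \<gamma>)\<close> are stored here.\<close>
  define b where "b g = Abs_ell2 (\<lambda>\<gamma>. of_real (a \<gamma>) * (if \<gamma> \<in> \<Gamma> then cnj (sgn (c \<gamma>) * \<gamma> g) else 0))" for g
  have ble: "cmod (of_real (a \<gamma>) * (if \<gamma> \<in> \<Gamma> then cnj (sgn (c \<gamma>) * \<gamma> g) else 0)) \<le> 1 * cmod (ell2_nth \<alpha> \<gamma>)" for g \<gamma>
    using a0[of \<gamma>] by (auto simp: \<alpha> norm_mult \<Gamma>_def charactersD norm_sgn)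
  have b: "ell2_nth (b g) \<gamma> = of_real (a \<gamma>) * (if \<gamma> \<in> \<Gamma> then cnj (sgn (c \<gamma>) * \<gamma> g) else 0)" for g \<gamma>
    unfolding b_def by (subst ell2_nth_Abs) (rule ell2_comparison[OF ble], rule refl)
  have Ag: "apply_bcontfun (A x) g = cinner x (b g)" for x g
  proof (rule has_sum_unique)
    have "(\<lambda>\<gamma>. cmod (ell2_nth \<alpha> \<gamma> * cnj (ell2_nth x \<gamma>))) summable_on \<Gamma>"
      by (rule summable_on_subset_banach[OF
            summable_on_iff_abs_summable_on_complex[THEN iffD1, OF ell2_prod_summable] subset_UNIV])
    then have "((\<lambda>\<gamma>. (of_real (a \<gamma>) * sgn (c \<gamma>) * ell2_nth x \<gamma>) *\<^sub>C char_fun \<gamma>) has_sum A x) \<Gamma>"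
      unfolding A_def
    proof (rule bcontfun_has_sum[rotated])
      fix \<gamma> :: "'g \<Rightarrow> complex" assume "\<gamma> \<in> \<Gamma>"
      then have "norm (char_fun \<gamma>) \<le> 1" by (simp add: \<Gamma>_def norm_char_fun)
      moreover have "cmod (of_real (a \<gamma>) * sgn (c \<gamma>) * ell2_nth x \<gamma>) \<le> cmod (ell2_nth \<alpha> \<gamma> * cnj (ell2_nth x \<gamma>))"
        using a0[of \<gamma>] by (auto simp: \<alpha> norm_mult norm_sgn)
      ultimately show "norm ((of_real (a \<gamma>) * sgn (c \<gamma>) * ell2_nth x \<gamma>) *\<^sub>C char_fun \<gamma>) \<le>
          cmod (ell2_nth \<alpha> \<gamma> * cnj (ell2_nth x \<gamma>))"
        unfolding norm_scaleC by (meson mult_left_le norm_ge_zero order_trans)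
    qed
    from has_sum_bounded_linear[OF bounded_linear_apply_bcontfun this, of g]
    show "((\<lambda>\<gamma>. ell2_nth x \<gamma> * cnj (ell2_nth (b g) \<gamma>)) has_sum apply_bcontfun (A x) g) \<Gamma>"
      by (rule has_sum_cong[THEN iffD1, rotated]) (auto simp: b \<Gamma>_def char_fun_apply)
    show "((\<lambda>\<gamma>. ell2_nth x \<gamma> * cnj (ell2_nth (b g) \<gamma>)) has_sum cinner x (b g)) \<Gamma>"
      by (rule has_sum_cong_neutral[THEN iffD1, OF _ _ _ cinner_ell2_has_sum[of x "b g"]]) (auto simp: b)
  qed
  have bA: "bounded_clinear A"
  proof (rule bounded_clinearI[where K = "norm \<alpha>"])
    show "A (x + y) = A x + A y" for x y
      by (rule bcontfun_eqI) (simp add: Ag plus_bcontfun.rep_eq hil.ip_add_left)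
    show "A (k *\<^sub>C x) = k *\<^sub>C A x" for k x
      by (rule bcontfun_eqI) (simp add: Ag hil.ip_scale_left)
    show "norm (A x) \<le> norm \<alpha> * norm x" for x
    proof (rule norm_bound)
      fix g
      have "norm (b g) \<le> 1 * norm \<alpha>" by (rule norm_ell2_le) (use ble in \<open>simp_all add: b\<close>)
      then have "norm x * norm (b g) \<le> norm x * norm \<alpha>" by (intro mult_left_mono) auto
      then show "norm (apply_bcontfun (A x) g) \<le> norm \<alpha> * norm x"
        using hil.Cauchy_Schwarz[of x "b g"] by (simp add: Ag mult.commute)
    qed
  qed

  have "conv_operator f \<mu> = (A \<circ> diag d \<circ> B) \<mu>" for \<mu>
  proof -
    have "conv_operator f \<mu> = (\<Sum>\<^sub>\<infinity>\<gamma>\<in>\<Gamma>. (c \<gamma> * fourier_stieltjes \<mu> \<gamma>) *\<^sub>C char_fun \<gamma>)"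
      unfolding c_def \<Gamma>_def by (rule conv_operator_fourier[OF sum1[unfolded c_def \<Gamma>_def]])
    also have "\<dots> = A (diag d (B \<mu>))"
      unfolding A_def
    proof (rule infsum_cong)
      fix \<gamma> assume \<gamma>: "\<gamma> \<in> \<Gamma>"
      have "of_real (a \<gamma>) * sgn (c \<gamma>) * ell2_nth (diag d (B \<mu>)) \<gamma> =
          sgn (c \<gamma>) * of_real (a \<gamma> * d \<gamma> * a \<gamma>) * fourier_stieltjes \<mu> \<gamma>"
        using \<gamma> by (simp add: diag_nth[OF d0 dD] B)
      also have "\<dots> = c \<gamma> * fourier_stieltjes \<mu> \<gamma>"
        unfolding ada[OF \<gamma>] by (simp add: sgn_eq)
      finally show "(c \<gamma> * fourier_stieltjes \<mu> \<gamma>) *\<^sub>C char_fun \<gamma> =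
          (of_real (a \<gamma>) * sgn (c \<gamma>) * ell2_nth (diag d (B \<mu>)) \<gamma>) *\<^sub>C char_fun \<gamma>" by simp
    qed
    finally show ?thesis by simp
  qed
  then have fact: "conv_operator f = A \<circ> diag d \<circ> B" by (rule ext)
  have "diag d \<in> schatten_class r"
  proof (cases "r = \<infinity>")
    case True
    then show ?thesis by (simp add: schatten_class_def bounded_clinear_diag[OF d0 dD])
  next
    case False
    then obtain q where q: "r = ereal q" "0 < q" using r(1) by (cases r) auto
    have "1 / q = 1 / s - 1" using r(2) s q by (simp add: one_ereal_def)
    then have qs: "(1 - s) * q = s" using s q by (simp add: field_simps)
    have "(\<lambda>\<gamma>. d \<gamma> powr q) = (\<lambda>\<gamma>. (a \<gamma>)\<^sup>2)"
      unfolding a2 using q by (auto simp: d_def fun_eq_iff powr_powr qs)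
    then show ?thesis unfolding q(1) by (intro diag_schatten[OF d0 dD q(2)]) (simp add: suma)
  qed
  then show ?thesis
    unfolding factors_through_schatten_def using bA bB fact by blast
qed

end

section \<open>Diagonal compressions of Schatten operators\<close>

lemma sum_block3:
  fixes h :: "nat \<Rightarrow> real"
  shows "(\<Sum>i<3 * N. h (i div 3)) = 3 * (\<Sum>n<N. h n)"
proof (induction N)
  case (Suc N)
  have "(\<Sum>i<3 * Suc N. h (i div 3)) = (\<Sum>i<3 * N. h (i div 3)) + h (3 * N div 3) + h (Suc (3 * N) div 3) + h (Suc (Suc (3 * N)) div 3)"
  proof -
    have "3 * Suc N = Suc (Suc (Suc (3 * N)))" by simp
    then show ?thesis by (simp only: sum.lessThan_Suc)
  qed
  moreover have "Suc (3 * N) div 3 = N" "Suc (Suc (3 * N)) div 3 = N" by presburger+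
  ultimately show ?case using Suc by simp
qed simp

lemma decreasing_enumeration:
  fixes f :: "'a \<Rightarrow> real"
  assumes "finite F"
  obtains e where "bij_betw e {..<card F} F" "\<And>i j. i \<le> j \<Longrightarrow> j < card F \<Longrightarrow> f (e j) \<le> f (e i)"
proof -
  obtain ys where ys: "set ys = F" "distinct ys" using finite_distinct_list[OF assms] by blast
  define xs where "xs = sort_key (\<lambda>a. - f a) ys"
  have xs: "set xs = F" "distinct xs" "length xs = card F"
    using ys distinct_card[of ys] by (simp_all add: xs_def)
  have "sorted (map (\<lambda>a. - f a) xs)" by (simp add: xs_def)
  then have "f (xs ! j) \<le> f (xs ! i)" if "i \<le> j" "j < card F" for i j
    using sorted_nth_mono[of "map (\<lambda>a. - f a) xs" i j] that xs by simp
  moreover have "bij_betw (\<lambda>i. xs ! i) {..<card F} F"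
    by (rule bij_betw_nth[OF xs(2)]) (simp_all only: xs(1,3))
  ultimately show ?thesis by (rule that[rotated])
qed

text \<open>The ideal property of singular numbers in the form \<open>s\<^sub>3\<^sub>n(Y U X) \<le> s\<^sub>n(Y) s\<^sub>n(U) s\<^sub>n(X)\<close>,
  for operators \<open>X\<close>, \<open>Y\<close> that make \<open>Y U X\<close> diagonal: some vector in the span of more than \<open>3n\<close>
  basis vectors satisfies all \<open>3n\<close> orthogonality conditions at once.\<close>

lemma diagonal_entry_bound:
  fixes x y :: "'i \<Rightarrow> 'h::complex_hilbert" and p u q :: "nat \<Rightarrow> 'h"
  assumes U: "bounded_clinear U" and F: "finite F"
    and diag: "\<And>i j. i \<in> F \<Longrightarrow> j \<in> F \<Longrightarrow> cinner (U (x i)) (y j) = (if i = j then t i else 0)"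
    and x: "\<And>v. (\<And>k. k < n \<Longrightarrow> cinner v (p k) = 0) \<Longrightarrow> (\<Sum>i\<in>F. (cmod (cinner v (x i)))\<^sup>2) \<le> a * (norm v)\<^sup>2"
    and u: "\<And>v. (\<And>k. k < n \<Longrightarrow> cinner v (u k) = 0) \<Longrightarrow> norm (U v) \<le> \<sigma> * norm v"
    and y: "\<And>v. (\<And>k. k < n \<Longrightarrow> cinner v (q k) = 0) \<Longrightarrow> (\<Sum>i\<in>F. (cmod (cinner v (y i)))\<^sup>2) \<le> b * (norm v)\<^sup>2"
    and nonneg: "0 \<le> a" "0 \<le> b"
    and F': "F' \<subseteq> F" "3 * n < card F'"
  shows "\<exists>i\<in>F'. (cmod (t i))\<^sup>2 \<le> a * \<sigma>\<^sup>2 * b"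
proof (rule ccontr)
  assume "\<not> ?thesis"
  then have less: "a * \<sigma>\<^sup>2 * b < (cmod (t i))\<^sup>2" if "i \<in> F'" for i using that by auto
  have finF': "finite F'" using F F' by (auto intro: finite_subset)
  define K where "K = {..<3::nat} \<times> {..<n}"
  \<comment> \<open>Three groups of \<open>n\<close> equations: \<open>v\<close> is orthogonal to
    the \<open>p k\<close> and the \<open>u k\<close>, and \<open>U v\<close> to the
    \<open>q k\<close>.\<close>
  define e where "e = (\<lambda>(c, k) i. if c = 0 then cinner (x i) (p k) else
      if c = (1::nat) then cinner (x i) (u k) else cinner (U (x i)) (q k))"
  have "finite K" "card K < card F'" using F'(2) by (auto simp: K_def card_cartesian_product)
  then obtain c where c: "\<exists>i\<in>F'. c i \<noteq> 0" "\<And>k. k \<in> K \<Longrightarrow> (\<Sum>i\<in>F'. e k i * c i) = 0"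
    using homogeneous_system_nontrivial[OF _ finF', of K e] by blast
  define v where "v = (\<Sum>i\<in>F'. c i *\<^sub>C x i)"
  define C where "C = (\<Sum>i\<in>F'. (cmod (c i))\<^sup>2)"
  have Uv: "U v = (\<Sum>i\<in>F'. c i *\<^sub>C U (x i))"
    unfolding v_def by (rule clinear_sum) (rule bounded_clinearD[OF U])+
  have v1: "cinner v (p k) = 0" and v2: "cinner v (u k) = 0" if "k < n" for k
    using c(2)[of "(0, k)"] c(2)[of "(1, k)"] that
    by (simp_all add: K_def e_def v_def hil.ip_sum_left hil.ip_scale_left mult.commute del: One_nat_def)
  have v3: "cinner (U v) (q k) = 0" if "k < n" for k
    using c(2)[of "(2, k)"] that
    by (simp add: K_def e_def Uv hil.ip_sum_left hil.ip_scale_left mult.commute)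
  \<comment> \<open>Hypothesis \<open>x\<close> bounds the coefficients
    \<open>cinner v (x i)\<close> on the complement of the \<open>p k\<close>. Pairing
    \<open>v\<close> with itself transfers the bound to \<open>v\<close> as a combination of the
    \<open>x i\<close>.\<close>
  have v_le: "(norm v)\<^sup>2 \<le> C * a"
  proof (cases "v = 0")
    case False
    have "(norm v)\<^sup>2 = cmod (cinner v v)" by (simp only: hil.ip_self norm_of_real abs_power2)
    also have "\<dots> = cmod (\<Sum>i\<in>F'. c i * cinner (x i) v)"
      by (subst (1) v_def) (simp add: hil.ip_sum_left hil.ip_scale_left)
    also have "\<dots> \<le> (\<Sum>i\<in>F'. cmod (c i) * cmod (cinner v (x i)))"
      using cinner_commute[of v] by (intro sum_norm_le) (simp add: norm_mult)
    finally have "((norm v)\<^sup>2)\<^sup>2 \<le> (\<Sum>i\<in>F'. cmod (c i) * cmod (cinner v (x i)))\<^sup>2"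
      by (intro power_mono) auto
    also have "\<dots> \<le> C * (\<Sum>i\<in>F'. (cmod (cinner v (x i)))\<^sup>2)"
      unfolding C_def by (rule Cauchy_Schwarz_ineq_sum)
    also have "\<dots> \<le> C * (\<Sum>i\<in>F. (cmod (cinner v (x i)))\<^sup>2)"
      unfolding C_def by (intro mult_left_mono sum_mono2 F F' sum_nonneg) auto
    also have "\<dots> \<le> C * (a * (norm v)\<^sup>2)"
      unfolding C_def by (intro mult_left_mono x v1 sum_nonneg) auto
    finally have "(norm v)\<^sup>2 * (norm v)\<^sup>2 \<le> (C * a) * (norm v)\<^sup>2" by (simp add: power2_eq_square mult.assoc)
    then show ?thesis by (rule mult_right_le_imp_le) (use False in simp)
  qed (simp add: C_def nonneg sum_nonneg)
  \<comment> \<open>Because the compression is diagonal, pairing \<open>U v\<close> with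
    \<open>y j\<close> picks out \<open>t j * c j\<close>.\<close>
  have "(\<Sum>i\<in>F'. (cmod (t i * c i))\<^sup>2) = (\<Sum>i\<in>F'. (cmod (cinner (U v) (y i)))\<^sup>2)"
  proof (rule sum.cong[OF refl])
    fix j assume j: "j \<in> F'"
    have "cinner (U v) (y j) = (\<Sum>i\<in>F'. if i = j then c j * t j else 0)"
    proof -
      have "cinner (U (x i)) (y j) = (if i = j then t j else 0)" if "i \<in> F'" for i
        using diag[OF subsetD[OF F'(1) that] subsetD[OF F'(1) j]] by simp
      then show ?thesis
        unfolding Uv hil.ip_sum_left hil.ip_scale_left by (intro sum.cong refl) simp
    qed
    then show "(cmod (t j * c j))\<^sup>2 = (cmod (cinner (U v) (y j)))\<^sup>2"
      using finF' j by (simp add: mult.commute)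
  qed
  also have "\<dots> \<le> (\<Sum>i\<in>F. (cmod (cinner (U v) (y i)))\<^sup>2)" by (intro sum_mono2 F F') auto
  also have "\<dots> \<le> b * (norm (U v))\<^sup>2" by (rule y) (rule v3)
  also have "\<dots> \<le> b * (\<sigma> * norm v)\<^sup>2" by (intro mult_left_mono power_mono u v2 nonneg) auto
  also have "\<dots> \<le> b * (\<sigma>\<^sup>2 * (C * a))"
    unfolding power_mult_distrib by (intro mult_left_mono v_le nonneg) auto
  also have "\<dots> = (\<Sum>i\<in>F'. a * \<sigma>\<^sup>2 * b * (cmod (c i))\<^sup>2)"
    by (simp add: C_def sum_distrib_left sum_distrib_right ac_simps)
  also have "\<dots> < (\<Sum>i\<in>F'. (cmod (t i * c i))\<^sup>2)"
  proof (rule sum_strict_mono_ex1[OF finF'])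
    show "\<forall>i\<in>F'. a * \<sigma>\<^sup>2 * b * (cmod (c i))\<^sup>2 \<le> (cmod (t i * c i))\<^sup>2"
      using mult_right_mono[OF less_imp_le[OF less]] by (simp add: norm_mult power_mult_distrib)
    show "\<exists>i\<in>F'. a * \<sigma>\<^sup>2 * b * (cmod (c i))\<^sup>2 < (cmod (t i * c i))\<^sup>2"
    proof -
      obtain i where i: "i \<in> F'" "c i \<noteq> 0" using c(1) by blast
      then have "a * \<sigma>\<^sup>2 * b * (cmod (c i))\<^sup>2 < (cmod (t i))\<^sup>2 * (cmod (c i))\<^sup>2"
        by (intro mult_strict_right_mono less) auto
      then show ?thesis using i(1) by (auto simp: norm_mult power_mult_distrib)
    qed
  qed
  finally show False by simp
qed

text \<open>Since each \<open>l n\<close> is a square sum of coefficients of \<open>w n\<close>, the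
  total of the \<open>l n\<close> can be bounded either by Bessel for each \<open>x i\<close> or by
  an assumption about orthonormal sequences.\<close>

lemma finite_rank_eigensystem:
  fixes x :: "'i \<Rightarrow> 'h::complex_hilbert"
  assumes F: "finite F"
  obtains w :: "nat \<Rightarrow> 'h" and l where
    "\<And>n v. (\<And>k. k < n \<Longrightarrow> cinner v (w k) = 0) \<Longrightarrow> (\<Sum>i\<in>F. (cmod (cinner v (x i)))\<^sup>2) \<le> l n * (norm v)\<^sup>2"
    "\<And>n. 0 \<le> l n" "\<And>m n. m \<noteq> n \<Longrightarrow> cinner (w m) (w n) = 0" "\<And>n. norm (w n) \<le> 1"
    "\<And>n. l n = (\<Sum>i\<in>F. (cmod (cinner (w n) (x i)))\<^sup>2)"
proof -
  let ?W = "\<lambda>v. \<Sum>i\<in>F. cinner v (x i) *\<^sub>C x i"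
  have form: "Re (cinner (?W v) v) = (\<Sum>i\<in>F. (cmod (cinner v (x i)))\<^sup>2)" for v
  proof -
    have "cinner v (x i) * cinner (x i) v = of_real ((cmod (cinner v (x i)))\<^sup>2)" for i
      unfolding complex_norm_square using cinner_commute[of "x i" v] by simp
    then show ?thesis by (simp add: hil.ip_sum_left hil.ip_scale_left del: of_real_power)
  qed
  obtain w :: "nat \<Rightarrow> 'h" and l :: "nat \<Rightarrow> real" where w: "\<And>n. ?W (w n) = of_real (l n) *\<^sub>C w n" "\<And>m n. m \<noteq> n \<Longrightarrow> cinner (w m) (w n) = 0"
    "\<And>n. norm (w n) = 1 \<or> w n = 0 \<and> l n = 0" "\<And>n. 0 \<le> l n"
    "\<And>n v. (\<And>k. k < n \<Longrightarrow> cinner v (w k) = 0) \<Longrightarrow> Re (cinner (?W v) v) \<le> l n * (norm v)\<^sup>2"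
    by (rule hilbert_eigensystem[OF compact_positive_finite_rank[OF F, of x]]) blast
  have "l n = (\<Sum>i\<in>F. (cmod (cinner (w n) (x i)))\<^sup>2)" for n
  proof -
    have "Re (cinner (?W (w n)) (w n)) = l n * (norm (w n))\<^sup>2"
      unfolding w(1) by (simp add: hil.ip_scale_left hil.ip_self)
    then show ?thesis using w(3)[of n] by (auto simp: form)
  qed
  moreover have "norm (w n) \<le> 1" for n using w(3)[of n] by auto
  ultimately show ?thesis using that w(2,4,5) unfolding form by blast
qed

text \<open>The outer factors are controlled differently, one by the norms of its columns
  \<open>x i\<close>, the other along orthonormal sequences. The condition on \<open>\<rho>\<close>
  covers a Schatten operator, with \<open>\<rho> n\<close> a power of \<open>\<sigma> n\<close>, as
  well as a merely bounded one, with \<open>\<rho> = 0\<close>. In decreasing order, the power of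
  entry \<open>i\<close> is at most \<open>h (i div 3)\<close>.\<close>

lemma sum_powr_diagonal_le:
  fixes x y :: "'i \<Rightarrow> 'h::complex_hilbert" and u :: "nat \<Rightarrow> 'h" and \<sigma> \<rho> :: "nat \<Rightarrow> real"
  assumes U: "bounded_clinear U" and F: "finite F"
    and diag: "\<And>i j. i \<in> F \<Longrightarrow> j \<in> F \<Longrightarrow> cinner (U (x i)) (y j) = (if i = j then t i else 0)"
    and u: "\<And>n v. (\<And>k. k < n \<Longrightarrow> cinner v (u k) = 0) \<Longrightarrow> norm (U v) \<le> \<sigma> n * norm v"
    and x: "(\<Sum>i\<in>F. (norm (x i))\<^sup>2) \<le> C1"
    and y: "\<And>(w :: nat \<Rightarrow> 'h) N. (\<And>m n. m \<noteq> n \<Longrightarrow> cinner (w m) (w n) = 0) \<Longrightarrow> (\<And>n. norm (w n) \<le> 1) \<Longrightarrow>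
      (\<Sum>n<N. \<Sum>i\<in>F. (cmod (cinner (w n) (y i)))\<^sup>2) \<le> C2"
    and \<rho>: "\<And>a b n. 0 \<le> a \<Longrightarrow> 0 \<le> b \<Longrightarrow> (a * (\<sigma> n)\<^sup>2 * b) powr (s / 2) \<le> c * (a + b) + \<rho> n"
      "\<And>n. 0 \<le> \<rho> n" "\<And>N. (\<Sum>n<N. \<rho> n) \<le> C3" and "0 \<le> c" "0 < s"
  shows "(\<Sum>i\<in>F. cmod (t i) powr s) \<le> 3 * (c * (C1 + C2) + C3)"
proof -
  obtain p :: "nat \<Rightarrow> 'h" and a :: "nat \<Rightarrow> real" where p:
    "\<And>n v. (\<And>k. k < n \<Longrightarrow> cinner v (p k) = 0) \<Longrightarrow> (\<Sum>i\<in>F. (cmod (cinner v (x i)))\<^sup>2) \<le> a n * (norm v)\<^sup>2"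
    "\<And>n. 0 \<le> a n" "\<And>m n. m \<noteq> n \<Longrightarrow> cinner (p m) (p n) = 0" "\<And>n. norm (p n) \<le> 1"
    "\<And>n. a n = (\<Sum>i\<in>F. (cmod (cinner (p n) (x i)))\<^sup>2)"
    by (rule finite_rank_eigensystem[OF F, of x]) blast
  obtain q :: "nat \<Rightarrow> 'h" and b :: "nat \<Rightarrow> real" where q:
    "\<And>n v. (\<And>k. k < n \<Longrightarrow> cinner v (q k) = 0) \<Longrightarrow> (\<Sum>i\<in>F. (cmod (cinner v (y i)))\<^sup>2) \<le> b n * (norm v)\<^sup>2"
    "\<And>n. 0 \<le> b n" "\<And>m n. m \<noteq> n \<Longrightarrow> cinner (q m) (q n) = 0" "\<And>n. norm (q n) \<le> 1"
    "\<And>n. b n = (\<Sum>i\<in>F. (cmod (cinner (q n) (y i)))\<^sup>2)"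
    by (rule finite_rank_eigensystem[OF F, of y]) blast
  have suma: "(\<Sum>n<N. a n) \<le> C1" for N
  proof -
    have "(\<Sum>n<N. a n) = (\<Sum>i\<in>F. \<Sum>n<N. (cmod (cinner (x i) (p n)))\<^sup>2)"
      unfolding p(5) by (subst sum.swap) (intro sum.cong refl, subst cinner_commute, simp)
    also have "\<dots> \<le> (\<Sum>i\<in>F. (norm (x i))\<^sup>2)"
      by (intro sum_mono hil.Bessel p) auto
    finally show ?thesis using x by simp
  qed
  have sumb: "(\<Sum>n<N. b n) \<le> C2" for N
    unfolding q(5) by (rule y) (use q in auto)
  define N where "N = card F"
  obtain e where e: "bij_betw e {..<N} F" "\<And>i j. i \<le> j \<Longrightarrow> j < N \<Longrightarrow> cmod (t (e j)) \<le> cmod (t (e i))"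
    unfolding N_def by (rule decreasing_enumeration[OF F, of "\<lambda>i. cmod (t i)"]) blast
  define h where "h n = c * (a n + b n) + \<rho> n" for n
  have h0: "0 \<le> h n" for n using p(2) q(2) \<rho>(2) \<open>0 \<le> c\<close> by (simp add: h_def)
  have le: "cmod (t (e i)) powr s \<le> h (i div 3)" if i: "i < N" for i
  proof -
    \<comment> \<open>Among the first \<open>3 * n + 1\<close> entries one obeys the bound for
      \<open>n\<close>, and entry \<open>i\<close> is no larger than any of them.\<close>
    define n where "n = i div 3"
    have n: "3 * n \<le> i" by (simp add: n_def)
    have inj: "inj_on e {..3 * n}"
      using e(1) n i by (auto simp: bij_betw_def intro: inj_on_subset)
    have sub: "e ` {..3 * n} \<subseteq> F" using bij_betw_imp_surj_on[OF e(1)] n i by auto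
    have "\<exists>j\<in>e ` {..3 * n}. (cmod (t j))\<^sup>2 \<le> a n * (\<sigma> n)\<^sup>2 * b n"
    proof (rule diagonal_entry_bound[OF U F])
      show "cinner (U (x i)) (y j) = (if i = j then t i else 0)" if "i \<in> F" "j \<in> F" for i j
        by (rule diag[OF that])
      show "(\<Sum>i\<in>F. (cmod (cinner v (x i)))\<^sup>2) \<le> a n * (norm v)\<^sup>2"
        if "\<And>k. k < n \<Longrightarrow> cinner v (p k) = 0" for v by (rule p(1)[OF that])
      show "norm (U v) \<le> \<sigma> n * norm v" if "\<And>k. k < n \<Longrightarrow> cinner v (u k) = 0" for v
        by (rule u[OF that])
      show "(\<Sum>i\<in>F. (cmod (cinner v (y i)))\<^sup>2) \<le> b n * (norm v)\<^sup>2"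
        if "\<And>k. k < n \<Longrightarrow> cinner v (q k) = 0" for v by (rule q(1)[OF that])
      show "3 * n < card (e ` {..3 * n})"
        unfolding card_image[OF inj] card_atMost by (rule lessI)
    qed (rule p(2) q(2) sub)+
    then obtain j where j: "j \<le> 3 * n" "(cmod (t (e j)))\<^sup>2 \<le> a n * (\<sigma> n)\<^sup>2 * b n" by auto
    have "cmod (t (e i)) \<le> cmod (t (e j))" by (rule e(2)) (use j n i in auto)
    then have "(cmod (t (e i)))\<^sup>2 \<le> (cmod (t (e j)))\<^sup>2" by (rule power_mono) simp
    then have "(cmod (t (e i)))\<^sup>2 \<le> a n * (\<sigma> n)\<^sup>2 * b n" using j(2) by (rule order_trans)
    then have "((cmod (t (e i)))\<^sup>2) powr (s / 2) \<le> (a n * (\<sigma> n)\<^sup>2 * b n) powr (s / 2)"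
      using \<open>0 < s\<close> by (intro powr_mono2) auto
    also have "((cmod (t (e i)))\<^sup>2) powr (s / 2) = cmod (t (e i)) powr s"
      by (cases "t (e i) = 0") (simp_all add: powr_powr flip: powr_numeral)
    finally show ?thesis using \<rho>(1)[OF p(2) q(2), of n n n] by (simp add: h_def n_def)
  qed
  have "(\<Sum>i\<in>F. cmod (t i) powr s) = (\<Sum>i<N. cmod (t (e i)) powr s)"
    by (rule sum.reindex_bij_betw[symmetric, OF e(1)])
  also have "\<dots> \<le> (\<Sum>i<N. h (i div 3))" by (intro sum_mono le) simp
  also have "\<dots> \<le> (\<Sum>i<3 * N. h (i div 3))" by (intro sum_mono2 h0) auto
  also have "\<dots> = 3 * (c * ((\<Sum>n<N. a n) + (\<Sum>n<N. b n)) + (\<Sum>n<N. \<rho> n))"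
    unfolding sum_block3 by (simp add: h_def sum.distrib flip: sum_distrib_left)
  also have "\<dots> \<le> 3 * (c * (C1 + C2) + C3)"
    by (intro mult_left_mono add_mono suma sumb \<rho> \<open>0 \<le> c\<close>) auto
  finally show ?thesis .
qed

text \<open>A crude Young inequality: each factor is at most a power of the maximum
  \<open>M\<close>, and the exponents \<open>1\<close>, \<open>2 / r\<close>, \<open>1\<close> add
  up to \<open>2 / s\<close>. Here \<open>a\<close> and \<open>b\<close> stand for squares of
  singular numbers already.\<close>

lemma three_factor_bound:
  fixes a b \<sigma> r s :: real
  assumes "0 \<le> a" "0 \<le> b" "0 \<le> \<sigma>" "0 < r" "0 < s" "1 / r = 1 / s - 1"
  shows "(a * \<sigma>\<^sup>2 * b) powr (s / 2) \<le> a + b + \<sigma> powr r"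
proof -
  define M where "M = max a (max b (\<sigma> powr r))"
  have M: "a \<le> M" "b \<le> M" "\<sigma> powr r \<le> M" "0 \<le> M" using assms by (auto simp: M_def)
  have "(\<sigma> powr r) powr (1 / r) \<le> M powr (1 / r)"
    by (rule powr_mono2) (use M assms(4) in simp_all)
  then have \<sigma>: "\<sigma> \<le> M powr (1 / r)" using assms(3,4) by (simp add: powr_powr)
  have "a * \<sigma>\<^sup>2 * b \<le> M * (M powr (1 / r))\<^sup>2 * M"
    using M assms \<sigma> by (intro mult_mono power_mono) auto
  also have "\<dots> = M powr (2 / s)"
  proof (cases "M = 0")
    case False
    then have "0 < M" using M by simp
    then have "M * (M powr (1 / r))\<^sup>2 * M = M powr (1 + (1 / r + 1 / r) + 1)"
      unfolding powr_add power2_eq_square by simp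
    also have "1 + (1 / r + 1 / r) + 1 = 2 / s" using assms(6) by simp
    finally show ?thesis .
  qed simp
  finally have "(a * \<sigma>\<^sup>2 * b) powr (s / 2) \<le> (M powr (2 / s)) powr (s / 2)"
    using assms by (intro powr_mono2) auto
  also have "\<dots> = M" using assms M by (simp add: powr_powr)
  also have "M \<le> a + b + \<sigma> powr r" using assms by (simp add: M_def)
  finally show ?thesis .
qed

section \<open>Trigonometric polynomials\<close>

context haar
begin

definition trig_poly :: "('g \<Rightarrow> complex) set" where
  "trig_poly = {u. \<exists>I c. finite I \<and> I \<subseteq> characters \<and> u = (\<lambda>x. \<Sum>\<gamma>\<in>I. c \<gamma> * \<gamma> x)}"

lemma trig_poly_character: "\<gamma> \<in> characters \<Longrightarrow> (\<lambda>x. c * \<gamma> x) \<in> trig_poly"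
  unfolding trig_poly_def by (intro CollectI exI[of _ "{\<gamma>}"] exI[of _ "\<lambda>_. c"]) auto

lemma trig_poly_add:
  assumes "u \<in> trig_poly" "v \<in> trig_poly"
  shows "(\<lambda>x. u x + v x) \<in> trig_poly"
proof -
  obtain I c where I: "finite I" "I \<subseteq> characters" "u = (\<lambda>x. \<Sum>\<gamma>\<in>I. c \<gamma> * \<gamma> x)"
    using assms(1) unfolding trig_poly_def by blast
  obtain J d where J: "finite J" "J \<subseteq> characters" "v = (\<lambda>x. \<Sum>\<gamma>\<in>J. d \<gamma> * \<gamma> x)"
    using assms(2) unfolding trig_poly_def by blast
  have "u x + v x = (\<Sum>\<gamma>\<in>I \<union> J. ((if \<gamma> \<in> I then c \<gamma> else 0) + (if \<gamma> \<in> J then d \<gamma> else 0)) * \<gamma> x)" for x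
  proof -
    have "u x = (\<Sum>\<gamma>\<in>I \<union> J. (if \<gamma> \<in> I then c \<gamma> else 0) * \<gamma> x)"
      unfolding I(3) using I(1) J(1) by (intro sum.mono_neutral_cong_left) auto
    moreover have "v x = (\<Sum>\<gamma>\<in>I \<union> J. (if \<gamma> \<in> J then d \<gamma> else 0) * \<gamma> x)"
      unfolding J(3) using I(1) J(1) by (intro sum.mono_neutral_cong_left) auto
    ultimately show ?thesis by (simp add: distrib_right sum.distrib)
  qed
  then show ?thesis
    unfolding trig_poly_def using I(1,2) J(1,2)
    by (intro CollectI exI[of _ "I \<union> J"]
        exI[of _ "\<lambda>\<gamma>. (if \<gamma> \<in> I then c \<gamma> else 0) + (if \<gamma> \<in> J then d \<gamma> else 0)"]) auto
qed

lemma one_character: "(\<lambda>_. 1) \<in> characters"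
  by (simp add: characters_def)

lemma trig_poly_const: "(\<lambda>x. c) \<in> trig_poly"
  using trig_poly_character[OF one_character, of c] by simp

lemma trig_poly_sum: "(\<And>i. i \<in> I \<Longrightarrow> u i \<in> trig_poly) \<Longrightarrow> (\<lambda>x. \<Sum>i\<in>I. u i x) \<in> trig_poly"
  by (induction I rule: infinite_finite_induct) (auto intro: trig_poly_const trig_poly_add)

lemma mult_character: "\<gamma> \<in> characters \<Longrightarrow> \<delta> \<in> characters \<Longrightarrow> (\<lambda>x. \<gamma> x * \<delta> x) \<in> characters"
  by (auto simp: characters_def norm_mult ac_simps intro: continuous_intros)

lemma trig_poly_mult:
  assumes "u \<in> trig_poly" "v \<in> trig_poly"
  shows "(\<lambda>x. u x * v x) \<in> trig_poly"
proof -
  obtain I c where I: "finite I" "I \<subseteq> characters" "u = (\<lambda>x. \<Sum>\<gamma>\<in>I. c \<gamma> * \<gamma> x)"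
    using assms(1) unfolding trig_poly_def by blast
  obtain J d where J: "finite J" "J \<subseteq> characters" "v = (\<lambda>x. \<Sum>\<gamma>\<in>J. d \<gamma> * \<gamma> x)"
    using assms(2) unfolding trig_poly_def by blast
  have "(\<lambda>x. u x * v x) = (\<lambda>x. \<Sum>\<gamma>\<in>I. \<Sum>\<delta>\<in>J. (c \<gamma> * d \<delta>) * (\<gamma> x * \<delta> x))"
    unfolding I(3) J(3) sum_product by (intro ext sum.cong refl) (simp add: ac_simps)
  also have "\<dots> \<in> trig_poly"
    by (intro trig_poly_sum trig_poly_character mult_character) (use I(2) J(2) in auto)
  finally show ?thesis .
qed

lemma trig_poly_prod: "(\<And>i. i \<in> I \<Longrightarrow> u i \<in> trig_poly) \<Longrightarrow> (\<lambda>x. \<Prod>i\<in>I. u i x) \<in> trig_poly"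
  by (induction I rule: infinite_finite_induct) (auto intro: trig_poly_const trig_poly_mult)

lemma trig_poly_power: "u \<in> trig_poly \<Longrightarrow> (\<lambda>x. u x ^ n) \<in> trig_poly"
  by (induction n) (auto intro: trig_poly_const trig_poly_mult)

lemma integrable_continuous_real: "continuous_on UNIV f \<Longrightarrow> integrable m f" for f :: "'g \<Rightarrow> real"
  using integrable_Re[OF integrable_continuous[OF continuous_on_of_real[of UNIV f]]] by simp

text \<open>The kernel is a normalized high power of \<open>\<Prod>\<gamma>\<in>F. (1 + Re \<gamma>) / 2\<close>, which attains its
  maximum \<open>1\<close> exactly where all \<open>\<gamma> \<in> F\<close> are \<open>1\<close>.\<close>

lemma positive_kernel:
  assumes F: "finite F" "F \<subseteq> characters"
  obtains J p where "finite J" "F \<subseteq> J" "J \<subseteq> characters"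
    "\<And>a. (\<integral>x. cmod (\<Sum>\<gamma>\<in>J. p \<gamma> * \<gamma> (x + a)) \<partial>m) = 1" "\<And>\<gamma>. \<gamma> \<in> F \<Longrightarrow> 1 / 2 \<le> cmod (p \<gamma>)"
proof -
  define w where "w x = (\<Prod>\<gamma>\<in>F. (1 + Re (\<gamma> x)) / 2)" for x
  have chF: "\<gamma> \<in> characters" if "\<gamma> \<in> F" for \<gamma> using F that by auto
  have factor: "0 \<le> (1 + Re (\<gamma> x)) / 2" "(1 + Re (\<gamma> x)) / 2 \<le> 1" if "\<gamma> \<in> F" for \<gamma> x
    using abs_Re_le_cmod[of "\<gamma> x"] charactersD(2)[OF chF[OF that], of x] by auto
  have w01: "0 \<le> w x" "w x \<le> 1" for x
    unfolding w_def by (intro prod_nonneg factor ballI; simp) (intro prod_le_1 conjI factor)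
  have w_le: "w x \<le> (1 + Re (\<gamma> x)) / 2" if "\<gamma> \<in> F" for \<gamma> x
  proof -
    have "w x = (1 + Re (\<gamma> x)) / 2 * (\<Prod>\<gamma>\<in>F - {\<gamma>}. (1 + Re (\<gamma> x)) / 2)"
      unfolding w_def using F(1) that by (rule prod.remove)
    also have "\<dots> \<le> (1 + Re (\<gamma> x)) / 2 * 1"
      using that by (intro mult_left_mono prod_le_1 conjI factor) auto
    finally show ?thesis by simp
  qed
  have w0: "w 0 = 1" unfolding w_def by (intro prod.neutral ballI) (simp add: charactersD(4)[OF chF])
  have cont: "continuous_on UNIV w"
    unfolding w_def by (intro continuous_intros charactersD(1) chF) auto
  define I where "I n = (\<integral>x. w x ^ n \<partial>m)" for n
  have int: "integrable m (\<lambda>x. w x ^ n)" for n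
    by (intro integrable_continuous_real continuous_intros cont)
  \<comment> \<open>Since \<open>w 0 = 1\<close>, the bound \<open>7/8\<close> holds on a set of
    positive measure, so \<open>I n\<close> decays no faster than a multiple of
    \<open>(7/8) ^ n\<close>; a ratio below \<open>3/4\<close> at every step is then
    impossible.\<close>
  define V where "V = w -` {7/8 <..}"
  have V: "open V" "0 \<in> V" unfolding V_def using w0 by (auto intro: open_vimage cont)
  define \<delta> where "\<delta> = measure m V"
  have \<delta>: "0 < \<delta>" unfolding \<delta>_def by (rule open_measure_pos[OF V])
  have Vm: "V \<in> sets m" using V(1) by (simp add: sets_m borel_open)
  have lower: "(7/8) ^ n * \<delta> \<le> I n" for n
  proof -
    have "(7/8) ^ n * \<delta> = (\<integral>x. (7/8) ^ n * indicat_real V x \<partial>m)" using Vm by (simp add: \<delta>_def)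
    also have "\<dots> \<le> I n" unfolding I_def
    proof (intro integral_mono int integrable_mult_right)
      show "integrable m (indicat_real V)" using Vm by (simp add: emeasure_eq_measure)
      show "(7/8) ^ n * indicat_real V x \<le> w x ^ n" for x
        using w01(1)[of x] by (auto simp: indicator_def V_def intro!: power_mono)
    qed
    finally show ?thesis .
  qed
  have Ipos: "0 < I n" for n using lower[of n] \<delta> by (smt (verit) zero_less_power mult_pos_pos divide_pos_pos)
  have "\<exists>n. 3/4 * I n \<le> I (Suc n)"
  proof (rule ccontr)
    assume "\<not> ?thesis"
    then have step: "I (Suc n) < 3/4 * I n" for n by (simp add: not_le)
    have upper: "I n \<le> (3/4) ^ n" for n
    proof (induction n)
      case (Suc n)
      then show ?case using step[of n] by simp
    qed (simp add: I_def)
    have "\<delta> \<le> (6/7) ^ n" for n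
    proof -
      have "(7/8) ^ n * \<delta> \<le> (3/4) ^ n" using lower[of n] upper[of n] by simp
      also have "(3/4::real) ^ n = (7/8) ^ n * (6/7) ^ n" by (simp flip: power_mult_distrib)
      finally show ?thesis by simp
    qed
    moreover have "(\<lambda>n. (6/7::real) ^ n) \<longlonglongrightarrow> 0" by (rule LIMSEQ_power_zero) simp
    ultimately have "\<delta> \<le> 0" by (intro LIMSEQ_le_const) auto
    then show False using \<delta> by simp
  qed
  then obtain n where n: "3/4 * I n \<le> I (Suc n)" by blast
  define P where "P x = complex_of_real (w x ^ n / I n)" for x
  have re: "complex_of_real ((1 + Re z) / 2) = (1/2) + ((1/4) * z + (1/4) * cnj z)" for z
    by (simp add: complex_eq_iff)
  have "(\<lambda>x. complex_of_real ((1 + Re (\<gamma> x)) / 2)) \<in> trig_poly" if "\<gamma> \<in> F" for \<gamma>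
    unfolding re by (intro trig_poly_add trig_poly_const trig_poly_character cnj_character chF that)
  then have "(\<lambda>x. complex_of_real (w x)) \<in> trig_poly"
    unfolding w_def of_real_prod by (intro trig_poly_prod)
  then have "(\<lambda>x. complex_of_real (1 / I n) * complex_of_real (w x) ^ n) \<in> trig_poly"
    by (intro trig_poly_mult trig_poly_power trig_poly_const)
  then have "P \<in> trig_poly" by (simp add: P_def[abs_def])
  then obtain J0 p0 where J0: "finite J0" "J0 \<subseteq> characters" "P = (\<lambda>x. \<Sum>\<gamma>\<in>J0. p0 \<gamma> * \<gamma> x)"
    unfolding trig_poly_def by blast
  \<comment> \<open>Adjoining \<open>F\<close> with zero coefficients gives
    \<open>F \<subseteq> J\<close> at once.\<close>
  define J where "J = J0 \<union> F"
  define p where "p \<gamma> = (if \<gamma> \<in> J0 then p0 \<gamma> else 0)" for \<gamma>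
  have J: "finite J" "J \<subseteq> characters" using J0 F by (auto simp: J_def)
  have P: "P x = (\<Sum>\<gamma>\<in>J. p \<gamma> * \<gamma> x)" for x
    unfolding J0(3) J_def p_def using J0(1) F(1) by (intro sum.mono_neutral_cong_left) auto
  have contP: "continuous_on UNIV P" unfolding P_def using Ipos[of n] by (intro continuous_intros cont) auto
  show ?thesis
  proof (rule that[OF J(1) _ J(2)])
    show "F \<subseteq> J" by (simp add: J_def)
    fix a
    have "(\<integral>x. cmod (P (x + a)) \<partial>m) = 1"
    proof -
      have "complex_of_real (\<integral>x. cmod (P (x + a)) \<partial>m) = (\<integral>x. P (x + a) \<partial>m)"
      proof -
        have "complex_of_real (cmod (P x)) = P x" for x
        proof -
          have "0 \<le> w x ^ n / I n" using w01(1)[of x] Ipos[of n] by simp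
          then show ?thesis unfolding P_def norm_of_real by (simp only: abs_of_nonneg)
        qed
        then show ?thesis by (simp only: integral_complex_of_real[symmetric])
      qed
      also have "\<dots> = (\<integral>x. P x \<partial>m)" by (rule integral_translate[OF contP])
      also have "\<dots> = 1" using Ipos[of n] unfolding P_def integral_complex_of_real by (simp add: I_def)
      finally show ?thesis by (simp only: of_real_eq_1_iff)
    qed
    then show "(\<integral>x. cmod (\<Sum>\<gamma>\<in>J. p \<gamma> * \<gamma> (x + a)) \<partial>m) = 1" by (simp add: P)
  next
    fix \<gamma> assume \<gamma>: "\<gamma> \<in> F"
    note ch = chF[OF \<gamma>]
    have \<gamma>J: "\<gamma> \<in> J" using \<gamma> by (simp add: J_def)
    have intc: "integrable m (\<lambda>x. cnj (\<gamma> x) * P x)"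
      by (intro integrable_continuous continuous_intros contP charactersD(1) ch)
    have "(\<integral>x. cnj (\<gamma> x) * P x \<partial>m) = (\<Sum>\<epsilon>\<in>J. \<integral>x. p \<epsilon> * (cnj (\<gamma> x) * \<epsilon> x) \<partial>m)"
    proof -
      have "(\<lambda>x. cnj (\<gamma> x) * P x) = (\<lambda>x. \<Sum>\<epsilon>\<in>J. p \<epsilon> * (cnj (\<gamma> x) * \<epsilon> x))"
        by (simp add: P sum_distrib_left mult.left_commute)
      moreover have "integrable m (\<lambda>x. p \<epsilon> * (cnj (\<gamma> x) * \<epsilon> x))" if "\<epsilon> \<in> J" for \<epsilon>
        using J(2) that by (intro integrable_continuous continuous_intros charactersD(1) ch) auto
      ultimately show ?thesis by (simp only: Bochner_Integration.integral_sum)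
    qed
    also have "\<dots> = (\<Sum>\<epsilon>\<in>J. if \<epsilon> = \<gamma> then p \<gamma> else 0)"
      using J character_orthogonality[OF _ ch] by (intro sum.cong) auto
    also have "\<dots> = p \<gamma>" using J(1) \<gamma>J by simp
    finally have coeff: "p \<gamma> = (\<integral>x. cnj (\<gamma> x) * P x \<partial>m)" ..
    \<comment> \<open>For \<open>\<gamma> \<in> F\<close> the real part of \<open>\<gamma>\<close>
      is at least \<open>2 * w - 1\<close>, and the mean of \<open>w\<close> for the density
      \<open>P\<close> is at least \<open>3/4\<close>, whence
      \<open>2 * (3/4) - 1 = 1/2\<close>.\<close>
    have "1 / 2 \<le> (2 * I (Suc n) - I n) / I n"
      using n Ipos[of n] by (simp add: pos_le_divide_eq)
    also have "\<dots> = (\<integral>x. (2 * w x ^ Suc n - w x ^ n) / I n \<partial>m)"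
      using int[of n] int[of "Suc n"] by (simp add: I_def del: power_Suc)
    also have "\<dots> \<le> (\<integral>x. Re (cnj (\<gamma> x) * P x) \<partial>m)"
    proof (rule integral_mono)
      show "integrable m (\<lambda>x. (2 * w x ^ Suc n - w x ^ n) / I n)"
        using int[of n] int[of "Suc n"] by (simp del: power_Suc)
      show "integrable m (\<lambda>x. Re (cnj (\<gamma> x) * P x))" by (rule integrable_Re[OF intc])
      fix x
      have "(2 * w x - 1) * (w x ^ n / I n) \<le> Re (\<gamma> x) * (w x ^ n / I n)"
        using w_le[OF \<gamma>, of x] w01(1)[of x] Ipos[of n] by (intro mult_right_mono) auto
      then show "(2 * w x ^ Suc n - w x ^ n) / I n \<le> Re (cnj (\<gamma> x) * P x)"
        by (simp add: P_def algebra_simps diff_divide_distrib)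
    qed
    also have "\<dots> = Re (p \<gamma>)" unfolding coeff by (rule integral_Re[OF intc])
    also have "\<dots> \<le> cmod (p \<gamma>)" by (rule complex_Re_le_cmod)
    finally show "1 / 2 \<le> cmod (p \<gamma>)" .
  qed
qed

section \<open>Factorization implies summability\<close>

definition char_measure :: "('g \<Rightarrow> complex) \<Rightarrow> 'g cmeasure" where
  "char_measure \<gamma> = density_cmeasure (char_fun \<gamma>)"

lemma conv_operator_char_measure:
  assumes "\<gamma> \<in> characters"
  shows "conv_operator f (char_measure \<gamma>) = fourier_coeff m f \<gamma> *\<^sub>C char_fun \<gamma>"
proof -
  have "cm_integral (char_measure \<gamma>) (\<lambda>h. f (g - h)) =
      apply_bcontfun (fourier_coeff m f \<gamma> *\<^sub>C char_fun \<gamma>) g" for g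
    using cm_integral_density[OF compact_imp_closed, of "char_fun \<gamma>" "reflect g f"]
      integral_conv_character[OF assms, of f g]
    by (simp add: char_measure_def reflect_apply char_fun_apply[OF assms])
  then show ?thesis by (simp only: conv_operator_def apply_bcontfun_inverse)
qed

text \<open>Integrate \<open>\<parallel>B (P\<^sub>a m)\<parallel>\<^sup>2\<close> over the translates \<open>P\<^sub>a\<close> of the positive kernel \<open>P\<close>: each
  \<open>P\<^sub>a m\<close> has norm \<open>1\<close>, and the coefficients of \<open>P\<close> on \<open>F\<close> are at least \<open>1/2\<close>.\<close>

lemma sum_norm_char_measure_le:
  fixes B :: "'g cmeasure \<Rightarrow> 'h::complex_hilbert"
  assumes B: "bounded_clinear B" "\<And>\<mu>. norm (B \<mu>) \<le> K * norm \<mu>" and K: "0 \<le> K"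
    and F: "finite F" "F \<subseteq> characters"
  shows "(\<Sum>\<gamma>\<in>F. (norm (B (char_measure \<gamma>)))\<^sup>2) \<le> 4 * K\<^sup>2"
proof -
  obtain J p where J: "finite J" "F \<subseteq> J" "J \<subseteq> characters"
    "\<And>a. (\<integral>x. cmod (\<Sum>\<gamma>\<in>J. p \<gamma> * \<gamma> (x + a)) \<partial>m) = 1" "\<And>\<gamma>. \<gamma> \<in> F \<Longrightarrow> 1 / 2 \<le> cmod (p \<gamma>)"
    by (rule positive_kernel[OF F]) blast
  have ch: "\<gamma> \<in> characters" if "\<gamma> \<in> J" for \<gamma> using J(3) that by auto
  let ?x = "\<lambda>\<gamma>. B (char_measure \<gamma>)"
  define v where "v a = (\<Sum>\<gamma>\<in>J. (p \<gamma> * \<gamma> a) *\<^sub>C ?x \<gamma>)" for a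
  have nv: "norm (v a) \<le> K" for a
  proof -
    define \<mu> where "\<mu> = density_cmeasure (\<Sum>\<gamma>\<in>J. (p \<gamma> * \<gamma> a) *\<^sub>C char_fun \<gamma>)"
    have "apply_bcontfun (\<Sum>\<gamma>\<in>J. (p \<gamma> * \<gamma> a) *\<^sub>C char_fun \<gamma>) x = (\<Sum>\<gamma>\<in>J. p \<gamma> * \<gamma> (x + a))" for x
    proof -
      have "apply_bcontfun (\<Sum>\<gamma>\<in>J. (p \<gamma> * \<gamma> a) *\<^sub>C char_fun \<gamma>) x =
          (\<Sum>\<gamma>\<in>J. apply_bcontfun ((p \<gamma> * \<gamma> a) *\<^sub>C char_fun \<gamma>) x)"
        by (rule linear_sum[OF bounded_linear.linear[OF bounded_linear_apply_bcontfun]])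
      then show ?thesis by (simp add: char_fun_apply ch charactersD(3) ac_simps)
    qed
    then have "norm \<mu> \<le> 1"
      using norm_density_cmeasure[OF compact_imp_closed, of "\<Sum>\<gamma>\<in>J. (p \<gamma> * \<gamma> a) *\<^sub>C char_fun \<gamma>"] J(4)[of a]
      by (simp add: \<mu>_def)
    moreover have "v a = B \<mu>"
    proof -
      have "\<mu> = (\<Sum>\<gamma>\<in>J. (p \<gamma> * \<gamma> a) *\<^sub>C char_measure \<gamma>)"
        unfolding \<mu>_def char_measure_def by (rule density_cmeasure_sum[OF compact_imp_closed J(1)])
      then show ?thesis
        unfolding v_def by (simp only: clinear_sum[where T = B, OF bounded_clinearD(2,3)[OF B(1)]])
    qed
    ultimately show ?thesis
      using B(2)[of \<mu>] mult_left_le[OF _ K, of "norm \<mu>"] by simp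
  qed
  have contJ [continuous_intros]: "continuous_on S \<gamma>" if "\<gamma> \<in> J" for \<gamma> and S :: "'g set"
    using charactersD(1)[OF ch[OF that]] continuous_on_subset by blast
  \<comment> \<open>After integration over \<open>a\<close>, orthogonality of characters keeps only
    the terms with \<open>\<delta> = \<gamma>\<close>.\<close>
  have expand: "cinner (v a) (v a) = (\<Sum>\<gamma>\<in>J. \<Sum>\<delta>\<in>J. (p \<gamma> * cnj (p \<delta>) * cinner (?x \<gamma>) (?x \<delta>)) * (cnj (\<delta> a) * \<gamma> a))" for a
    by (simp add: v_def hil.ip_sum_left hil.ip_sum_right hil.ip_scale_left hil.ip_scale_right
        sum_distrib_left ac_simps) (rule sum.swap)
  have inte: "integrable m (\<lambda>a. c * (cnj (\<delta> a) * \<gamma> a))" if "\<gamma> \<in> J" "\<delta> \<in> J" for \<gamma> \<delta> and c :: complex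
    using that by (intro integrable_continuous continuous_intros)
  have "(\<integral>a. cinner (v a) (v a) \<partial>m) =
      (\<Sum>\<gamma>\<in>J. \<Sum>\<delta>\<in>J. \<integral>a. (p \<gamma> * cnj (p \<delta>) * cinner (?x \<gamma>) (?x \<delta>)) * (cnj (\<delta> a) * \<gamma> a) \<partial>m)"
    unfolding expand
    by (subst Bochner_Integration.integral_sum, (intro Bochner_Integration.integrable_sum inte; assumption))
      (intro sum.cong refl Bochner_Integration.integral_sum inte; assumption)
  also have "\<dots> = (\<Sum>\<gamma>\<in>J. \<Sum>\<delta>\<in>J. if \<delta> = \<gamma> then p \<gamma> * cnj (p \<gamma>) * cinner (?x \<gamma>) (?x \<gamma>) else 0)"
    by (intro sum.cong refl) (simp add: character_orthogonality ch)
  also have "\<dots> = (\<Sum>\<gamma>\<in>J. of_real ((cmod (p \<gamma>))\<^sup>2 * (norm (?x \<gamma>))\<^sup>2))"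
    using J(1) by (simp add: hil.ip_self of_real_mult complex_norm_square[symmetric] del: of_real_power)
  finally have eq: "complex_of_real (\<Sum>\<gamma>\<in>J. (cmod (p \<gamma>))\<^sup>2 * (norm (?x \<gamma>))\<^sup>2) = (\<integral>a. cinner (v a) (v a) \<partial>m)"
    by simp
  have "(\<Sum>\<gamma>\<in>J. (cmod (p \<gamma>))\<^sup>2 * (norm (?x \<gamma>))\<^sup>2) = cmod (\<integral>a. cinner (v a) (v a) \<partial>m)"
    unfolding eq[symmetric] norm_of_real by (simp add: sum_nonneg)
  also have "\<dots> \<le> K\<^sup>2"
  proof (rule norm_integral_le)
    show "cmod (cinner (v a) (v a)) \<le> K\<^sup>2" for a
      using power_mono[OF nv[of a], of 2] by (simp add: hil.ip_self norm_power)
    show "continuous_on UNIV (\<lambda>a. cinner (v a) (v a))"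
      unfolding expand by (intro continuous_intros)
  qed
  finally have le: "(\<Sum>\<gamma>\<in>J. (cmod (p \<gamma>))\<^sup>2 * (norm (?x \<gamma>))\<^sup>2) \<le> K\<^sup>2" .
  \<comment> \<open>The factor \<open>4\<close> is the inverse square of the lower bound
    \<open>1/2\<close> for \<open>p\<close>.\<close>
  have "(\<Sum>\<gamma>\<in>F. (norm (?x \<gamma>))\<^sup>2) \<le> (\<Sum>\<gamma>\<in>F. 4 * ((cmod (p \<gamma>))\<^sup>2 * (norm (?x \<gamma>))\<^sup>2))"
  proof (rule sum_mono)
    fix \<gamma> assume "\<gamma> \<in> F"
    then have "(1/2)\<^sup>2 \<le> (cmod (p \<gamma>))\<^sup>2" by (intro power_mono J(5)) auto
    then have "1 \<le> 4 * (cmod (p \<gamma>))\<^sup>2" by (simp add: power2_eq_square)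
    then have "1 * (norm (?x \<gamma>))\<^sup>2 \<le> (4 * (cmod (p \<gamma>))\<^sup>2) * (norm (?x \<gamma>))\<^sup>2" by (rule mult_right_mono) simp
    then show "(norm (?x \<gamma>))\<^sup>2 \<le> 4 * ((cmod (p \<gamma>))\<^sup>2 * (norm (?x \<gamma>))\<^sup>2)" by simp
  qed
  also have "\<dots> \<le> (\<Sum>\<gamma>\<in>J. 4 * ((cmod (p \<gamma>))\<^sup>2 * (norm (?x \<gamma>))\<^sup>2))"
    by (intro sum_mono2 J) auto
  also have "\<dots> = 4 * (\<Sum>\<gamma>\<in>J. (cmod (p \<gamma>))\<^sup>2 * (norm (?x \<gamma>))\<^sup>2)" by (simp add: sum_distrib_left)
  also have "\<dots> \<le> 4 * K\<^sup>2" using le by simp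
  finally show ?thesis .
qed

text \<open>Evaluation of \<open>A\<close> at \<open>x\<close> is a functional of norm at most
  \<open>K\<close>. On the test vector \<open>v\<close> it takes the value \<open>S\<close>, while
  \<open>(norm v) ^ 2 <= S\<close>; hence \<open>S ^ 2 <= K ^ 2 * S\<close>.\<close>

lemma sum_cmod_orthonormal_le:
  fixes A :: "'h::complex_hilbert \<Rightarrow> ('g \<Rightarrow>\<^sub>C complex)"
  assumes A: "bounded_clinear A" "\<And>v. norm (A v) \<le> K * norm v" and K: "0 \<le> K"
    and w: "\<And>m n. m \<noteq> n \<Longrightarrow> cinner (w m) (w n) = 0" "\<And>n :: nat. norm (w n) \<le> 1"
  shows "(\<Sum>n<N. (cmod (A (w n) x))\<^sup>2) \<le> K\<^sup>2"
proof -
  define S where "S = (\<Sum>n<N. (cmod (A (w n) x))\<^sup>2)"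
  define v where "v = (\<Sum>n<N. cnj (A (w n) x) *\<^sub>C w n)"
  have S0: "0 \<le> S" by (simp add: S_def sum_nonneg)
  have wv: "cinner (w n) v = A (w n) x * cinner (w n) (w n)" if "n < N" for n
  proof -
    have "cinner (w n) v = (\<Sum>k<N. if k = n then A (w n) x * cinner (w n) (w n) else 0)"
      unfolding v_def hil.ip_sum_right hil.ip_scale_right using w(1) by (intro sum.cong) auto
    then show ?thesis using that by simp
  qed
  have "cinner v v = (\<Sum>n<N. cnj (A (w n) x) * cinner (w n) v)"
    by (subst (1) v_def) (simp only: hil.ip_sum_left hil.ip_scale_left)
  also have "\<dots> = of_real (\<Sum>n<N. (cmod (A (w n) x))\<^sup>2 * (norm (w n))\<^sup>2)"
    unfolding of_real_sum of_real_mult complex_norm_square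
    by (intro sum.cong refl) (simp add: wv hil.ip_self ac_simps)
  finally have "(norm v)\<^sup>2 = (\<Sum>n<N. (cmod (A (w n) x))\<^sup>2 * (norm (w n))\<^sup>2)"
    unfolding hil.nrm_sq by simp
  also have "\<dots> \<le> S"
    unfolding S_def by (intro sum_mono mult_right_le_one_le power_le_one w) auto
  finally have nv: "(norm v)\<^sup>2 \<le> S" .
  have "A v = (\<Sum>n<N. cnj (A (w n) x) *\<^sub>C A (w n))"
    unfolding v_def by (rule clinear_sum) (rule bounded_clinearD[OF A(1)])+
  then have "apply_bcontfun (A v) x = (\<Sum>n<N. apply_bcontfun (cnj (A (w n) x) *\<^sub>C A (w n)) x)"
    by (simp only: linear_sum[OF bounded_linear.linear[OF bounded_linear_apply_bcontfun]])
  also have "\<dots> = of_real S"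
    by (simp add: S_def complex_norm_square mult.commute del: of_real_power)
  finally have "S = cmod (apply_bcontfun (A v) x)" using S0 by simp
  also have "\<dots> \<le> norm (A v)" by (rule norm_bounded)
  also have "\<dots> \<le> K * norm v" by (rule A)
  finally have "S\<^sup>2 \<le> (K * norm v)\<^sup>2" using S0 by (intro power_mono) auto
  also have "\<dots> \<le> K\<^sup>2 * S" unfolding power_mult_distrib by (intro mult_left_mono nv) simp
  finally have "S * S \<le> K\<^sup>2 * S" by (simp add: power2_eq_square)
  then have "S \<le> K\<^sup>2 \<or> S = 0" using S0 by (auto simp: mult_le_cancel_right)
  then show ?thesis unfolding S_def by auto
qed

text \<open>The Hilbert-Schmidt bound for \<open>A\<close> into \<open>L_2\<close>: Bessel for the
  characters reduces the sum to the integral of the pointwise square sum of the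
  \<open>A (w n)\<close>.\<close>

lemma sum_coefficients_orthonormal_le:
  fixes A :: "'h::complex_hilbert \<Rightarrow> ('g \<Rightarrow>\<^sub>C complex)"
  assumes A: "bounded_clinear A" "\<And>v. norm (A v) \<le> K * norm v" and K: "0 \<le> K"
    and F: "finite F" "F \<subseteq> characters"
    and w: "\<And>m n. m \<noteq> n \<Longrightarrow> cinner (w m) (w n) = 0" "\<And>n :: nat. norm (w n) \<le> 1"
  shows "(\<Sum>n<N. \<Sum>\<gamma>\<in>F. (cmod (fourier_coeff m (A (w n)) \<gamma>))\<^sup>2) \<le> K\<^sup>2"
proof -
  have ip: "fourier_coeff m u \<gamma> = ip2 u (char_fun \<gamma>)" if "\<gamma> \<in> F" for u \<gamma>
  proof -
    have "\<gamma> \<in> characters" using F(2) that by auto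
    then show ?thesis by (simp add: fourier_coeff_def ip2_def char_fun_apply mult.commute)
  qed
  have "(\<Sum>n<N. \<Sum>\<gamma>\<in>F. (cmod (fourier_coeff m (A (w n)) \<gamma>))\<^sup>2) \<le> (\<Sum>n<N. (L2.nrm (A (w n)))\<^sup>2)"
  proof (rule sum_mono)
    fix n
    have "(\<Sum>\<gamma>\<in>F. (cmod (ip2 (A (w n)) (char_fun \<gamma>)))\<^sup>2) \<le> (L2.nrm (A (w n)))\<^sup>2"
    proof (rule L2.Bessel[OF F(1)])
      fix \<gamma> \<delta> assume g: "\<gamma> \<in> F" "\<delta> \<in> F" "\<gamma> \<noteq> \<delta>"
      then have "\<gamma> \<in> characters" "\<delta> \<in> characters" using F(2) by auto
      then show "ip2 (char_fun \<gamma>) (char_fun \<delta>) = 0"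
        using g fourier_coeff_char_fun[of \<gamma> \<delta>] ip[of \<delta> "char_fun \<gamma>"] by simp
    next
      fix \<gamma> assume "\<gamma> \<in> F"
      then have "\<gamma> \<in> characters" using F(2) by auto
      then show "L2.nrm (char_fun \<gamma>) \<le> 1" using L2_nrm_le_norm norm_char_fun order_trans by blast
    qed
    then show "(\<Sum>\<gamma>\<in>F. (cmod (fourier_coeff m (A (w n)) \<gamma>))\<^sup>2) \<le> (L2.nrm (A (w n)))\<^sup>2"
      by (simp add: ip)
  qed
  also have "\<dots> = (\<integral>x. (\<Sum>n<N. (cmod (A (w n) x))\<^sup>2) \<partial>m)"
    unfolding L2_nrm_sq
    by (rule Bochner_Integration.integral_sum[symmetric]) (intro integrable_continuous_real continuous_intros)
  also have "\<dots> \<le> (\<integral>x. K\<^sup>2 \<partial>m)"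
    by (intro integral_mono integrable_continuous_real continuous_intros sum_cmod_orthonormal_le[OF A K w]) auto
  finally show ?thesis by simp
qed

lemma bounded_clinear_fourier_coeff_comp:
  fixes A :: "'h::complex_hilbert \<Rightarrow> ('g \<Rightarrow>\<^sub>C complex)"
  assumes A: "bounded_clinear A" and \<gamma>: "\<gamma> \<in> characters"
  shows "bounded_clinear (\<lambda>v. fourier_coeff m (A v) \<gamma>)"
  unfolding bounded_clinear_def
  using bounded_linear_compose[OF bounded_linear_fourier_coeff[OF \<gamma>] bounded_clinearD(1)[OF A]]
  by (auto simp: bounded_clinearD(3)[OF A] fourier_coeff_scale scaleC_complex_def)

theorem factors_imp_summable:
  assumes s: "0 < s" "s \<le> 1" and r: "0 < r" "1 / r = 1 / ereal s - 1"
    and fact: "factors_through_schatten TYPE('h::complex_hilbert) r (conv_operator f)"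
  shows "(\<lambda>\<gamma>. cmod (fourier_coeff m f \<gamma>) powr s) summable_on characters"
proof -
  obtain B :: "'g cmeasure \<Rightarrow> 'h" and U and A :: "'h \<Rightarrow> 'g \<Rightarrow>\<^sub>C complex"
    where B: "bounded_clinear B" and Us: "U \<in> schatten_class r" and A: "bounded_clinear A"
      and T: "conv_operator f = A \<circ> U \<circ> B"
    using fact unfolding factors_through_schatten_def by blast
  have U: "bounded_clinear U"
    using Us by (auto simp: schatten_class_def compact_operator_def split: if_splits)
  obtain KB where KB: "0 \<le> KB" "\<And>\<mu>. norm (B \<mu>) \<le> KB * norm \<mu>" using bounded_clinearD(7)[OF B] by blast
  obtain KA where KA: "0 \<le> KA" "\<And>v. norm (A v) \<le> KA * norm v" using bounded_clinearD(7)[OF A] by blast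
  let ?t = "fourier_coeff m f"
  have "\<forall>\<gamma>. \<exists>y. \<gamma> \<in> characters \<longrightarrow> (\<forall>v. fourier_coeff m (A v) \<gamma> = cinner v y)"
    using Riesz_representation[OF bounded_clinear_fourier_coeff_comp[OF A]] by blast
  then obtain y where y: "\<And>\<gamma> v. \<gamma> \<in> characters \<Longrightarrow> fourier_coeff m (A v) \<gamma> = cinner v (y \<gamma>)" by metis
  \<comment> \<open>Between the columns \<open>x \<gamma>\<close> and the rows
    \<open>y \<delta>\<close> the matrix of \<open>U\<close> is diagonal, with the Fourier
    coefficients as entries.\<close>
  define x where "x \<gamma> = B (char_measure \<gamma>)" for \<gamma>
  have diag: "cinner (U (x \<gamma>)) (y \<delta>) = (if \<gamma> = \<delta> then ?t \<gamma> else 0)"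
    if "\<gamma> \<in> characters" "\<delta> \<in> characters" for \<gamma> \<delta>
  proof -
    have "A (U (x \<gamma>)) = ?t \<gamma> *\<^sub>C char_fun \<gamma>"
      using conv_operator_char_measure[OF that(1), of f] by (simp add: T x_def)
    then show ?thesis
      using that by (simp add: y[OF that(2), symmetric] fourier_coeff_scale fourier_coeff_char_fun)
  qed
  \<comment> \<open>\<open>Q\<close> collects what the cases of finite and infinite \<open>r\<close>
    both supply about \<open>U\<close>.\<close>
  define Q where "Q u \<sigma> \<rho> c C3 \<longleftrightarrow> (\<forall>n v. (\<forall>k<n. cinner v (u k) = 0) \<longrightarrow> norm (U v) \<le> \<sigma> n * norm v) \<and>
      (\<forall>a b n. 0 \<le> a \<longrightarrow> 0 \<le> b \<longrightarrow> (a * (\<sigma> n)\<^sup>2 * b) powr (s / 2) \<le> c * (a + b) + \<rho> n) \<and>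
      (\<forall>n. 0 \<le> \<rho> n) \<and> (\<forall>N. (\<Sum>n<N. \<rho> n) \<le> C3) \<and> 0 \<le> c"
    for u :: "nat \<Rightarrow> 'h" and \<sigma> \<rho> :: "nat \<Rightarrow> real" and c C3 :: real
  have "\<exists>u \<sigma> \<rho> c C3. Q u \<sigma> \<rho> c C3"
  proof (cases "r = \<infinity>")
    case True
    then have "1 / ereal s = 1" using r s by (cases "1 / ereal s") (auto simp: one_ereal_def)
    then have s1: "s = 1" using s by (simp add: one_ereal_def)
    obtain KU where KU: "0 \<le> KU" "\<And>v. norm (U v) \<le> KU * norm v" using bounded_clinearD(7)[OF U] by blast
    have "(a * KU\<^sup>2 * b) powr (s / 2) \<le> KU * (a + b) + 0" if "0 \<le> a" "0 \<le> b" for a b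
    proof -
      have "(a * KU\<^sup>2 * b) powr (s / 2) = sqrt (a * KU\<^sup>2 * b)"
        using that by (simp add: s1 powr_half_sqrt)
      also have "\<dots> \<le> sqrt ((KU * (a + b))\<^sup>2)"
      proof (rule real_sqrt_le_mono)
        have "a * b \<le> (a + b)\<^sup>2" using that by (simp add: power2_sum)
        then have "KU\<^sup>2 * (a * b) \<le> KU\<^sup>2 * (a + b)\<^sup>2" by (rule mult_left_mono) simp
        then show "a * KU\<^sup>2 * b \<le> (KU * (a + b))\<^sup>2" by (simp add: power_mult_distrib ac_simps)
      qed
      also have "\<dots> = KU * (a + b)" using that KU(1) by simp
      finally show ?thesis by simp
    qed
    \<comment> \<open>Zero vectors impose no orthogonality condition: the norm bound of
      \<open>U\<close> holds everywhere.\<close>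
    then have "Q (\<lambda>_. 0) (\<lambda>_. KU) (\<lambda>_. 0) KU 0" unfolding Q_def using KU by simp
    then show ?thesis by blast
  next
    case False
    then obtain q where q: "r = ereal q" "0 < q" using r(1) by (cases r) auto
    have qs: "1 / q = 1 / s - 1" using r(2) s q by (simp add: one_ereal_def)
    obtain \<sigma> where comp: "compact_operator U" and \<sigma>: "is_singular_numbers U \<sigma>" "summable (\<lambda>n. \<sigma> n powr q)"
      using Us q by (auto simp: schatten_class_def)
    have \<sigma>0: "0 \<le> \<sigma> n" for n using \<sigma>(1) by (simp add: is_singular_numbers_def)
    obtain u where u: "\<forall>n v. (\<forall>k<n. cinner v (u k) = 0) \<longrightarrow> norm (U v) \<le> \<sigma> n * norm v"
      using singular_numbers_bound[OF comp \<sigma>(1)] by blast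
    have "(\<Sum>n<N. \<sigma> n powr q) \<le> suminf (\<lambda>n. \<sigma> n powr q)" for N
      by (rule sum_le_suminf[OF \<sigma>(2)]) auto
    moreover have "(a * (\<sigma> n)\<^sup>2 * b) powr (s / 2) \<le> 1 * (a + b) + \<sigma> n powr q" if "0 \<le> a" "0 \<le> b" for a b n
      using three_factor_bound[OF that \<sigma>0 q(2) s(1) qs] by simp
    ultimately have "Q u \<sigma> (\<lambda>n. \<sigma> n powr q) 1 (suminf (\<lambda>n. \<sigma> n powr q))"
      unfolding Q_def using u by auto
    then show ?thesis by blast
  qed
  then obtain u \<sigma> \<rho> c C3 where Q: "Q u \<sigma> \<rho> c C3" by blast
  have u: "norm (U v) \<le> \<sigma> n * norm v" if "\<And>k. k < n \<Longrightarrow> cinner v (u k) = 0" for n v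
    using Q that unfolding Q_def by blast
  have \<rho>: "0 \<le> a \<Longrightarrow> 0 \<le> b \<Longrightarrow> (a * (\<sigma> n)\<^sup>2 * b) powr (s / 2) \<le> c * (a + b) + \<rho> n"
    "0 \<le> \<rho> n" "(\<Sum>n<N. \<rho> n) \<le> C3" "0 \<le> c" for a b n N
    using Q unfolding Q_def by blast+
  \<comment> \<open>The bound is independent of \<open>F\<close>; \<open>4 * KB^2\<close> and
    \<open>KA^2\<close> are the Hilbert-Schmidt bounds of the outer factors.\<close>
  have "(\<Sum>\<gamma>\<in>F. cmod (?t \<gamma>) powr s) \<le> 3 * (c * (4 * KB\<^sup>2 + KA\<^sup>2) + C3)"
    if F: "finite F" "F \<subseteq> characters" for F
  proof (rule sum_powr_diagonal_le[OF U F(1) _ u _ _ \<rho> s(1)])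
    show "cinner (U (x i)) (y j) = (if i = j then ?t i else 0)" if "i \<in> F" "j \<in> F" for i j
      using that F(2) by (intro diag) auto
    show "(\<Sum>\<gamma>\<in>F. (norm (x \<gamma>))\<^sup>2) \<le> 4 * KB\<^sup>2"
      unfolding x_def by (rule sum_norm_char_measure_le[OF B KB(2,1) F])
    fix w :: "nat \<Rightarrow> 'h" and N
    assume w: "\<And>m n. m \<noteq> n \<Longrightarrow> cinner (w m) (w n) = 0" "\<And>n. norm (w n) \<le> 1"
    have "(\<Sum>n<N. \<Sum>\<gamma>\<in>F. (cmod (cinner (w n) (y \<gamma>)))\<^sup>2) =
        (\<Sum>n<N. \<Sum>\<gamma>\<in>F. (cmod (fourier_coeff m (A (w n)) \<gamma>))\<^sup>2)"
      using F(2) by (intro sum.cong refl) (simp add: y subsetD)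
    also have "\<dots> \<le> KA\<^sup>2" by (rule sum_coefficients_orthonormal_le[OF A KA(2,1) F w])
    finally show "(\<Sum>n<N. \<Sum>\<gamma>\<in>F. (cmod (cinner (w n) (y \<gamma>)))\<^sup>2) \<le> KA\<^sup>2" .
  qed
  then show ?thesis
    by (intro nonneg_bdd_above_summable_on bdd_aboveI) auto
qed

end

text \<open>The equivalence can name only one Hilbert space, so the second conjunct extends the
  converse to spaces of an arbitrary type \<open>'h\<close>.\<close>

theorem theorem3p11:
  fixes f :: "'g::{topological_ab_group_add, t2_space} \<Rightarrow>\<^sub>C complex"
    and m :: "'g measure" and s :: real and r :: ereal
  assumes "compact (UNIV :: 'g set)"
    and "normalized_haar_measure m"
    and "0 < s" and "s \<le> 1"
    and "0 < r" and "1 / r = 1 / ereal s - 1"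
  shows "((\<lambda>\<gamma>. cmod (fourier_coeff m f \<gamma>) powr s) summable_on characters \<longleftrightarrow>
          factors_through_schatten TYPE(('g \<Rightarrow> complex) ell2) r (conv_operator f)) \<and>
         (factors_through_schatten TYPE('h::complex_hilbert) r (conv_operator f) \<longrightarrow>
          (\<lambda>\<gamma>. cmod (fourier_coeff m f \<gamma>) powr s) summable_on characters)"
proof -
  interpret haar m by (rule haar.intro[OF assms(1,2)])
  show ?thesis
    by (intro conjI iffI impI) (rule summable_imp_factors[OF assms(3-6)] factors_imp_summable[OF assms(3-6)]; assumption)+
qed

end
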